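(* (Soundness of unzipping.) Let $\Gamma;\dot\Gamma\vdash e:(\tau;\sigma)$ be a Linear A judgment and $\theta$ an enumeration of $\dot\Gamma$. Then $$\mathcal U(\delta_\theta(e))\;\sim\;\delta_\theta(\mathcal U^{\mathrm{Jax}}(e)).$$
   Context: **Calculus $\lambda LL$.** Fix function symbols $\underline f$ with arities $n\ge 1$, each denoting a differentiable $f:\mathbb R^n\to\mathbb R$. Types: $A,B::=\mathbb R\mid A\multimap B\mid 1\mid A\otimes B\mid\top\mid A\& B\mid {!A}$. Each variable has a fixed type. Patterns: $p,q::=x\mid {!x}\mid ()\mid (p,q)\mid\langle p,q\rangle$, no variable repeated, typed by $x:A$, $!x:{!A}$ (for $x$ of type $A$), $():1$, $(p,q):A\otimes B$, $\langle p,q\rangle:A\& B$. An environment is a finite set of typed patterns with disjoint variables; $!\Gamma$ means all patterns are of the form $!x$; the comma is variable-disjoint union. Terms: $M,N::=x\mid {!M}\mid\lambda p.M\mid MN\mid ()\mid (M,N)\mid\langle\rangle\mid\langle M,N\rangle\mid\underline r\mid\underline f\mid\dot+\mid\dot*$ ($r\in\mathbb R$). Typing: $x:A\vdash x:A$; $!x:{!A}\vdash x:A$; $!\Gamma\vdash M:A\Rightarrow{!\Gamma}\vdash{!M}:{!A}$; $\Delta\vdash M:B\Rightarrow{!x}:{!A},\Delta\vdash M:B$; $p:A,\Delta\vdash M:B\Rightarrow\Delta\vdash\lambda p.M:A\multimap B$; if $!\Gamma_i,\Delta_i\vdash M_i:A_i$ ($i=1,2$) then $!\Gamma_1\cup{!\Gamma_2},\Delta_1,\Delta_2\vdash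 M_1M_2:B$ when $A_1=A_2\multimap B$, and $\vdash(M_1,M_2):A_1\otimes A_2$ in that same environment; $\vdash():1$; $\Delta\vdash M:B\Rightarrow():1,\Delta\vdash M:B$; $p:A,q:B,\Delta\vdash M:C\Rightarrow(p,q):A\otimes B,\Delta\vdash M:C$; $\Delta\vdash M_1:A_1$ and $\Delta\vdash M_2:A_2\Rightarrow\Delta\vdash\langle M_1,M_2\rangle:A_1\& A_2$; $p_i:A_i,\Delta\vdash M:B\Rightarrow\langle p_1,p_2\rangle:A_1\& A_2,\Delta\vdash M:B$ ($i=1$ or $2$); $\Delta\vdash\langle\rangle:\top$; $\vdash\underline r:\mathbb R$; $\Delta\vdash\underline0:\mathbb R$; $\vdash\underline f:({!\mathbb R}\otimes\dots\otimes{!\mathbb R})\multimap{!\mathbb R}$; $\vdash\dot+:\mathbb R\&\mathbb R\multimap\mathbb R$; $\vdash\dot*:\mathbb R\multimap\mathbb R\multimap\mathbb R$. Reduction $\rightarrow$ is the closure under all term contexts of: $(\lambda p.M)V\to M\{V/p\}$ for $V$ a value for $p$; $\underline f(!\underline{r_1},\dots,!\underline{r_n})\to{!\underline{f(r_1,\dots,r_n)}}$; $\dot+\langle\underline r,\underline s\rangle\to\underline{r+s}$; $\dot*\,\underline r\,\underline s\to\underline{rs}$. A value for $x$ is any term, for $!x$ any $!M$, for $()$ is $()$, for $(p_1,p_2)$ (resp. $\langle p_1,p_2\rangle$) a pair $(V_1,V_2)$ (resp. $\langle V_1,V_2\rangle$) of values for $p_1,p_2$; substitution acts componentwise, with $M\{!N/!x\}=M\{N/x\}$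 and $M\{()/()\}=M$. $=_\beta$ is the equivalence closure of $\rightarrow$. **Logical equivalence $\sim$.** On closed terms of the same type: $M\sim_{\mathbb R}N$ and $M\sim_1N$ iff $M=_\beta N$; $M\sim_{A_1\otimes A_2}N$ iff $M\to^*(M_1,M_2)$, $N\to^*(N_1,N_2)$ with $M_i\sim_{A_i}N_i$; $M\sim_{!A}N$ iff $M\to^*{!M'}$, $N\to^*{!N'}$ with $M'\sim_AN'$; $M\sim_\top N$ always; $M\sim_{A_1\& A_2}N$ iff $(\lambda\langle x_1,x_2\rangle.x_i)M\sim_{A_i}(\lambda\langle x_1,x_2\rangle.x_i)N$ for $i=1,2$; $M\sim_{A\multimap B}N$ iff $MM'\sim_BNN'$ whenever $M'\sim_AN'$. For $\Gamma=p_1:A_1,\dots,p_n:A_n$ and $\Gamma\vdash M,N:A$: $M\sim N$ iff $M\{V_i/p_i\}_i\sim_AN\{V'_i/p_i\}_i$ for all closed values $V_i,V'_i$ for $p_i$ with $V_i\sim_{A_i}V_i'$. **Abbreviations.** $\mathtt{let}\ p=N\ \mathtt{in}\ M:=(\lambda p.M)N$; $\S A:=1\& A$ and $\S M:=\langle(),M\rangle$ for terms and patterns $M$. $n$-ary tuples $\langle M_1,\dots,M_n\rangle$ (and $A_1\&\dots\& A_n$, and tuple patterns) are right-nested; the $1$-ary tuple is its component; the empty tuple is $\langle\rangle$, the empty $\&$ is $\top$, and the empty tuple pattern is a fresh variable of type $\top$. For types $H$ built from $\mathbb R,\top,\&$: $\underline0_{\mathbb R}=\underline0$, $\underline0_\top=\langle\rangle$,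 $\underline0_{H\& H'}=\langle\underline0_H,\underline0_{H'}\rangle$; $\dot+_{\mathbb R}=\dot+$, $\dot+_\top=\lambda\langle h,h'\rangle.\langle\rangle$, $\dot+_{H\& K}=\lambda\langle\langle h,k\rangle,\langle h',k'\rangle\rangle.\langle\dot+_H\langle h,h'\rangle,\dot+_K\langle k,k'\rangle\rangle$; for a variable $x:\mathbb R$: $\dot*_{\mathbb R}x=\dot*x$, $\dot*_\top x=\lambda h.\langle\rangle$, $\dot*_{H\& K}x=\lambda\langle h,k\rangle.\langle(\dot*_Hx)h,(\dot*_Kx)k\rangle$. **Linear A.** Types $\tau,\sigma::=\mathbb R\mid1\mid\tau\otimes\sigma$. There are primal variables $x,z,\dots$ and tangent variables $\dot x,\dot y,\dots$, with fixed types. Judgments $\Gamma;\dot\Gamma\vdash e:(\tau;\sigma)$ ($\Gamma$ primal context, $\dot\Gamma$ tangent context; comma = disjoint union, $\cup$ = union): - $x:\tau;\dot y:\sigma\vdash(x;\dot y):(\tau;\sigma)$; - $\Gamma_1;\dot\Gamma_1\vdash e_1:(\tau_1;\sigma_1)$ and $\Gamma_2,x:\tau_1;\dot\Gamma_2,\dot y:\sigma_1\vdash e_2:(\tau;\sigma)$ give $\Gamma_1\cup\Gamma_2;\dot\Gamma_1,\dot\Gamma_2\vdash\mathtt{let}\,(x;\dot y)=e_1\,\mathtt{in}\,e_2:(\tau;\sigma)$; - $;\vdash\otimes():(1;1)$; $;\vdash\dot\otimes():(1;1)$; - $\Gamma;\dot\Gamma\vdash e:(\tau;\sigma)$ gives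 $\Gamma,z:1;\dot\Gamma\vdash\mathtt{let}\otimes()=z\,\mathtt{in}\,e:(\tau;\sigma)$ and $\Gamma;\dot\Gamma,\dot z:1\vdash\mathtt{let}\,\dot\otimes()=\dot z\,\mathtt{in}\,e:(\tau;\sigma)$; - $;\dot x_1:\tau_1,\dot x_2:\tau_2\vdash\dot\otimes(\dot x_1,\dot x_2):(1;\tau_1\otimes\tau_2)$; $\Gamma;\dot\Gamma,\dot x_1:\tau_1,\dot x_2:\tau_2\vdash e:(\tau;\sigma)$ gives $\Gamma;\dot\Gamma,\dot z:\tau_1\otimes\tau_2\vdash\mathtt{let}\,\dot\otimes(\dot x_1,\dot x_2)=\dot z\,\mathtt{in}\,e:(\tau;\sigma)$; - $;\vdash\dot0_\tau:(1;\tau)$; $;\dot x:\tau,\dot y:\tau\vdash\dot x\,\dot+\,\dot y:(1;\tau)$; $x:\mathbb R;\dot y:\tau\vdash x\,\dot*\,\dot y:(1;\tau)$; $;\vdash\underline r:(\mathbb R;1)$; $x_1:\mathbb R,\dots,x_n:\mathbb R;\vdash\underline f(x_1,\dots,x_n):(\mathbb R;1)$; $;\dot x:\tau\vdash\mathrm{dup}(\dot x):(1;\tau\otimes\tau)$; $\Gamma;\dot\Gamma\vdash e:(\tau;\sigma)$ gives $\Gamma;\dot\Gamma\vdash\mathrm{drop}(e):(1;1)$. $FV^t(e)$ is the set of free tangent variables of $e$. **Syntactic sugar** (fresh auxiliary variables): $\mathtt{let}\,x=e_1\,\mathtt{in}\,e_2:=\mathtt{let}\,(x;\dot y)=e_1\,\mathtt{in}\,\mathtt{let}\,\dot\otimes()=\dot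 y\,\mathtt{in}\,e_2$; $\mathtt{let}\,\dot y=e_1\,\mathtt{in}\,e_2:=\mathtt{let}\,(x;\dot y)=e_1\,\mathtt{in}\,\mathtt{let}\otimes()=x\,\mathtt{in}\,e_2$; expression $x:=\mathtt{let}\,\dot y=\dot\otimes()\,\mathtt{in}\,(x;\dot y)$; expression $\dot y:=\mathtt{let}\,x=\otimes()\,\mathtt{in}\,(x;\dot y)$; $(e_1;e_2):=\mathtt{let}\,x=e_1\,\mathtt{in}\,\mathtt{let}\,\dot y=e_2\,\mathtt{in}\,(x;\dot y)$. **Unzipping $\mathcal U^{\mathrm{Jax}}$ on Linear A.** By induction, $\mathcal U^{\mathrm{Jax}}(e)=E[(e^p;\dot e)]$ with $E$ a (one-hole) stack of primal $\mathtt{let}$'s, $e^p$ a primal and $\dot e$ a tangent expression (bound variables renamed apart). Writing $\mathcal U^{\mathrm{Jax}}(e_i)=E_i[(e_i^p;\dot e_i)]$: - $(x;\dot y)\mapsto(x;\dot y)$; - $\mathtt{let}\,(x;\dot y)=e_1\,\mathtt{in}\,e_2\mapsto E_1[\mathtt{let}\,x=e_1^p\,\mathtt{in}\,E_2[(e_2^p;\,\mathtt{let}\,\dot y=\dot e_1\,\mathtt{in}\,\dot e_2)]]$; - $e\mapsto(e;\dot\otimes())$ for $e$ among $\otimes(),\underline r,\underline f(x_1,\dots,x_n)$; $e\mapsto(\otimes();e)$ for $e$ among $\dot\otimes(),\dot\otimes(\dot x_1,\dot x_2),\dot0_\tau,\dot x\dot+\dot y,x\dot*\dot y,\mathrm{dup}(\dot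 x)$; - $\mathtt{let}\otimes()=z\,\mathtt{in}\,e_1\mapsto\mathtt{let}\otimes()=z\,\mathtt{in}\,E_1[(e_1^p;\dot e_1)]$; - $\mathtt{let}\,\dot\otimes()=\dot z\,\mathtt{in}\,e_1\mapsto E_1[(e_1^p;\mathtt{let}\,\dot\otimes()=\dot z\,\mathtt{in}\,\dot e_1)]$, and similarly for $\mathtt{let}\,\dot\otimes(\dot x_1,\dot x_2)=\dot z\,\mathtt{in}\,e_1$; - $\mathrm{drop}(e_1)\mapsto E_1[(\mathrm{drop}(e_1^p);\mathrm{drop}(\dot e_1))]$. **Translation of types.** $\mathsf p(\mathbb R)=\mathbb R$, $\mathsf p(1)=1$, $\mathsf p(\tau\otimes\sigma)={!\mathsf p(\tau)}\otimes{!\mathsf p(\sigma)}$; $\mathsf t(\mathbb R)=\mathbb R$, $\mathsf t(1)=\top$, $\mathsf t(\tau\otimes\sigma)=\mathsf t(\tau)\&\mathsf t(\sigma)$. **Translation $\delta$.** For $\Gamma;\dot\Gamma\vdash e:(\tau;\sigma)$ and an enumeration $\theta$ of $\dot\Gamma=FV^t(e)$, $\delta_\theta(e)$ has type ${!\mathsf p(\tau)}\otimes\S((\&_{\dot y:\sigma'\in\theta}\mathsf t(\sigma'))\multimap\mathsf t(\sigma))$ in the environment $\{!x:{!\mathsf p(\tau')}\mid x:\tau'\in\Gamma\}$. Write $u_\theta=\langle u_{\dot y}\rangle_{\dot y\in\theta}$ for a tuple (pattern) of fresh variables $u_{\dot y}:\mathsf t(\sigma')$, for $\dot y:\sigma'$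 in $\theta$. - $\delta_\theta((x;\dot y))=(!x,\S(\lambda u_\theta.u_{\dot y}))$; - $\delta_\theta(\mathtt{let}\,(x;\dot y)=e_1\,\mathtt{in}\,e_2)=\mathtt{let}\,(!x,\S f)=\delta_{\theta_1}(e_1)\,\mathtt{in}\,\mathtt{let}\,(!z,\S g)=\delta_{\dot y,\theta_2}(e_2)\,\mathtt{in}\,(!z,\S(\lambda u_\theta.\,g\langle f\,u_{\theta_1},u_{\dot w}\rangle_{\dot w\in\theta_2}))$, where $\theta_i=\theta\cap FV^t(e_i)$ and the argument of $g$ is the tuple with first component $f\,u_{\theta_1}$ followed by $u_{\dot w}$, $\dot w\in\theta_2$; - $\delta_\theta(\otimes())=\delta_\theta(\dot\otimes())=(!(),\S(\lambda y^\top.\langle\rangle))$; $\delta_\theta(\mathtt{let}\otimes()=z\,\mathtt{in}\,e)=\mathtt{let}\,()=z\,\mathtt{in}\,\delta_\theta(e)$; - $\delta_\theta(\mathtt{let}\,\dot\otimes()=\dot z\,\mathtt{in}\,e)=\mathtt{let}\,(!x,\S f)=\delta_{\theta\setminus\dot z}(e)\,\mathtt{in}\,(!x,\S(\lambda u_\theta.f\,u_{\theta\setminus\dot z}))$; - $\delta_\theta(\dot\otimes(\dot x_1,\dot x_2))=(!(),\S(\lambda u_\theta.\langle u_{\dot x_1},u_{\dot x_2}\rangle))$; - $\delta_\theta(\mathtt{let}\,\dot\otimes(\dot x_1,\dot x_2)=\dot z\,\mathtt{in}\,e)=\mathtt{let}\,(!x,\S f)=\delta_{\dot x_1,\dot x_2,\theta\setminus\dot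 z}(e)\,\mathtt{in}\,(!x,\S(\lambda u_\theta[\langle x_1,x_2\rangle/u_{\dot z}].\,f\langle x_1,x_2,u_{\dot w}\rangle_{\dot w\in\theta\setminus\dot z}))$, where $u_\theta[\langle x_1,x_2\rangle/u_{\dot z}]$ is $u_\theta$ with $u_{\dot z}$ replaced by $\langle x_1,x_2\rangle$; - $\delta_\theta(\underline r)=(!\underline r,\S(\lambda y^\top.\langle\rangle))$; $\delta_\theta(\underline f(x_1,\dots,x_n))=(\underline f(!x_1,\dots,!x_n),\S(\lambda y^\top.\langle\rangle))$; $\delta_\theta(\dot0_\sigma)=(!(),\S(\lambda y^\top.\underline0_{\mathsf t(\sigma)}))$; - for $\dot y_1,\dot y_2,\dot y:\tau$: $\delta_\theta(\dot y_1\dot+\dot y_2)=(!(),\S(\lambda u_\theta.\dot+_{\mathsf t(\tau)}\langle u_{\dot y_1},u_{\dot y_2}\rangle))$; $\delta_\theta(x\dot*\dot y)=(!(),\S(\lambda u_\theta.(\dot*_{\mathsf t(\tau)}x)u_{\dot y}))$; $\delta_\theta(\mathrm{dup}(\dot y))=(!(),\S(\lambda u_\theta.\langle u_{\dot y},u_{\dot y}\rangle))$; - $\delta_\theta(\mathrm{drop}(e))=\mathtt{let}\,(!x,\S f)=\delta_\theta(e)\,\mathtt{in}\,(!(),\S(\lambda y.\mathtt{let}\ z=f\,y\ \mathtt{in}\,\langle\rangle))$. **Unzipping $\mathcal U$ in $\lambda LL$.** It is defined on terms $S::=(P,\S F)\mid\mathtt{let}\,(!x,\S f)=S_1\,\mathtt{in}\,S_2\mid\mathtt{let}\,\S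 f=\S F\,\mathtt{in}\,S_1\mid\mathtt{let}\,{!x}=P\,\mathtt{in}\,S_1\mid\mathtt{let}\,()=z\,\mathtt{in}\,S_1$ of type ${!E}\otimes\S(L\multimap H)$ (which include all $\delta_\theta(e)$), where $P$ ranges over terms of types ${!E}$ and $F$ over terms of types $L\multimap H$ ($L,H$ built from $\mathbb R,\top,\&$). Define $\mathcal U^\bullet(S)=(\epsilon[\,],P,F)$ ($\epsilon$ a one-hole context, bound variables renamed to avoid capture), writing $\mathcal U^\bullet(S_i)=(\epsilon_i[\,],P_i,F_i)$: $\mathcal U^\bullet((P,\S F))=([\,],P,F)$; $\mathcal U^\bullet(\mathtt{let}\,(!x,\S f)=S_1\,\mathtt{in}\,S_2)=(\epsilon_1[\mathtt{let}\,{!x}=P_1\,\mathtt{in}\,\epsilon_2[\,]],P_2,\mathtt{let}\,\S f=\S F_1\,\mathtt{in}\,F_2)$; $\mathcal U^\bullet(\mathtt{let}\,{!x}=P\,\mathtt{in}\,S_1)=(\mathtt{let}\,{!x}=P\,\mathtt{in}\,\epsilon_1[\,],P_1,F_1)$; $\mathcal U^\bullet(\mathtt{let}\,()=z\,\mathtt{in}\,S_1)=(\mathtt{let}\,()=z\,\mathtt{in}\,\epsilon_1[\,],P_1,F_1)$; $\mathcal U^\bullet(\mathtt{let}\,\S f=\S F\,\mathtt{in}\,S_1)=(\epsilon_1[\,],P_1,\mathtt{let}\,\S f=\S F\,\mathtt{in}\,F_1)$. Then $\mathcal U(S):=\epsilon[(P,\S F)]$. *)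

theory Defs
  imports "HOL-Analysis.L2_Norm"
begin

text \<open>
  Both calculi are formalised up to renaming of bound variables by means of de Bruijn indices.
  In lambda-LL a binder \<open>\<lambda>p. M\<close> binds as many indices as \<open>p\<close> has variables; the leftmost variable
  of \<open>p\<close> is index \<open>0\<close>.  Linear A has two independent index spaces, one for primal and one for
  tangent variables.
\<close>

section \<open>Function symbols\<close>

record 'f signature =
  arity :: "'f \<Rightarrow> nat"
  interp :: "'f \<Rightarrow> real list \<Rightarrow> real"

text \<open>Frechet differentiability on all of \<open>\<real>\<^sup>n\<close>, whose points are the lists of length \<open>n\<close>
  (the arity varies with the symbol, so a fixed Euclidean type cannot be used).\<close>

definition differentiable_Rn :: "nat \<Rightarrow> (real list \<Rightarrow> real) \<Rightarrow> bool" where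
  "differentiable_Rn n f \<longleftrightarrow>
    (\<forall>x. length x = n \<longrightarrow>
      (\<exists>d. length d = n \<and>
        (\<forall>\<epsilon>>0. \<exists>\<delta>>0. \<forall>h. length h = n \<and> L2_set ((!) h) {..<n} < \<delta> \<longrightarrow>
          \<bar>f (map2 (+) x h) - f x - (\<Sum>i<n. d ! i * h ! i)\<bar> \<le> \<epsilon> * L2_set ((!) h) {..<n})))"

definition wf_signature :: "'f signature \<Rightarrow> bool" where
  "wf_signature S \<longleftrightarrow> (\<forall>f. 1 \<le> arity S f \<and> differentiable_Rn (arity S f) (interp S f))"

text \<open>Right-nested tuples: \<open>nest f z [a\<^sub>1, \<dots>, a\<^sub>n] = f a\<^sub>1 (f a\<^sub>2 (\<dots> a\<^sub>n))\<close>.\<close>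

fun nest :: "('a \<Rightarrow> 'a \<Rightarrow> 'a) \<Rightarrow> 'a \<Rightarrow> 'a list \<Rightarrow> 'a" where
  "nest f z [] = z"
| "nest f z [a] = a"
| "nest f z (a # b # as) = f a (nest f z (b # as))"


section \<open>The calculus lambda-LL\<close>

datatype ty = RealT | Lolli ty ty | OneT | TensT ty ty | TopT | WithT ty ty | OfCourse ty

text \<open>\<open>PVar\<close> and \<open>PBang\<close> are the patterns \<open>x\<close> and \<open>!x\<close>.  In a binder the variables are anonymous
  and only their types \<open>A\<close> are recorded (\<open>ty pat\<close>; for \<open>PBang A\<close> the pattern itself has type
  \<open>!A\<close>).  In an environment they are pairs of an index and a type (\<open>(nat \<times> ty) pat\<close>).\<close>

datatype 'v pat = PVar 'v | PBang 'v | PUnit | PTens "'v pat" "'v pat" | PWith "'v pat" "'v pat"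

datatype 'f tm =
    Var nat | Bang "'f tm" | Lam "ty pat" "'f tm" | App "'f tm" "'f tm"
  | Unit | Tens "'f tm" "'f tm" | Top | With "'f tm" "'f tm"
  | Const real | Fun 'f | Plus | Times

primrec leaves :: "'v pat \<Rightarrow> 'v list" where
  "leaves (PVar v) = [v]"
| "leaves (PBang v) = [v]"
| "leaves PUnit = []"
| "leaves (PTens p q) = leaves p @ leaves q"
| "leaves (PWith p q) = leaves p @ leaves q"

definition plen :: "'v pat \<Rightarrow> nat" where
  "plen p = length (leaves p)"

primrec number :: "nat \<Rightarrow> ty pat \<Rightarrow> (nat \<times> ty) pat" where
  "number k (PVar A) = PVar (k, A)"
| "number k (PBang A) = PBang (k, A)"
| "number k PUnit = PUnit"
| "number k (PTens p q) = PTens (number k p) (number (k + plen p) q)"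
| "number k (PWith p q) = PWith (number k p) (number (k + plen p) q)"

text \<open>Since every variable carries its type, a pattern has exactly one type.\<close>

primrec pty :: "(nat \<times> ty) pat \<Rightarrow> ty" where
  "pty (PVar v) = snd v"
| "pty (PBang v) = OfCourse (snd v)"
| "pty PUnit = OneT"
| "pty (PTens p q) = TensT (pty p) (pty q)"
| "pty (PWith p q) = WithT (pty p) (pty q)"


subsection \<open>Renaming, substitution, reduction\<close>

definition liftn :: "nat \<Rightarrow> (nat \<Rightarrow> nat) \<Rightarrow> nat \<Rightarrow> nat" where
  "liftn k f = (\<lambda>i. if i < k then i else f (i - k) + k)"

primrec ren :: "(nat \<Rightarrow> nat) \<Rightarrow> 'f tm \<Rightarrow> 'f tm" where
  "ren f (Var i) = Var (f i)"
| "ren f (Bang M) = Bang (ren f M)"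
| "ren f (Lam p M) = Lam p (ren (liftn (plen p) f) M)"
| "ren f (App M N) = App (ren f M) (ren f N)"
| "ren f Unit = Unit"
| "ren f (Tens M N) = Tens (ren f M) (ren f N)"
| "ren f Top = Top"
| "ren f (With M N) = With (ren f M) (ren f N)"
| "ren f (Const r) = Const r"
| "ren f (Fun g) = Fun g"
| "ren f Plus = Plus"
| "ren f Times = Times"

definition lifts :: "nat \<Rightarrow> (nat \<Rightarrow> 'f tm) \<Rightarrow> nat \<Rightarrow> 'f tm" where
  "lifts k s = (\<lambda>i. if i < k then Var i else ren (\<lambda>j. j + k) (s (i - k)))"

primrec subst :: "(nat \<Rightarrow> 'f tm) \<Rightarrow> 'f tm \<Rightarrow> 'f tm" where
  "subst s (Var i) = s i"
| "subst s (Bang M) = Bang (subst s M)"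
| "subst s (Lam p M) = Lam p (subst (lifts (plen p) s) M)"
| "subst s (App M N) = App (subst s M) (subst s N)"
| "subst s Unit = Unit"
| "subst s (Tens M N) = Tens (subst s M) (subst s N)"
| "subst s Top = Top"
| "subst s (With M N) = With (subst s M) (subst s N)"
| "subst s (Const r) = Const r"
| "subst s (Fun g) = Fun g"
| "subst s Plus = Plus"
| "subst s Times = Times"

text \<open>The values for \<open>p\<close> are exactly the terms \<open>value_of s p\<close>, where \<open>s\<close> assigns an arbitrary term to
  each variable of \<open>p\<close>; the substitution \<open>M{V/p}\<close> with \<open>V = value_of s p\<close> then replaces the
  variables of \<open>p\<close> in \<open>M\<close> as given by \<open>s\<close>.\<close>

primrec value_of :: "(nat \<Rightarrow> 'f tm) \<Rightarrow> (nat \<times> ty) pat \<Rightarrow> 'f tm" where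
  "value_of s (PVar v) = s (fst v)"
| "value_of s (PBang v) = Bang (s (fst v))"
| "value_of s PUnit = Unit"
| "value_of s (PTens p q) = Tens (value_of s p) (value_of s q)"
| "value_of s (PWith p q) = With (value_of s p) (value_of s q)"

inductive red :: "'f signature \<Rightarrow> 'f tm \<Rightarrow> 'f tm \<Rightarrow> bool" for S :: "'f signature" where
  beta: "red S (App (Lam p M) (value_of s (number 0 p)))
           (subst (\<lambda>i. if i < plen p then s i else Var (i - plen p)) M)"
| fun_app: "length rs = arity S f \<Longrightarrow>
    red S (App (Fun f) (nest Tens Unit (map (\<lambda>r. Bang (Const r)) rs))) (Bang (Const (interp S f rs)))"
| plus: "red S (App Plus (With (Const r) (Const s))) (Const (r + s))"
| times: "red S (App (App Times (Const r)) (Const s)) (Const (r * s))"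
| bang: "red S M M' \<Longrightarrow> red S (Bang M) (Bang M')"
| lam: "red S M M' \<Longrightarrow> red S (Lam p M) (Lam p M')"
| app1: "red S M M' \<Longrightarrow> red S (App M N) (App M' N)"
| app2: "red S N N' \<Longrightarrow> red S (App M N) (App M N')"
| tens1: "red S M M' \<Longrightarrow> red S (Tens M N) (Tens M' N)"
| tens2: "red S N N' \<Longrightarrow> red S (Tens M N) (Tens M N')"
| with1: "red S M M' \<Longrightarrow> red S (With M N) (With M' N)"
| with2: "red S N N' \<Longrightarrow> red S (With M N) (With M N')"

abbreviation reds :: "'f signature \<Rightarrow> 'f tm \<Rightarrow> 'f tm \<Rightarrow> bool" where
  "reds S \<equiv> (red S)\<^sup>*\<^sup>*"

abbreviation beta_eq :: "'f signature \<Rightarrow> 'f tm \<Rightarrow> 'f tm \<Rightarrow> bool" where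
  "beta_eq S \<equiv> equivclp (red S)"


subsection \<open>Typing\<close>

type_synonym env = "(nat \<times> ty) pat set"

definition evars :: "env \<Rightarrow> nat set" where
  "evars D = (\<Union>p\<in>D. fst ` set (leaves p))"

definition is_env :: "env \<Rightarrow> bool" where
  "is_env D \<longleftrightarrow> finite D \<and> (\<forall>p\<in>D. distinct (map fst (leaves p))) \<and>
    (\<forall>p\<in>D. \<forall>q\<in>D. p \<noteq> q \<longrightarrow> evars {p} \<inter> evars {q} = {})"

definition bang_env :: "env \<Rightarrow> bool" where
  "bang_env D \<longleftrightarrow> (\<forall>p\<in>D. \<exists>v. p = PBang v)"

text \<open>Side condition of the comma: variable-disjointness.\<close>

definition apart :: "env \<Rightarrow> env \<Rightarrow> bool" where
  "apart D E \<longleftrightarrow> evars D \<inter> evars E = {}"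

definition shift_env :: "nat \<Rightarrow> env \<Rightarrow> env" where
  "shift_env k D = map_pat (\<lambda>(i, A). (i + k, A)) ` D"

text \<open>In \<open>t_app\<close> and \<open>t_tens\<close>, \<open>is_env (G1 \<union> G2)\<close> says that an index shared by \<open>G1\<close> and \<open>G2\<close> has
  the same type in both.\<close>

inductive typed :: "'f signature \<Rightarrow> env \<Rightarrow> 'f tm \<Rightarrow> ty \<Rightarrow> bool" for S :: "'f signature" where
  t_var: "typed S {PVar (i, A)} (Var i) A"
| t_bvar: "typed S {PBang (i, A)} (Var i) A"
| t_bang: "bang_env G \<Longrightarrow> typed S G M A \<Longrightarrow> typed S G (Bang M) (OfCourse A)"
| t_weak: "typed S D M B \<Longrightarrow> apart {PBang (i, A)} D \<Longrightarrow> typed S (insert (PBang (i, A)) D) M B"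
| t_lam: "typed S (insert (number 0 p) (shift_env (plen p) D)) M B \<Longrightarrow>
    typed S D (Lam p M) (Lolli (pty (number 0 p)) B)"
| t_app: "\<lbrakk>typed S (G1 \<union> D1) M (Lolli A B); typed S (G2 \<union> D2) N A;
      bang_env G1; bang_env G2; is_env (G1 \<union> G2); apart D1 D2; apart (G1 \<union> G2) (D1 \<union> D2)\<rbrakk>
    \<Longrightarrow> typed S (G1 \<union> G2 \<union> D1 \<union> D2) (App M N) B"
| t_tens: "\<lbrakk>typed S (G1 \<union> D1) M A; typed S (G2 \<union> D2) N B;
      bang_env G1; bang_env G2; is_env (G1 \<union> G2); apart D1 D2; apart (G1 \<union> G2) (D1 \<union> D2)\<rbrakk>
    \<Longrightarrow> typed S (G1 \<union> G2 \<union> D1 \<union> D2) (Tens M N) (TensT A B)"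
| t_unit: "typed S {} Unit OneT"
| t_punit: "typed S D M B \<Longrightarrow> typed S (insert PUnit D) M B"
| t_ptens: "\<lbrakk>typed S (insert p (insert q D)) M C; apart {p} {q}; apart {p, q} D\<rbrakk>
    \<Longrightarrow> typed S (insert (PTens p q) D) M C"
| t_with: "typed S D M A \<Longrightarrow> typed S D N B \<Longrightarrow> typed S D (With M N) (WithT A B)"
| t_pwith1: "\<lbrakk>typed S (insert p D) M B; is_env {PWith p q}; apart {PWith p q} D\<rbrakk>
    \<Longrightarrow> typed S (insert (PWith p q) D) M B"
| t_pwith2: "\<lbrakk>typed S (insert q D) M B; is_env {PWith p q}; apart {PWith p q} D\<rbrakk>
    \<Longrightarrow> typed S (insert (PWith p q) D) M B"
| t_top: "is_env D \<Longrightarrow> typed S D Top TopT"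
| t_const: "typed S {} (Const r) RealT"
| t_zero: "is_env D \<Longrightarrow> typed S D (Const 0) RealT"
| t_fun: "typed S {} (Fun f)
    (Lolli (nest TensT OneT (replicate (arity S f) (OfCourse RealT))) (OfCourse RealT))"
| t_plus: "typed S {} Plus (Lolli (WithT RealT RealT) RealT)"
| t_times: "typed S {} Times (Lolli RealT (Lolli RealT RealT))"


subsection \<open>Logical equivalence\<close>

definition closed_typed :: "'f signature \<Rightarrow> ty \<Rightarrow> 'f tm \<Rightarrow> 'f tm \<Rightarrow> bool" where
  "closed_typed S A M N \<longleftrightarrow> typed S {} M A \<and> typed S {} N A"

primrec leq_closed :: "'f signature \<Rightarrow> ty \<Rightarrow> 'f tm \<Rightarrow> 'f tm \<Rightarrow> bool" where
  "leq_closed S RealT = (\<lambda>M N. closed_typed S RealT M N \<and> beta_eq S M N)"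
| "leq_closed S OneT = (\<lambda>M N. closed_typed S OneT M N \<and> beta_eq S M N)"
| "leq_closed S (TensT A B) = (\<lambda>M N. closed_typed S (TensT A B) M N \<and>
    (\<exists>M1 M2 N1 N2. reds S M (Tens M1 M2) \<and> reds S N (Tens N1 N2) \<and>
       leq_closed S A M1 N1 \<and> leq_closed S B M2 N2))"
| "leq_closed S (OfCourse A) = (\<lambda>M N. closed_typed S (OfCourse A) M N \<and>
    (\<exists>M' N'. reds S M (Bang M') \<and> reds S N (Bang N') \<and> leq_closed S A M' N'))"
| "leq_closed S TopT = (\<lambda>M N. closed_typed S TopT M N)"
| "leq_closed S (WithT A B) = (\<lambda>M N. closed_typed S (WithT A B) M N \<and>
    leq_closed S A (App (Lam (PWith (PVar A) (PVar B)) (Var 0)) M)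
                   (App (Lam (PWith (PVar A) (PVar B)) (Var 0)) N) \<and>
    leq_closed S B (App (Lam (PWith (PVar A) (PVar B)) (Var 1)) M)
                   (App (Lam (PWith (PVar A) (PVar B)) (Var 1)) N))"
| "leq_closed S (Lolli A B) = (\<lambda>M N. closed_typed S (Lolli A B) M N \<and>
    (\<forall>M' N'. leq_closed S A M' N' \<longrightarrow> leq_closed S B (App M M') (App N N')))"

definition log_equiv :: "'f signature \<Rightarrow> env \<Rightarrow> ty \<Rightarrow> 'f tm \<Rightarrow> 'f tm \<Rightarrow> bool" where
  "log_equiv S G A M N \<longleftrightarrow> typed S G M A \<and> typed S G N A \<and>
    (\<forall>s s'. (\<forall>p\<in>G. leq_closed S (pty p) (value_of s p) (value_of s' p)) \<longrightarrow>
       leq_closed S A (subst s M) (subst s' N))"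


subsection \<open>Abbreviations\<close>

abbreviation LetIn :: "ty pat \<Rightarrow> 'f tm \<Rightarrow> 'f tm \<Rightarrow> 'f tm" where
  "LetIn p N M \<equiv> App (Lam p M) N"

abbreviation sect_ty :: "ty \<Rightarrow> ty" where "sect_ty A \<equiv> WithT OneT A"
abbreviation sect :: "'f tm \<Rightarrow> 'f tm" where "sect M \<equiv> With Unit M"
abbreviation sect_pat :: "ty pat \<Rightarrow> ty pat" where "sect_pat p \<equiv> PWith PUnit p"

abbreviation with_ty :: "ty list \<Rightarrow> ty" where "with_ty \<equiv> nest WithT TopT"
abbreviation with_tm :: "'f tm list \<Rightarrow> 'f tm" where "with_tm \<equiv> nest With Top"
abbreviation with_pat :: "ty pat list \<Rightarrow> ty pat" where "with_pat \<equiv> nest PWith (PVar TopT)"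

text \<open>The following three are only meant for types built from \<open>RealT\<close>, \<open>TopT\<close> and \<open>WithT\<close>.\<close>

fun zero_tm :: "ty \<Rightarrow> 'f tm" where
  "zero_tm RealT = Const 0"
| "zero_tm TopT = Top"
| "zero_tm (WithT H K) = With (zero_tm H) (zero_tm K)"

fun plus_tm :: "ty \<Rightarrow> 'f tm" where
  "plus_tm RealT = Plus"
| "plus_tm TopT = Lam (PWith (PVar TopT) (PVar TopT)) Top"
| "plus_tm (WithT H K) =
    Lam (PWith (PWith (PVar H) (PVar K)) (PWith (PVar H) (PVar K)))
      (With (App (plus_tm H) (With (Var 0) (Var 2))) (App (plus_tm K) (With (Var 1) (Var 3))))"

fun times_tm :: "ty \<Rightarrow> nat \<Rightarrow> 'f tm" where
  "times_tm RealT x = App Times (Var x)"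
| "times_tm TopT x = Lam (PVar TopT) Top"
| "times_tm (WithT H K) x =
    Lam (PWith (PVar H) (PVar K))
      (With (App (times_tm H (x + 2)) (Var 0)) (App (times_tm K (x + 2)) (Var 1)))"


section \<open>Linear A\<close>

datatype lty = LReal | LOne | LTens lty lty

text \<open>A variable occurrence is an index together with the type of the variable; where the type is
  forced by the construct only the index is given.  \<open>ELet\<close> binds primal \<open>0\<close> and tangent \<open>0\<close> in its
  second argument; \<open>ELetTensT z \<tau>\<^sub>1 \<tau>\<^sub>2 e\<close>, with \<open>z\<close> of type \<open>\<tau>\<^sub>1 \<otimes> \<tau>\<^sub>2\<close>, binds tangents \<open>0\<close> and \<open>1\<close>
  (the first and second component) in \<open>e\<close>.  The suffixes P and T stand for primal and tangent.\<close>

type_synonym lvar = "nat \<times> lty"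

datatype 'f exp =
    EPair lvar lvar
  | ELet "'f exp" "'f exp"
  | EUnitP
  | EUnitT
  | ELetUnitP nat "'f exp"
  | ELetUnitT nat "'f exp"
  | ETensT lvar lvar
  | ELetTensT nat lty lty "'f exp"
  | EZero lty
  | EAdd lvar lvar
  | EMul nat lvar
  | EConst real
  | EFun 'f "nat list"
  | EDup lvar
  | EDrop "'f exp"

type_synonym lctx = "nat \<rightharpoonup> lty"

definition push :: "lty \<Rightarrow> lctx \<Rightarrow> lctx" where
  "push \<tau> G = case_nat (Some \<tau>) G"

inductive lin_typed :: "'f signature \<Rightarrow> lctx \<Rightarrow> lctx \<Rightarrow> 'f exp \<Rightarrow> lty \<Rightarrow> lty \<Rightarrow> bool"
  for S :: "'f signature" where
  l_pair: "lin_typed S [x \<mapsto> \<tau>] [y \<mapsto> \<sigma>] (EPair (x, \<tau>) (y, \<sigma>)) \<tau> \<sigma>"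
| l_let: "\<lbrakk>lin_typed S G1 D1 e1 \<tau>1 \<sigma>1; lin_typed S (push \<tau>1 G2) (push \<sigma>1 D2) e2 \<tau> \<sigma>;
    \<forall>x\<in>dom G1 \<inter> dom G2. G1 x = G2 x; dom D1 \<inter> dom D2 = {}\<rbrakk>
   \<Longrightarrow> lin_typed S (G1 ++ G2) (D1 ++ D2) (ELet e1 e2) \<tau> \<sigma>"
| l_unitP: "lin_typed S Map.empty Map.empty EUnitP LOne LOne"
| l_unitT: "lin_typed S Map.empty Map.empty EUnitT LOne LOne"
| l_let_unitP: "lin_typed S G D e \<tau> \<sigma> \<Longrightarrow> z \<notin> dom G \<Longrightarrow> lin_typed S (G(z \<mapsto> LOne)) D (ELetUnitP z e) \<tau> \<sigma>"
| l_let_unitT: "lin_typed S G D e \<tau> \<sigma> \<Longrightarrow> z \<notin> dom D \<Longrightarrow> lin_typed S G (D(z \<mapsto> LOne)) (ELetUnitT z e) \<tau> \<sigma>"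
| l_tensT: "x1 \<noteq> x2 \<Longrightarrow> lin_typed S Map.empty [x1 \<mapsto> \<tau>1, x2 \<mapsto> \<tau>2] (ETensT (x1, \<tau>1) (x2, \<tau>2)) LOne (LTens \<tau>1 \<tau>2)"
| l_let_tensT: "lin_typed S G (push \<tau>1 (push \<tau>2 D)) e \<tau> \<sigma> \<Longrightarrow> z \<notin> dom D \<Longrightarrow>
    lin_typed S G (D(z \<mapsto> LTens \<tau>1 \<tau>2)) (ELetTensT z \<tau>1 \<tau>2 e) \<tau> \<sigma>"
| l_zero: "lin_typed S Map.empty Map.empty (EZero \<tau>) LOne \<tau>"
| l_add: "x \<noteq> y \<Longrightarrow> lin_typed S Map.empty [x \<mapsto> \<tau>, y \<mapsto> \<tau>] (EAdd (x, \<tau>) (y, \<tau>)) LOne \<tau>"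
| l_mul: "lin_typed S [x \<mapsto> LReal] [y \<mapsto> \<tau>] (EMul x (y, \<tau>)) LOne \<tau>"
| l_const: "lin_typed S Map.empty Map.empty (EConst r) LReal LOne"
| l_fun: "length xs = arity S f \<Longrightarrow> distinct xs \<Longrightarrow>
    lin_typed S (map_of (map (\<lambda>x. (x, LReal)) xs)) Map.empty (EFun f xs) LReal LOne"
| l_dup: "lin_typed S Map.empty [x \<mapsto> \<tau>] (EDup (x, \<tau>)) LOne (LTens \<tau> \<tau>)"
| l_drop: "lin_typed S G D e \<tau> \<sigma> \<Longrightarrow> lin_typed S G D (EDrop e) LOne LOne"

text \<open>The primal and tangent type of a typable expression, read off its syntax.\<close>

primrec ety :: "'f exp \<Rightarrow> lty \<times> lty" where
  "ety (EPair x y) = (snd x, snd y)"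
| "ety (ELet e1 e2) = ety e2"
| "ety EUnitP = (LOne, LOne)"
| "ety EUnitT = (LOne, LOne)"
| "ety (ELetUnitP z e) = ety e"
| "ety (ELetUnitT z e) = ety e"
| "ety (ETensT x y) = (LOne, LTens (snd x) (snd y))"
| "ety (ELetTensT z \<tau>1 \<tau>2 e) = ety e"
| "ety (EZero \<tau>) = (LOne, \<tau>)"
| "ety (EAdd x y) = (LOne, snd x)"
| "ety (EMul x y) = (LOne, snd y)"
| "ety (EConst r) = (LReal, LOne)"
| "ety (EFun f xs) = (LReal, LOne)"
| "ety (EDup x) = (LOne, LTens (snd x) (snd x))"
| "ety (EDrop e) = (LOne, LOne)"

lemma ety_lin_typed: "lin_typed S G D e \<tau> \<sigma> \<Longrightarrow> ety e = (\<tau>, \<sigma>)"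
  by (induction rule: lin_typed.induct) auto

definition up :: "nat \<Rightarrow> lvar \<Rightarrow> lvar" where
  "up k v = (fst v + k, snd v)"

primrec FVt :: "'f exp \<Rightarrow> lvar set" where
  "FVt (EPair x y) = {y}"
| "FVt (ELet e1 e2) = FVt e1 \<union> {v. up 1 v \<in> FVt e2}"
| "FVt EUnitP = {}"
| "FVt EUnitT = {}"
| "FVt (ELetUnitP z e) = FVt e"
| "FVt (ELetUnitT z e) = insert (z, LOne) (FVt e)"
| "FVt (ETensT x y) = {x, y}"
| "FVt (ELetTensT z \<tau>1 \<tau>2 e) = insert (z, LTens \<tau>1 \<tau>2) {v. up 2 v \<in> FVt e}"
| "FVt (EZero \<tau>) = {}"
| "FVt (EAdd x y) = {x, y}"
| "FVt (EMul x y) = {y}"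
| "FVt (EConst r) = {}"
| "FVt (EFun f xs) = {}"
| "FVt (EDup x) = {x}"
| "FVt (EDrop e) = FVt e"

text \<open>\<open>lren f g\<close> renames free primal indices by \<open>f\<close> and free tangent indices by \<open>g\<close>.\<close>

primrec lren :: "(nat \<Rightarrow> nat) \<Rightarrow> (nat \<Rightarrow> nat) \<Rightarrow> 'f exp \<Rightarrow> 'f exp" where
  "lren f g (EPair x y) = EPair (apfst f x) (apfst g y)"
| "lren f g (ELet e1 e2) = ELet (lren f g e1) (lren (liftn 1 f) (liftn 1 g) e2)"
| "lren f g EUnitP = EUnitP"
| "lren f g EUnitT = EUnitT"
| "lren f g (ELetUnitP z e) = ELetUnitP (f z) (lren f g e)"
| "lren f g (ELetUnitT z e) = ELetUnitT (g z) (lren f g e)"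
| "lren f g (ETensT x y) = ETensT (apfst g x) (apfst g y)"
| "lren f g (ELetTensT z \<tau>1 \<tau>2 e) = ELetTensT (g z) \<tau>1 \<tau>2 (lren f (liftn 2 g) e)"
| "lren f g (EZero \<tau>) = EZero \<tau>"
| "lren f g (EAdd x y) = EAdd (apfst g x) (apfst g y)"
| "lren f g (EMul x y) = EMul (f x) (apfst g y)"
| "lren f g (EConst r) = EConst r"
| "lren f g (EFun h xs) = EFun h (map f xs)"
| "lren f g (EDup x) = EDup (apfst g x)"
| "lren f g (EDrop e) = EDrop (lren f g e)"


subsection \<open>Syntactic sugar\<close>

text \<open>Each auxiliary variable takes index \<open>0\<close> of its kind, which shifts the indices of that kind in
  its scope.  \<open>letP e1 e2\<close> binds primal \<open>0\<close> of \<open>e2\<close> only, \<open>letT e1 e2\<close> tangent \<open>0\<close> of \<open>e2\<close> only.\<close>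

definition letP :: "'f exp \<Rightarrow> 'f exp \<Rightarrow> 'f exp" where
  "letP e1 e2 = ELet e1 (ELetUnitT 0 (lren id Suc e2))"

definition letT :: "'f exp \<Rightarrow> 'f exp \<Rightarrow> 'f exp" where
  "letT e1 e2 = ELet e1 (ELetUnitP 0 (lren Suc id e2))"

definition varP :: "lvar \<Rightarrow> 'f exp" where
  "varP x = letT EUnitT (EPair x (0, LOne))"

definition varT :: "lvar \<Rightarrow> 'f exp" where
  "varT y = letP EUnitP (EPair (0, LOne) y)"

definition lpair :: "'f exp \<Rightarrow> 'f exp \<Rightarrow> 'f exp" where
  "lpair e1 e2 = letP e1 (letT (lren Suc id e2) (EPair (0, fst (ety e1)) (0, snd (ety e2))))"


subsection \<open>Unzipping\<close>

text \<open>A stack of primal lets, outermost first: \<open>JLet e\<close> is \<open>let x = e in [ ]\<close> and \<open>JUnit z\<close> is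
  \<open>let \<otimes>() = z in [ ]\<close>.  It binds \<open>jlen\<close> many primal variables in its hole.\<close>

datatype 'f jframe = JLet "'f exp" | JUnit nat

primrec jplug :: "'f jframe list \<Rightarrow> 'f exp \<Rightarrow> 'f exp" where
  "jplug [] e = e"
| "jplug (fr # E) e = (case fr of JLet e1 \<Rightarrow> letP e1 (jplug E e) | JUnit z \<Rightarrow> ELetUnitP z (jplug E e))"

primrec jlen :: "'f jframe list \<Rightarrow> nat" where
  "jlen [] = 0"
| "jlen (fr # E) = (case fr of JLet e1 \<Rightarrow> Suc (jlen E) | JUnit z \<Rightarrow> jlen E)"

primrec jren :: "(nat \<Rightarrow> nat) \<Rightarrow> 'f jframe list \<Rightarrow> 'f jframe list" where
  "jren f [] = []"
| "jren f (fr # E) = (case fr of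
      JLet e1 \<Rightarrow> JLet (lren f id e1) # jren (liftn 1 f) E
    | JUnit z \<Rightarrow> JUnit (f z) # jren f E)"

text \<open>The triple \<open>(E, e\<^sup>p, e\<^sup>t)\<close>, where \<open>e\<^sup>p\<close> and \<open>e\<^sup>t\<close> live in the scope of \<open>E\<close>.  In the case of
  \<open>ELet\<close> the new stack is \<open>E1\<close>, then \<open>x\<close>, then \<open>E2\<close>: what comes from \<open>e2\<close> is weakened by the
  variables of \<open>E1\<close>, and the tangent part of \<open>e1\<close> by \<open>x\<close> and the variables of \<open>E2\<close>.  The
  result \<open>E[(e\<^sup>p; e\<^sup>t)]\<close> always uses the sugared pair, also when \<open>e\<^sup>p\<close> and \<open>e\<^sup>t\<close> are variables.\<close>

primrec jax :: "'f exp \<Rightarrow> 'f jframe list \<times> 'f exp \<times> 'f exp" where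
  "jax (EPair x y) = ([], varP x, varT y)"
| "jax (ELet e1 e2) =
    (let (E1, p1, t1) = jax e1; (E2, p2, t2) = jax e2;
         r = liftn 1 (\<lambda>i. i + jlen E1); r' = liftn (jlen E2) r
     in (E1 @ [JLet p1] @ jren r E2,
         lren r' id p2,
         letT (lren (\<lambda>i. i + 1 + jlen E2) id t1) (lren r' id t2)))"
| "jax EUnitP = ([], EUnitP, EUnitT)"
| "jax EUnitT = ([], EUnitP, EUnitT)"
| "jax (ELetUnitP z e) = (let (E, p, t) = jax e in (JUnit z # E, p, t))"
| "jax (ELetUnitT z e) = (let (E, p, t) = jax e in (E, p, ELetUnitT z t))"
| "jax (ETensT x y) = ([], EUnitP, ETensT x y)"
| "jax (ELetTensT z \<tau>1 \<tau>2 e) = (let (E, p, t) = jax e in (E, p, ELetTensT z \<tau>1 \<tau>2 t))"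
| "jax (EZero \<tau>) = ([], EUnitP, EZero \<tau>)"
| "jax (EAdd x y) = ([], EUnitP, EAdd x y)"
| "jax (EMul x y) = ([], EUnitP, EMul x y)"
| "jax (EConst r) = ([], EConst r, EUnitT)"
| "jax (EFun f xs) = ([], EFun f xs, EUnitT)"
| "jax (EDup x) = ([], EUnitP, EDup x)"
| "jax (EDrop e) = (let (E, p, t) = jax e in (E, EDrop p, EDrop t))"

definition unzip_jax :: "'f exp \<Rightarrow> 'f exp" where
  "unzip_jax e = (let (E, p, t) = jax e in jplug E (lpair p t))"


section \<open>The translation of Linear A into lambda-LL\<close>

primrec tyP :: "lty \<Rightarrow> ty" where
  "tyP LReal = RealT"
| "tyP LOne = OneT"
| "tyP (LTens \<tau> \<sigma>) = TensT (OfCourse (tyP \<tau>)) (OfCourse (tyP \<sigma>))"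

primrec tyT :: "lty \<Rightarrow> ty" where
  "tyT LReal = RealT"
| "tyT LOne = TopT"
| "tyT (LTens \<tau> \<sigma>) = WithT (tyT \<tau>) (tyT \<sigma>)"

abbreviation arg_ty :: "lvar list \<Rightarrow> ty" where
  "arg_ty \<theta> \<equiv> with_ty (map (\<lambda>v. tyT (snd v)) \<theta>)"

text \<open>The tuple pattern \<open>u\<^sub>\<theta>\<close>; inside its scope \<open>u\<^sub>y\<close> is the index \<open>upos \<theta> y\<close> and outer indices are
  shifted by \<open>width \<theta>\<close> (which is \<open>1\<close> for empty \<open>\<theta>\<close>).\<close>

definition upat :: "lvar list \<Rightarrow> ty pat" where
  "upat \<theta> = with_pat (map (\<lambda>v. PVar (tyT (snd v))) \<theta>)"

definition upos :: "lvar list \<Rightarrow> lvar \<Rightarrow> nat" where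
  "upos \<theta> y = length (takeWhile (\<lambda>v. v \<noteq> y) \<theta>)"

definition width :: "lvar list \<Rightarrow> nat" where
  "width \<theta> = plen (upat \<theta>)"

abbreviation uvar :: "lvar list \<Rightarrow> lvar \<Rightarrow> 'f tm" where
  "uvar \<theta> y \<equiv> Var (upos \<theta> y)"

text \<open>The pattern \<open>(!x, \<section>f)\<close> with \<open>x\<close> of type \<open>tyP \<tau>\<close> and \<open>f\<close> of type
  \<open>Lolli (arg_ty \<theta>) (tyT \<sigma>)\<close>, where \<open>\<rho> = (\<tau>, \<sigma>)\<close>; \<open>x\<close> gets index \<open>0\<close> and \<open>f\<close> index \<open>1\<close>.\<close>

definition xf_pat :: "lvar list \<Rightarrow> lty \<times> lty \<Rightarrow> ty pat" where
  "xf_pat \<theta> \<rho> = PTens (PBang (tyP (fst \<rho>))) (sect_pat (PVar (Lolli (arg_ty \<theta>) (tyT (snd \<rho>)))))"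

text \<open>A primal variable of Linear A with index \<open>i\<close> is translated to the index \<open>i\<close>.  In the case of
  \<open>ELet\<close> the pattern \<open>(!x, \<section>f)\<close> binds \<open>f\<close> in addition to \<open>x\<close>, so the translation of \<open>e2\<close> is weakened
  by index \<open>1\<close>.\<close>

primrec delta :: "'f exp \<Rightarrow> lvar list \<Rightarrow> 'f tm" where
  "delta (EPair x y) = (\<lambda>\<theta>. Tens (Bang (Var (fst x))) (sect (Lam (upat \<theta>) (uvar \<theta> y))))"
| "delta (ELet e1 e2) = (\<lambda>\<theta>.
    let \<theta>1 = filter (\<lambda>v. v \<in> FVt e1) \<theta>;
        \<theta>2 = filter (\<lambda>v. up 1 v \<in> FVt e2) \<theta>;
        \<theta>2' = (0, snd (ety e1)) # map (up 1) \<theta>2;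
        w = width \<theta>
    in LetIn (xf_pat \<theta>1 (ety e1)) (delta e1 \<theta>1)
        (LetIn (xf_pat \<theta>2' (ety e2)) (ren (liftn 1 Suc) (delta e2 \<theta>2'))
          (Tens (Bang (Var 0))
            (sect (Lam (upat \<theta>)
              (App (Var (w + 1))
                (with_tm (App (Var (w + 3)) (with_tm (map (uvar \<theta>) \<theta>1)) # map (uvar \<theta>) \<theta>2))))))))"
| "delta EUnitP = (\<lambda>\<theta>. Tens (Bang Unit) (sect (Lam (PVar TopT) Top)))"
| "delta EUnitT = (\<lambda>\<theta>. Tens (Bang Unit) (sect (Lam (PVar TopT) Top)))"
| "delta (ELetUnitP z e) = (\<lambda>\<theta>. LetIn PUnit (Var z) (delta e \<theta>))"
| "delta (ELetUnitT z e) = (\<lambda>\<theta>.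
    let \<theta>' = removeAll (z, LOne) \<theta>
    in LetIn (xf_pat \<theta>' (ety e)) (delta e \<theta>')
        (Tens (Bang (Var 0))
          (sect (Lam (upat \<theta>) (App (Var (width \<theta> + 1)) (with_tm (map (uvar \<theta>) \<theta>')))))))"
| "delta (ETensT x1 x2) = (\<lambda>\<theta>. Tens (Bang Unit) (sect (Lam (upat \<theta>) (With (uvar \<theta> x1) (uvar \<theta> x2)))))"
| "delta (ELetTensT z \<tau>1 \<tau>2 e) = (\<lambda>\<theta>.
    let zv = (z, LTens \<tau>1 \<tau>2);
        \<theta>' = removeAll zv \<theta>;
        \<theta>'' = (0, \<tau>1) # (1, \<tau>2) # map (up 2) \<theta>';
        q = with_pat (map (\<lambda>v. if v = zv then PWith (PVar (tyT \<tau>1)) (PVar (tyT \<tau>2))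
                               else PVar (tyT (snd v))) \<theta>);
        k = upos \<theta> zv;
        u' = (\<lambda>v. if upos \<theta> v < k then Var (upos \<theta> v) else Var (upos \<theta> v + 1))
    in LetIn (xf_pat \<theta>'' (ety e)) (delta e \<theta>'')
        (Tens (Bang (Var 0))
          (sect (Lam q (App (Var (plen q + 1)) (with_tm (Var k # Var (k + 1) # map u' \<theta>')))))))"
| "delta (EZero \<sigma>) = (\<lambda>\<theta>. Tens (Bang Unit) (sect (Lam (PVar TopT) (zero_tm (tyT \<sigma>)))))"
| "delta (EAdd y1 y2) = (\<lambda>\<theta>. Tens (Bang Unit)
    (sect (Lam (upat \<theta>) (App (plus_tm (tyT (snd y1))) (With (uvar \<theta> y1) (uvar \<theta> y2))))))"
| "delta (EMul x y) = (\<lambda>\<theta>. Tens (Bang Unit)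
    (sect (Lam (upat \<theta>) (App (times_tm (tyT (snd y)) (x + width \<theta>)) (uvar \<theta> y)))))"
| "delta (EConst r) = (\<lambda>\<theta>. Tens (Bang (Const r)) (sect (Lam (PVar TopT) Top)))"
| "delta (EFun f xs) = (\<lambda>\<theta>. Tens (App (Fun f) (nest Tens Unit (map (\<lambda>x. Bang (Var x)) xs)))
    (sect (Lam (PVar TopT) Top)))"
| "delta (EDup y) = (\<lambda>\<theta>. Tens (Bang Unit) (sect (Lam (upat \<theta>) (With (uvar \<theta> y) (uvar \<theta> y)))))"
| "delta (EDrop e) = (\<lambda>\<theta>. LetIn (xf_pat \<theta> (ety e)) (delta e \<theta>)
    (Tens (Bang Unit) (sect (Lam (PVar (arg_ty \<theta>))
      (LetIn (PVar (tyT (snd (ety e)))) (App (Var 2) (Var 0)) Top)))))"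


section \<open>Unzipping in lambda-LL\<close>

text \<open>A one-hole context built from lets, outermost first: \<open>(p, N)\<close> stands for \<open>let p = N in [ ]\<close>.
  It binds \<open>clen\<close> many variables in its hole.\<close>

type_synonym 'f lctxt = "(ty pat \<times> 'f tm) list"

primrec cplug :: "'f lctxt \<Rightarrow> 'f tm \<Rightarrow> 'f tm" where
  "cplug [] M = M"
| "cplug (fr # E) M = LetIn (fst fr) (snd fr) (cplug E M)"

definition clen :: "'f lctxt \<Rightarrow> nat" where
  "clen E = sum_list (map (\<lambda>fr. plen (fst fr)) E)"

primrec cren :: "(nat \<Rightarrow> nat) \<Rightarrow> 'f lctxt \<Rightarrow> 'f lctxt" where
  "cren f [] = []"
| "cren f (fr # E) = (fst fr, ren f (snd fr)) # cren (liftn (plen (fst fr)) f) E"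

text \<open>The result \<open>(\<epsilon>, P, F)\<close> has \<open>P\<close> and \<open>F\<close> in the scope of \<open>\<epsilon>\<close>.

  For \<open>let (!x, \<section>f) = S1 in S2\<close>: with \<open>n\<^sub>i\<close> the number of variables bound by \<open>\<epsilon>\<^sub>i\<close>, what comes from
  \<open>S2\<close> lives in a scope that extends the ambient one by \<open>x, f, \<epsilon>\<^sub>2\<close>, and is moved to \<open>\<epsilon>\<^sub>1, x, \<epsilon>\<^sub>2\<close> (in the case of \<open>F2\<close>,
  to \<open>\<epsilon>\<^sub>1, x, \<epsilon>\<^sub>2, f\<close>, where \<open>f\<close> has index \<open>0\<close>).  The renamings move \<open>\<epsilon>\<^sub>2\<close> and \<open>P2\<close> out of the scope of
  \<open>f\<close>, which is not supposed to occur in them.  Similarly for \<open>let \<section>f = \<section>F in S1\<close>.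
  The function is unspecified on terms that are not of one of the five forms.\<close>

fun unzb :: "'f tm \<Rightarrow> 'f lctxt \<times> 'f tm \<times> 'f tm" where
  "unzb (Tens P (With Unit F)) = ([], P, F)"
| "unzb (App (Lam (PTens (PBang A) (PWith PUnit (PVar B))) S2) S1) =
    (let (E1, P1, F1) = unzb S1; (E2, P2, F2) = unzb S2;
         n1 = clen E1; n2 = clen E2;
         r = liftn 1 (\<lambda>i. i - 1 + n1)
     in (E1 @ [(PBang A, P1)] @ cren r E2,
         ren (liftn n2 r) P2,
         LetIn (sect_pat (PVar B)) (sect (ren (\<lambda>i. i + 1 + n2) F1))
           (ren (\<lambda>i. if i \<le> n2 then i + 1 else if i = n2 + 1 then 0 else i + n1) F2)))"
| "unzb (App (Lam (PWith PUnit (PVar B)) S1) (With Unit F)) =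
    (let (E1, P1, F1) = unzb S1; n1 = clen E1; r = (\<lambda>i. i - 1)
     in (cren r E1,
         ren (liftn n1 r) P1,
         LetIn (sect_pat (PVar B)) (sect (ren (\<lambda>i. i + n1) F))
           (ren (\<lambda>i. if i < n1 then i + 1 else if i = n1 then 0 else i) F1)))"
| "unzb (App (Lam (PBang A) S1) P) = (let (E1, P1, F1) = unzb S1 in ((PBang A, P) # E1, P1, F1))"
| "unzb (App (Lam PUnit S1) (Var z)) = (let (E1, P1, F1) = unzb S1 in ((PUnit, Var z) # E1, P1, F1))"

definition unzip :: "'f tm \<Rightarrow> 'f tm" where
  "unzip M = (let (E, P, F) = unzb M in cplug E (Tens P (sect F)))"

end

theory Submission
  imports Defs
begin

text \<open>
  Both terms are compared through a denotation instead of through each other.  Linear A has an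
  evident semantics over values built from reals and pairs, and unzipping in Linear A
  preserves it.  A first-order closed term represents a value if its evaluation yields the
  corresponding canonical form; the translation of \<open>e\<close> as well as its unzipping in lambda-LL
  evaluate, under closed substitutions representing an environment, to pairs \<open>(!V, \<section>F)\<close> that
  represent the primal value and the tangent map of \<open>e\<close>.  Closed well-typed terms
  that represent the same values are logically equivalent, and conversely logically equivalent
  terms of first-order type represent a common value because closed well-typed terms normalize.
  In this way neither transitivity of \<open>\<sim>\<close> nor confluence is needed.
\<close>

subsection \<open>Renaming and substitution\<close>

text \<open>The relation \<open>\<sim>\<close> on open terms substitutes two different families of
  values, \<open>s\<close> on the left and \<open>s'\<close> on the right, so even a term compared
  with itself calls for a fundamental lemma. A common environment \<open>\<rho>\<close> of values,
  read off from both families, removes the asymmetry: each side is evaluated alone, under its own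
  substitution, and the sides meet only in \<open>\<rho>\<close>. A function type enters the
  compared type only once, for linear maps between tangent types, and there \<open>\<sim>\<close>
  merely asks for equivalent results on equivalent arguments; a tangent map is therefore described
  extensionally, by its effect on represented tuples (\<open>frep\<close>). The other obstacle is
  typing: \<open>log_equiv\<close> and every clause of \<open>leq_closed\<close> demand typed terms,
  so the unzipping of the translation and the translation of the unzipping have to be typed
  independently of their evaluation, and the components reached by evaluation need subject
  reduction.\<close>

definition bind :: "nat \<Rightarrow> (nat \<Rightarrow> 'f tm) \<Rightarrow> (nat \<Rightarrow> 'f tm) \<Rightarrow> nat \<Rightarrow> 'f tm" where
  "bind k u s = (\<lambda>i. if i < k then u i else s (i - k))"

lemma liftn_comp: "liftn k f \<circ> liftn k g = liftn k (f \<circ> g)"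
  by (auto simp: liftn_def fun_eq_iff)

lemma liftn_id [simp]: "liftn k id = id" "liftn k (\<lambda>x. x) = (\<lambda>x. x)"
  by (auto simp: liftn_def fun_eq_iff)

lemma liftn_0 [simp]: "liftn 0 f = f"
  by (auto simp: liftn_def fun_eq_iff)

lemma liftn_liftn: "liftn k (liftn m f) = liftn (k + m) f"
  by (auto simp: liftn_def fun_eq_iff)

lemma ren_ren: "ren f (ren g M) = ren (f \<circ> g) M"
  by (induction M arbitrary: f g) (auto simp: liftn_comp)

lemma ren_id [simp]: "ren id M = M" "ren (\<lambda>x. x) M = M"
proof -
  show "ren id M = M" by (induction M) auto
  then show "ren (\<lambda>x. x) M = M" by (simp add: id_def)
qed

lemma lifts_comp_liftn: "lifts k s \<circ> liftn k f = lifts k (s \<circ> f)"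
  by (auto simp: lifts_def liftn_def fun_eq_iff)

lemma subst_ren: "subst s (ren f M) = subst (s \<circ> f) M"
  by (induction M arbitrary: s f) (auto simp: lifts_comp_liftn)

lemma ren_lifts: "ren (liftn k f) \<circ> lifts k s = lifts k (ren f \<circ> s)"
proof
  fix i
  have "liftn k f \<circ> (\<lambda>j. j + k) = (\<lambda>j. j + k) \<circ> f"
    by (auto simp: liftn_def)
  then show "(ren (liftn k f) \<circ> lifts k s) i = lifts k (ren f \<circ> s) i"
    by (auto simp: lifts_def liftn_def ren_ren)
qed

lemma ren_subst: "ren f (subst s M) = subst (ren f \<circ> s) M"
proof (induction M arbitrary: s f)
  case (Lam p M)
  show ?case by (simp only: subst.simps ren.simps Lam.IH ren_lifts)
qed (auto simp: comp_def)

lemma subst_lifts: "subst (lifts k t) \<circ> lifts k s = lifts k (subst t \<circ> s)"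
proof
  fix i
  have "lifts k t \<circ> (\<lambda>j. j + k) = ren (\<lambda>j. j + k) \<circ> t"
    by (auto simp: lifts_def)
  then show "(subst (lifts k t) \<circ> lifts k s) i = lifts k (subst t \<circ> s) i"
    by (auto simp: lifts_def subst_ren ren_subst)
qed

lemma subst_subst: "subst t (subst s M) = subst (subst t \<circ> s) M"
proof (induction M arbitrary: s t)
  case (Lam p M)
  show ?case by (simp only: subst.simps Lam.IH subst_lifts)
qed (auto simp: comp_def)

lemma lifts_Var [simp]: "lifts k Var = Var"
  by (auto simp: lifts_def fun_eq_iff)

lemma subst_Var [simp]: "subst Var M = M"
  by (induction M) auto

lemma ren_as_subst: "ren f M = subst (Var \<circ> f) M"
  using subst_ren[of Var f M] by simp

text \<open>Contracting a redex whose abstraction already carries \<open>s\<close> amounts to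
  evaluating the body in the extended environment \<open>bind k u s\<close>: the shift made by
  \<open>lifts\<close> is undone by the indices \<open>i - k\<close>. This lets substitutions be
  read as environments throughout the evaluation proofs.\<close>

lemma subst_bind_lifts:
  "subst (\<lambda>i. if i < k then u i else Var (i - k)) (subst (lifts k s) M) = subst (bind k u s) M"
proof -
  have "subst (\<lambda>i. if i < k then u i else Var (i - k)) \<circ> lifts k s = bind k u s"
    by (auto simp: bind_def lifts_def fun_eq_iff subst_ren comp_def)
  then show ?thesis by (simp add: subst_subst)
qed

lemma bind_comp_liftn: "bind k u s \<circ> liftn k f = bind k u (s \<circ> f)"
  by (auto simp: bind_def liftn_def fun_eq_iff)

section \<open>Free variables and closed terms\<close>

primrec fvs :: "'f tm \<Rightarrow> nat set" where
  "fvs (Var i) = {i}"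
| "fvs (Bang M) = fvs M"
| "fvs (Lam p M) = {i. i + plen p \<in> fvs M}"
| "fvs (App M N) = fvs M \<union> fvs N"
| "fvs Unit = {}"
| "fvs (Tens M N) = fvs M \<union> fvs N"
| "fvs Top = {}"
| "fvs (With M N) = fvs M \<union> fvs N"
| "fvs (Const r) = {}"
| "fvs (Fun g) = {}"
| "fvs Plus = {}"
| "fvs Times = {}"

lemma subst_cong_fvs: "\<forall>i\<in>fvs M. s i = t i \<Longrightarrow> subst s M = subst t M"
proof (induction M arbitrary: s t)
  case (Lam p M)
  have "\<forall>i\<in>fvs M. lifts (plen p) s i = lifts (plen p) t i"
    using Lam.prems by (auto simp: lifts_def dest: bspec[of _ _ "i - plen p" for i])
  then show ?case by (simp add: Lam.IH)
next
  case (App M N) then show ?case by (metis UnCI fvs.simps(4) subst.simps(4))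
next
  case (Tens M N) then show ?case by (metis UnCI fvs.simps(6) subst.simps(6))
next
  case (With M N) then show ?case by (metis UnCI fvs.simps(8) subst.simps(8))
qed simp_all

lemma subst_closed: "fvs M = {} \<Longrightarrow> subst s M = M"
  using subst_cong_fvs[of M s Var] by simp

lemma ren_closed: "fvs M = {} \<Longrightarrow> ren f M = M"
  by (simp add: ren_as_subst subst_closed)

subsection \<open>Numbered patterns\<close>

lemma plen_simps [simp]:
  "plen (PVar v) = 1" "plen (PBang v) = 1" "plen PUnit = 0"
  "plen (PTens p q) = plen p + plen q" "plen (PWith p q) = plen p + plen q"
  by (auto simp: plen_def)

lemma leaves_number: "leaves (number k p) = zip [k..<k + plen p] (leaves p)"
proof (induction p arbitrary: k)
  case (PTens p q)
  then show ?case
    using upt_add_eq_append[of k "k + plen p" "plen q"] by (simp add: add.assoc plen_def)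
next
  case (PWith p q)
  then show ?case
    using upt_add_eq_append[of k "k + plen p" "plen q"] by (simp add: add.assoc plen_def)
qed (auto simp: upt_rec)

lemma fst_leaves_number: "map fst (leaves (number k p)) = [k..<k + plen p]"
  by (simp add: leaves_number plen_def)

lemma in_leaves_number: "(i, A) \<in> set (leaves (number k p)) \<Longrightarrow> k \<le> i \<and> i < k + plen p"
  by (auto simp: leaves_number dest: set_zip_leftD)

lemma value_of_cong: "\<forall>i\<in>fst ` set (leaves p). s i = t i \<Longrightarrow> value_of s p = value_of t p"
  by (induction p) auto

subsection \<open>Substitution preserves typing\<close>

abbreviation map_env :: "(nat \<Rightarrow> nat) \<Rightarrow> env \<Rightarrow> env" where
  "map_env f D \<equiv> map_pat (apfst f) ` D"

lemma leaves_map_pat [simp]: "leaves (map_pat f p) = map f (leaves p)"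
  by (induction p) auto

lemma evars_simps [simp]:
  "evars {} = {}" "evars (D \<union> E) = evars D \<union> evars E"
  "evars (insert p D) = fst ` set (leaves p) \<union> evars D"
  by (auto simp: evars_def)

lemma evars_map_env: "evars (map_env f D) = f ` evars D"
  by (force simp: evars_def image_iff)

lemma evars_mono: "D \<subseteq> E \<Longrightarrow> evars D \<subseteq> evars E"
  by (auto simp: evars_def)

lemma shift_env_map_env: "shift_env k D = map_env (\<lambda>i. i + k) D"
  by (auto simp: shift_env_def apfst_def map_prod_def)

lemma shift_env_simps [simp]:
  "shift_env k {} = {}" "shift_env k (D \<union> E) = shift_env k D \<union> shift_env k E"
  by (auto simp: shift_env_def)

lemma evars_shift_env: "evars (shift_env k D) = (\<lambda>i. i + k) ` evars D"
  by (simp add: shift_env_map_env evars_map_env)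

lemma evars_number [simp]: "fst ` set (leaves (number k p)) = {k..<k + plen p}"
  by (metis atLeastLessThan_upt fst_leaves_number set_map)

lemma is_env_subset: "is_env E \<Longrightarrow> D \<subseteq> E \<Longrightarrow> is_env D"
  unfolding is_env_def using finite_subset by blast

lemma is_env_map_env:
  assumes "is_env D" "inj_on f (evars D)"
  shows "is_env (map_env f D)"
  unfolding is_env_def
proof (intro conjI ballI impI)
  show "finite (map_env f D)" using assms by (simp add: is_env_def)
next
  fix p assume "p \<in> map_env f D"
  then obtain q where q: "q \<in> D" "p = map_pat (apfst f) q" by auto
  have "map fst (leaves p) = map f (map fst (leaves q))" using q by simp
  moreover have "inj_on f (set (map fst (leaves q)))"
    using assms(2) q by (rule_tac inj_on_subset) (auto simp: evars_def)
  ultimately show "distinct (map fst (leaves p))"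
    using assms(1) q by (simp only: distinct_map) (simp add: is_env_def distinct_map)
next
  fix p q assume "p \<in> map_env f D" "q \<in> map_env f D" "p \<noteq> q"
  then obtain p' q' where *: "p' \<in> D" "q' \<in> D" "p = map_pat (apfst f) p'" "q = map_pat (apfst f) q'" "p' \<noteq> q'"
    by auto
  then have "evars {p'} \<inter> evars {q'} = {}" using assms(1) by (auto simp: is_env_def)
  moreover have "evars {p'} \<subseteq> evars D" "evars {q'} \<subseteq> evars D" using * by (auto simp: evars_def)
  ultimately have "f ` evars {p'} \<inter> f ` evars {q'} = {}"
    using inj_on_image_Int[OF assms(2), of "evars {p'}" "evars {q'}"] by (simp only: image_empty)
  then show "evars {p} \<inter> evars {q} = {}"
    unfolding *(3,4) by (simp add: image_image)
qed

lemma apart_map_env: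
  assumes "apart D E" "inj_on f (evars D \<union> evars E)"
  shows "apart (map_env f D) (map_env f E)"
  using assms(1) inj_on_image_Int[OF assms(2), of "evars D" "evars E"]
  unfolding apart_def evars_map_env by simp

lemma apart_subset: "apart D E \<Longrightarrow> D' \<subseteq> D \<Longrightarrow> E' \<subseteq> E \<Longrightarrow> apart D' E'"
  unfolding apart_def using evars_mono by blast

text \<open>Its use is the empty environment: a closed term has no free index, hence is untouched
  when a substitution is pushed under a binder.\<close>

lemma typed_fvs: "typed S D M A \<Longrightarrow> fvs M \<subseteq> evars D"
proof (induction rule: typed.induct)
  case (t_lam p D M B)
  then show ?case by (force simp: evars_shift_env)
qed (auto simp: evars_def)

lemma typed_closed_fvs: "typed S {} M A \<Longrightarrow> fvs M = {}"
  using typed_fvs[of S "{}"] by fastforce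

lemma map_env_number: "map_pat (apfst (liftn k f)) (number j p) = number j p" if "j + plen p \<le> k"
  using that by (induction p arbitrary: j) (auto simp: liftn_def)

lemma map_env_shift_env: "map_env (liftn k f) (shift_env k D) = shift_env k (map_env f D)"
proof -
  have "apfst (liftn k f) \<circ> apfst (\<lambda>i. i + k) = (apfst (\<lambda>i. i + k) \<circ> apfst f :: nat \<times> ty \<Rightarrow> _)"
    by (auto simp: liftn_def fun_eq_iff)
  then show ?thesis
    by (simp only: shift_env_map_env image_image pat.map_comp)
qed

lemma inj_on_liftn: "inj_on f X \<Longrightarrow> inj_on (liftn k f) ({..<k} \<union> (\<lambda>i. i + k) ` X)"
  by (rule inj_onI) (auto simp: liftn_def split: if_splits dest: inj_onD)

text \<open>Environments are plain sets, so a pattern without variables may be principal in a rule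
  and still occur in the premise, and the two parts of a split need not be disjoint. These facts
  tell how a split of the environment of the conclusion is inherited by the premise.\<close>

lemma insert_eq_Un:
  assumes "insert a E = D \<union> D'"
  shows "a \<in> D' \<Longrightarrow> D' = insert a (D' \<inter> E)" "a \<notin> D' \<Longrightarrow> D' = D' \<inter> E" "a \<notin> D' \<Longrightarrow> a \<in> D"
    "E = (D \<inter> E) \<union> (D' \<inter> E)" "a \<notin> D' \<Longrightarrow> E = (D \<inter> E) \<union> D'"
proof -
  have *: "x = a \<or> x \<in> E \<longleftrightarrow> x \<in> D \<or> x \<in> D'" for x
    using assms by (metis UnCI UnE insertCI insertE)
  show "a \<in> D' \<Longrightarrow> D' = insert a (D' \<inter> E)" "a \<notin> D' \<Longrightarrow> D' = D' \<inter> E" "a \<notin> D' \<Longrightarrow> a \<in> D"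
    "E = (D \<inter> E) \<union> (D' \<inter> E)" "a \<notin> D' \<Longrightarrow> E = (D \<inter> E) \<union> D'"
    using * unfolding set_eq_iff Int_iff Un_iff insert_iff by metis+
qed

text \<open>The side conditions of \<open>t_app\<close> and \<open>t_tens\<close> are conditions on
  membership and disjointness, which pass to subsets and are kept by a renaming that is injective on
  the variables left over.\<close>

lemma map_env_restrict:
  assumes "bang_env G1" "bang_env G2" "is_env (G1 \<union> G2)" "apart D1 D2" "apart (G1 \<union> G2) (D1 \<union> D2)"
    and inj: "inj_on f (evars D')"
  defines "m \<equiv> \<lambda>X. map_env f (X \<inter> D')"
  shows "bang_env (m G1)" "bang_env (m G2)" "is_env (m G1 \<union> m G2)" "apart (m D1) (m D2)"
    "apart (m G1 \<union> m G2) (m D1 \<union> m D2)"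
proof -
  have sub: "evars (X \<inter> D') \<subseteq> evars D'" for X by (rule evars_mono) auto
  have inj: "inj_on f (evars (X \<inter> D') \<union> evars (Y \<inter> D'))" for X Y
    using inj by (rule inj_on_subset) (use sub in auto)
  show "bang_env (m G1)" "bang_env (m G2)"
    using assms by (fastforce simp: bang_env_def m_def)+
  have "is_env (map_env f ((G1 \<union> G2) \<inter> D'))"
    by (rule is_env_map_env[OF is_env_subset[OF assms(3)]]) (use inj[of "G1 \<union> G2" "G1 \<union> G2"] in auto)
  then show "is_env (m G1 \<union> m G2)" by (simp add: m_def Int_Un_distrib2 image_Un)
  show "apart (m D1) (m D2)" unfolding m_def
    by (rule apart_map_env[OF apart_subset[OF assms(4)] inj]) auto
  have "apart (map_env f ((G1 \<union> G2) \<inter> D')) (map_env f ((D1 \<union> D2) \<inter> D'))"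
    by (rule apart_map_env[OF apart_subset[OF assms(5)] inj]) auto
  then show "apart (m G1 \<union> m G2) (m D1 \<union> m D2)" by (simp add: m_def Int_Un_distrib2 image_Un)
qed

text \<open>Closed terms consume no resources, so replacing a variable by one cannot violate
  linearity, even if the variable is shared. Substitution and renaming are treated at once because a
  binder mixes them: the variables of the abstraction are kept while those of \<open>D\<close>
  disappear.\<close>

lemma typed_subst_rename:
  assumes "typed S E M A" "E = D \<union> D'"
    and "\<forall>p\<in>D. \<forall>(i, B)\<in>set (leaves p). typed S {} (s i) B"
    and "\<forall>i\<in>evars D'. s i = Var (f i)" "inj_on f (evars D')"
  shows "typed S (map_env f D') (subst s M) A"
  using assms
proof (induction arbitrary: D D' s f rule: typed.induct)
  case (t_var i A)
  show ?case
  proof (cases "D' = {}")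
    case True
    then have "D = {PVar (i, A)}" using t_var.prems(1) by simp
    with True t_var.prems(2) show ?thesis by simp
  next
    case False
    moreover have "D' \<subseteq> {PVar (i, A)}" unfolding t_var.prems(1) by simp
    ultimately have "D' = {PVar (i, A)}" by (simp add: subset_singleton_iff)
    then show ?thesis using t_var.prems(3) by (simp add: typed.t_var)
  qed
next
  case (t_bvar i A)
  show ?case
  proof (cases "D' = {}")
    case True
    then have "D = {PBang (i, A)}" using t_bvar.prems(1) by simp
    with True t_bvar.prems(2) show ?thesis by simp
  next
    case False
    moreover have "D' \<subseteq> {PBang (i, A)}" unfolding t_bvar.prems(1) by simp
    ultimately have "D' = {PBang (i, A)}" by (simp add: subset_singleton_iff)
    then show ?thesis using t_bvar.prems(3) by (simp add: typed.t_bvar)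
  qed
next
  case (t_bang G M A)
  have "bang_env D'" using t_bang.hyps(1) unfolding t_bang.prems(1) by (simp add: bang_env_def)
  then have "bang_env (map_env f D')" by (fastforce simp: bang_env_def)
  then show ?case using t_bang.IH[OF t_bang.prems] by (auto intro: typed.t_bang)
next
  case (t_weak D0 M B i A)
  have inj: "inj_on f X" if "X \<subseteq> evars D'" for X
    using t_weak.prems(4) that by (rule inj_on_subset)
  have E: "D0 = (D \<inter> D0) \<union> (D' \<inter> D0)" by (rule insert_eq_Un(4)[OF t_weak.prems(1)])
  have IH: "typed S (map_env f (D' \<inter> D0)) (subst s M) B"
    by (rule t_weak.IH[OF E _ _ inj])
      (use t_weak.prems(2,3) evars_mono[of "D' \<inter> D0" D'] in blast)+
  show ?case
  proof (cases "PBang (i, A) \<in> D'")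
    case True
    then have D': "D' = insert (PBang (i, A)) (D' \<inter> D0)" by (rule insert_eq_Un(1)[OF t_weak.prems(1)])
    have "apart (map_env f {PBang (i, A)}) (map_env f (D' \<inter> D0))"
    proof (rule apart_map_env)
      show "apart {PBang (i, A)} (D' \<inter> D0)" using t_weak.hyps(2) by (rule apart_subset) auto
      show "inj_on f (evars {PBang (i, A)} \<union> evars (D' \<inter> D0))"
        using evars_mono[of "{PBang (i, A)}" D'] evars_mono[of "D' \<inter> D0" D'] True by (intro inj) auto
    qed
    then have "typed S (insert (PBang (f i, A)) (map_env f (D' \<inter> D0))) (subst s M) B"
      using IH by (intro typed.t_weak) auto
    then show ?thesis by (subst D') simp
  next
    case False
    then have "D' = D' \<inter> D0" by (rule insert_eq_Un(2)[OF t_weak.prems(1)])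
    then show ?thesis using IH by simp
  qed
next
  case (t_lam p E M B)
  let ?k = "plen p"
  have "typed S (map_env (liftn ?k f) (insert (number 0 p) (shift_env ?k D'))) (subst (lifts ?k s) M) B"
  proof (rule t_lam.IH)
    \<comment> \<open>The bound pattern joins the renamed part; its indices are fixed by
      \<open>liftn\<close>.\<close>
    show "insert (number 0 p) (shift_env ?k E) = shift_env ?k D \<union> insert (number 0 p) (shift_env ?k D')"
      using t_lam.prems by auto
    show "\<forall>p\<in>shift_env ?k D. \<forall>(i, B)\<in>set (leaves p). typed S {} (lifts ?k s i) B"
      using t_lam.prems(2) by (fastforce simp: shift_env_map_env lifts_def ren_closed typed_closed_fvs)
    show "\<forall>i\<in>evars (insert (number 0 p) (shift_env ?k D')). lifts ?k s i = Var (liftn ?k f i)"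
    proof
      fix i assume i: "i \<in> evars (insert (number 0 p) (shift_env ?k D'))"
      show "lifts ?k s i = Var (liftn ?k f i)"
      proof (cases "i < ?k")
        case False
        then have "i - ?k \<in> evars D'" using i by (auto simp: evars_shift_env)
        then show ?thesis using False t_lam.prems(3) by (simp add: lifts_def liftn_def)
      qed (simp add: lifts_def liftn_def)
    qed
    show "inj_on (liftn ?k f) (evars (insert (number 0 p) (shift_env ?k D')))"
      using inj_on_liftn[OF t_lam.prems(4), of ?k] by (simp add: evars_shift_env lessThan_atLeast0)
  qed
  then have "typed S (insert (number 0 p) (shift_env ?k (map_env f D'))) (subst (lifts ?k s) M) B"
    by (simp add: map_env_number map_env_shift_env)
  then show ?case by (simp add: typed.t_lam)
next
  case (t_app G1 D1 M A B G2 D2 N)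
  \<comment> \<open>Intersecting each piece with \<open>D'\<close> keeps the overlap of
    \<open>G1\<close> and \<open>G2\<close> intact.\<close>
  let ?m = "\<lambda>X. map_env f (X \<inter> D')"
  have sub: "evars (X \<inter> D') \<subseteq> evars D'" for X by (rule evars_mono) auto
  have inj: "inj_on f (evars (X \<inter> D'))" for X
    using t_app.prems(4) sub by (rule inj_on_subset)
  have 1: "typed S (?m (G1 \<union> D1)) (subst s M) (Lolli A B)"
    by (rule t_app.IH(1)[of "D \<inter> (G1 \<union> D1)" _ s f, OF _ _ _ inj])
      (use t_app.prems sub[of "G1 \<union> D1"] in auto)
  have 2: "typed S (?m (G2 \<union> D2)) (subst s N) A"
    by (rule t_app.IH(2)[of "D \<inter> (G2 \<union> D2)" _ s f, OF _ _ _ inj])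
      (use t_app.prems sub[of "G2 \<union> D2"] in auto)
  have "typed S (?m G1 \<union> ?m G2 \<union> ?m D1 \<union> ?m D2) (App (subst s M) (subst s N)) B"
    by (rule typed.t_app[OF _ _ map_env_restrict[OF t_app.hyps(3-7) t_app.prems(4)]])
      (use 1 2 in \<open>simp_all add: Int_Un_distrib2 image_Un\<close>)
  moreover have "?m G1 \<union> ?m G2 \<union> ?m D1 \<union> ?m D2 = map_env f D'"
    using t_app.prems(1) by blast
  ultimately show ?case by simp
next
  case (t_tens G1 D1 M A G2 D2 N B)
  let ?m = "\<lambda>X. map_env f (X \<inter> D')"
  have sub: "evars (X \<inter> D') \<subseteq> evars D'" for X by (rule evars_mono) auto
  have inj: "inj_on f (evars (X \<inter> D'))" for X
    using t_tens.prems(4) sub by (rule inj_on_subset)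
  have 1: "typed S (?m (G1 \<union> D1)) (subst s M) A"
    by (rule t_tens.IH(1)[of "D \<inter> (G1 \<union> D1)" _ s f, OF _ _ _ inj])
      (use t_tens.prems sub[of "G1 \<union> D1"] in auto)
  have 2: "typed S (?m (G2 \<union> D2)) (subst s N) B"
    by (rule t_tens.IH(2)[of "D \<inter> (G2 \<union> D2)" _ s f, OF _ _ _ inj])
      (use t_tens.prems sub[of "G2 \<union> D2"] in auto)
  have "typed S (?m G1 \<union> ?m G2 \<union> ?m D1 \<union> ?m D2) (Tens (subst s M) (subst s N)) (TensT A B)"
    by (rule typed.t_tens[OF _ _ map_env_restrict[OF t_tens.hyps(3-7) t_tens.prems(4)]])
      (use 1 2 in \<open>simp_all add: Int_Un_distrib2 image_Un\<close>)
  moreover have "?m G1 \<union> ?m G2 \<union> ?m D1 \<union> ?m D2 = map_env f D'"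
    using t_tens.prems(1) by blast
  ultimately show ?case by simp
next
  case t_unit
  then show ?case by (auto intro: typed.t_unit)
next
  case (t_punit D0 M B)
  have inj: "inj_on f X" if "X \<subseteq> evars D'" for X
    using t_punit.prems(4) that by (rule inj_on_subset)
  have E: "D0 = (D \<inter> D0) \<union> (D' \<inter> D0)" by (rule insert_eq_Un(4)[OF t_punit.prems(1)])
  have IH: "typed S (map_env f (D' \<inter> D0)) (subst s M) B"
    by (rule t_punit.IH[OF E _ _ inj])
      (use t_punit.prems(2,3) evars_mono[of "D' \<inter> D0" D'] in blast)+
  show ?case
  proof (cases "PUnit \<in> D'")
    case True
    then have "D' = insert PUnit (D' \<inter> D0)" by (rule insert_eq_Un(1)[OF t_punit.prems(1)])
    then have "map_env f D' = map_env f (insert PUnit (D' \<inter> D0))" by (rule arg_cong)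
    then show ?thesis using typed.t_punit[OF IH] by simp
  next
    case False
    then have "D' = D' \<inter> D0" by (rule insert_eq_Un(2)[OF t_punit.prems(1)])
    then show ?thesis using IH by simp
  qed
next
  case (t_ptens p q D0 M C)
  have inj: "inj_on f X" if "X \<subseteq> evars D'" for X
    using t_ptens.prems(4) that by (rule inj_on_subset)
  show ?case
  proof (cases "PTens p q \<in> D'")
    case True
    then have D': "D' = insert (PTens p q) (D' \<inter> D0)" by (rule insert_eq_Un(1)[OF t_ptens.prems(1)])
    have ev: "evars {p, q} \<union> evars (D' \<inter> D0) \<subseteq> evars D'"
      using evars_mono[of "{PTens p q}" D'] evars_mono[of "D' \<inter> D0" D'] True by auto
    then have ev': "evars {p} \<union> evars {q} \<subseteq> evars D'" by auto
    have IH: "typed S (map_env f (insert p (insert q (D' \<inter> D0)))) (subst s M) C"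
    proof (rule t_ptens.IH)
      show "insert p (insert q D0) = (D \<inter> D0) \<union> insert p (insert q (D' \<inter> D0))" using arg_cong[OF insert_eq_Un(4)[OF t_ptens.prems(1)], of "\<lambda>X. insert p (insert q X)"] by (simp only: Un_insert_right)
      show "inj_on f (evars (insert p (insert q (D' \<inter> D0))))"
        by (rule inj) (use ev in auto)
    qed (use t_ptens.prems(2,3) ev in auto)
    have "apart (map_env f {p, q}) (map_env f (D' \<inter> D0))"
      by (rule apart_map_env[OF apart_subset[OF t_ptens.hyps(3)] inj]) (use ev in auto)
    moreover have "apart (map_env f {p}) (map_env f {q})"
      by (rule apart_map_env[OF t_ptens.hyps(2) inj[OF ev']])
    ultimately have "typed S (insert (map_pat (apfst f) (PTens p q)) (map_env f (D' \<inter> D0))) (subst s M) C"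
      using IH by (simp add: typed.t_ptens)
    then show ?thesis by (subst D') simp
  next
    case False
    then have D: "PTens p q \<in> D" by (rule insert_eq_Un(3)[OF t_ptens.prems(1)])
    \<comment> \<open>The variables of a principal pattern in \<open>D\<close> are replaced by
      closed terms, so its components join \<open>D\<close> and the induction hypothesis gives the
      claim without a further rule for pairs.\<close>
    have leaves: "\<forall>p\<in>insert p (insert q (D \<inter> D0)). \<forall>(i, B)\<in>set (leaves p). typed S {} (s i) B"
      using t_ptens.prems(2) bspec[OF t_ptens.prems(2) D] by auto
    have "insert p (insert q D0) = insert p (insert q (D \<inter> D0)) \<union> D'"
      using arg_cong[OF insert_eq_Un(5)[OF t_ptens.prems(1) False], of "\<lambda>X. insert p (insert q X)"] by (simp only: Un_insert_left)
    from t_ptens.IH[OF this leaves t_ptens.prems(3,4)] show ?thesis .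
  qed
next
  case (t_with E M A N B)
  then show ?case by (auto intro: typed.t_with)
next
  case (t_pwith1 p D0 M B q)
  have inj: "inj_on f X" if "X \<subseteq> evars D'" for X
    using t_pwith1.prems(4) that by (rule inj_on_subset)
  show ?case
  proof (cases "PWith p q \<in> D'")
    case True
    then have D': "D' = insert (PWith p q) (D' \<inter> D0)" by (rule insert_eq_Un(1)[OF t_pwith1.prems(1)])
    have ev: "evars {PWith p q} \<union> evars (D' \<inter> D0) \<subseteq> evars D'"
      using evars_mono[of "{PWith p q}" D'] evars_mono[of "D' \<inter> D0" D'] True by auto
    have IH: "typed S (map_env f (insert p (D' \<inter> D0))) (subst s M) B"
    proof (rule t_pwith1.IH)
      show "insert p D0 = (D \<inter> D0) \<union> insert p (D' \<inter> D0)"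
        using arg_cong[OF insert_eq_Un(4)[OF t_pwith1.prems(1)], of "insert p"] by (simp only: Un_insert_right)
      show "inj_on f (evars (insert p (D' \<inter> D0)))"
        by (rule inj) (use ev in auto)
    qed (use t_pwith1.prems(2,3) ev in auto)
    have "apart (map_env f {PWith p q}) (map_env f (D' \<inter> D0))"
      by (rule apart_map_env[OF apart_subset[OF t_pwith1.hyps(3)] inj]) (use ev in auto)
    moreover have "is_env (map_env f {PWith p q})"
      by (rule is_env_map_env[OF t_pwith1.hyps(2) inj]) (use ev in auto)
    ultimately have "typed S (insert (map_pat (apfst f) (PWith p q)) (map_env f (D' \<inter> D0))) (subst s M) B"
      using IH by (simp add: typed.t_pwith1)
    then show ?thesis by (subst D') simp
  next
    case False
    then have D: "PWith p q \<in> D" by (rule insert_eq_Un(3)[OF t_pwith1.prems(1)])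
    have leaves: "\<forall>p\<in>insert p (D \<inter> D0). \<forall>(i, B)\<in>set (leaves p). typed S {} (s i) B"
      using t_pwith1.prems(2) bspec[OF t_pwith1.prems(2) D] by auto
    have "insert p D0 = insert p (D \<inter> D0) \<union> D'"
      using arg_cong[OF insert_eq_Un(5)[OF t_pwith1.prems(1) False], of "\<lambda>X. insert p X"] by (simp only: Un_insert_left)
    from t_pwith1.IH[OF this leaves t_pwith1.prems(3,4)] show ?thesis .
  qed
next
  case (t_pwith2 q D0 M B p)
  have inj: "inj_on f X" if "X \<subseteq> evars D'" for X
    using t_pwith2.prems(4) that by (rule inj_on_subset)
  show ?case
  proof (cases "PWith p q \<in> D'")
    case True
    then have D': "D' = insert (PWith p q) (D' \<inter> D0)" by (rule insert_eq_Un(1)[OF t_pwith2.prems(1)])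
    have ev: "evars {PWith p q} \<union> evars (D' \<inter> D0) \<subseteq> evars D'"
      using evars_mono[of "{PWith p q}" D'] evars_mono[of "D' \<inter> D0" D'] True by auto
    have IH: "typed S (map_env f (insert q (D' \<inter> D0))) (subst s M) B"
    proof (rule t_pwith2.IH)
      show "insert q D0 = (D \<inter> D0) \<union> insert q (D' \<inter> D0)"
        using arg_cong[OF insert_eq_Un(4)[OF t_pwith2.prems(1)], of "insert q"] by (simp only: Un_insert_right)
      show "inj_on f (evars (insert q (D' \<inter> D0)))"
        by (rule inj) (use ev in auto)
    qed (use t_pwith2.prems(2,3) ev in auto)
    have "apart (map_env f {PWith p q}) (map_env f (D' \<inter> D0))"
      by (rule apart_map_env[OF apart_subset[OF t_pwith2.hyps(3)] inj]) (use ev in auto)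
    moreover have "is_env (map_env f {PWith p q})"
      by (rule is_env_map_env[OF t_pwith2.hyps(2) inj]) (use ev in auto)
    ultimately have "typed S (insert (map_pat (apfst f) (PWith p q)) (map_env f (D' \<inter> D0))) (subst s M) B"
      using IH by (simp add: typed.t_pwith2)
    then show ?thesis by (subst D') simp
  next
    case False
    then have D: "PWith p q \<in> D" by (rule insert_eq_Un(3)[OF t_pwith2.prems(1)])
    have leaves: "\<forall>p\<in>insert q (D \<inter> D0). \<forall>(i, B)\<in>set (leaves p). typed S {} (s i) B"
      using t_pwith2.prems(2) bspec[OF t_pwith2.prems(2) D] by auto
    have "insert q D0 = insert q (D \<inter> D0) \<union> D'"
      using arg_cong[OF insert_eq_Un(5)[OF t_pwith2.prems(1) False], of "\<lambda>X. insert q X"] by (simp only: Un_insert_left)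
    from t_pwith2.IH[OF this leaves t_pwith2.prems(3,4)] show ?thesis .
  qed
next
  case (t_top D0)
  have "is_env D'" using t_top.hyps by (rule is_env_subset) (use t_top.prems(1) in blast)
  then show ?case using t_top.prems(4) by (simp add: typed.t_top is_env_map_env)
next
  case t_const
  then show ?case by (auto intro: typed.t_const)
next
  case (t_zero D0)
  have "is_env D'" using t_zero.hyps by (rule is_env_subset) (use t_zero.prems(1) in blast)
  then show ?case using t_zero.prems(4) by (simp add: typed.t_zero is_env_map_env)
next
  case t_fun
  then show ?case by (auto intro: typed.t_fun)
next
  case t_plus
  then show ?case by (auto intro: typed.t_plus)
next
  case t_times
  then show ?case by (auto intro: typed.t_times)
qed

lemma typed_ren: "typed S D M A \<Longrightarrow> inj_on f (evars D) \<Longrightarrow> typed S (map_env f D) (ren f M) A"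
  using typed_subst_rename[of S D M A "{}" D "Var \<circ> f" f] by (simp add: ren_as_subst)

lemma typed_subst_closed:
  "typed S D M A \<Longrightarrow> \<forall>p\<in>D. \<forall>(i, B)\<in>set (leaves p). typed S {} (s i) B \<Longrightarrow> typed S {} (subst s M) A"
  using typed_subst_rename[of S D M A D "{}" s id] by simp

subsection \<open>Weak reduction and subject reduction for closed terms\<close>

text \<open>Reduction outside abstractions: it suffices for evaluating closed terms, and on closed terms it
  stays within the closed fragment, where typing derivations can be inverted rule by rule.\<close>

inductive wred :: "'f signature \<Rightarrow> 'f tm \<Rightarrow> 'f tm \<Rightarrow> bool" for S :: "'f signature" where
  w_beta: "wred S (App (Lam p M) (value_of s (number 0 p)))
           (subst (\<lambda>i. if i < plen p then s i else Var (i - plen p)) M)"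
| w_fun: "length rs = arity S f \<Longrightarrow>
    wred S (App (Fun f) (nest Tens Unit (map (\<lambda>r. Bang (Const r)) rs))) (Bang (Const (interp S f rs)))"
| w_plus: "wred S (App Plus (With (Const r) (Const s))) (Const (r + s))"
| w_times: "wred S (App (App Times (Const r)) (Const s)) (Const (r * s))"
| w_bang: "wred S M M' \<Longrightarrow> wred S (Bang M) (Bang M')"
| w_app1: "wred S M M' \<Longrightarrow> wred S (App M N) (App M' N)"
| w_app2: "wred S N N' \<Longrightarrow> wred S (App M N) (App M N')"
| w_tens1: "wred S M M' \<Longrightarrow> wred S (Tens M N) (Tens M' N)"
| w_tens2: "wred S N N' \<Longrightarrow> wred S (Tens M N) (Tens M N')"
| w_with1: "wred S M M' \<Longrightarrow> wred S (With M N) (With M' N)"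
| w_with2: "wred S N N' \<Longrightarrow> wred S (With M N) (With M N')"

abbreviation wreds :: "'f signature \<Rightarrow> 'f tm \<Rightarrow> 'f tm \<Rightarrow> bool" where
  "wreds S \<equiv> (wred S)\<^sup>*\<^sup>*"

lemma wred_red: "wred S M N \<Longrightarrow> red S M N"
  by (induction rule: wred.induct) (auto intro: red.intros)

lemma wreds_reds: "wreds S M N \<Longrightarrow> reds S M N"
  by (induction rule: rtranclp_induct) (auto intro: rtranclp.rtrancl_into_rtrancl wred_red)

section \<open>Typing in the empty environment: inversion and introduction\<close>

inductive_cases typed_AppE: "typed S E (App M N) B"
inductive_cases typed_LamE: "typed S E (Lam p M) B"
inductive_cases typed_TensE: "typed S E (Tens M N) B"
inductive_cases typed_WithE: "typed S E (With M N) B"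
inductive_cases typed_BangE: "typed S E (Bang M) B"
inductive_cases typed_FunE: "typed S E (Fun f) B"
inductive_cases typed_PlusE: "typed S E Plus B"
inductive_cases typed_TimesE: "typed S E Times B"

text \<open>The conclusion of every rule acting on a pattern has a nonempty environment, so here the
  last rule is the one belonging to the term constructor.\<close>

lemma closed_App: "typed S {} (App M N) B \<Longrightarrow> \<exists>A. typed S {} M (Lolli A B) \<and> typed S {} N A"
  by (erule typed_AppE) auto

lemma closed_Lam:
  "typed S {} (Lam p M) C \<Longrightarrow> \<exists>B. C = Lolli (pty (number 0 p)) B \<and> typed S {number 0 p} M B"
  by (erule typed_LamE) auto

lemma closed_Tens: "typed S {} (Tens M N) C \<Longrightarrow> \<exists>A B. C = TensT A B \<and> typed S {} M A \<and> typed S {} N B"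
  by (erule typed_TensE) auto

lemma closed_With: "typed S {} (With M N) C \<Longrightarrow> \<exists>A B. C = WithT A B \<and> typed S {} M A \<and> typed S {} N B"
  by (erule typed_WithE) auto

lemma closed_Bang: "typed S {} (Bang M) C \<Longrightarrow> \<exists>A. C = OfCourse A \<and> typed S {} M A"
  by (erule typed_BangE) auto

lemma closed_AppI: "typed S {} M (Lolli A B) \<Longrightarrow> typed S {} N A \<Longrightarrow> typed S {} (App M N) B"
  using t_app[of S "{}" "{}" M A B "{}" "{}" N] by (simp add: bang_env_def is_env_def apart_def)

lemma closed_TensI: "typed S {} M A \<Longrightarrow> typed S {} N B \<Longrightarrow> typed S {} (Tens M N) (TensT A B)"
  using t_tens[of S "{}" "{}" M A "{}" "{}" N B] by (simp add: bang_env_def is_env_def apart_def)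

lemma closed_BangI: "typed S {} M A \<Longrightarrow> typed S {} (Bang M) (OfCourse A)"
  by (simp add: t_bang bang_env_def)

lemma typed_value_of:
  "typed S {} (value_of s p) (pty p) \<Longrightarrow> \<forall>(i, A)\<in>set (leaves p). typed S {} (s i) A"
  by (induction p) (force dest!: closed_Tens closed_With closed_Bang)+

text \<open>The redex is closed, so everything substituted is closed and the substitution lemma
  applies with nothing left to rename. The contractions of \<open>Fun\<close>, \<open>Plus\<close>
  and \<open>Times\<close> keep the type because each of these constants has a single type.\<close>

lemma wred_typed: "wred S M N \<Longrightarrow> typed S {} M A \<Longrightarrow> typed S {} N A"
proof (induction arbitrary: A rule: wred.induct)
  case (w_beta p M s)
  obtain B where "typed S {} (Lam p M) (Lolli B A)" "typed S {} (value_of s (number 0 p)) B"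
    using closed_App[OF w_beta] by auto
  then have M: "typed S {number 0 p} M A" and "typed S {} (value_of s (number 0 p)) (pty (number 0 p))"
    by (auto dest!: closed_Lam)
  from typed_value_of[OF this(2)] have "\<forall>(i, A)\<in>set (leaves (number 0 p)). typed S {} (s i) A" .
  \<comment> \<open>Only indices below \<open>plen p\<close> occur in \<open>number 0 p\<close>, so
    the \<open>Var\<close> branch of the substitution is never consulted.\<close>
  then show ?case
    by (intro typed_subst_closed[OF M]) (fastforce dest: in_leaves_number)
next
  case (w_fun rs f)
  then have "A = OfCourse RealT" by (auto dest!: closed_App elim: typed_FunE)
  then show ?case by (simp add: closed_BangI t_const)
next
  case (w_plus r s)
  then have "A = RealT" by (auto dest!: closed_App elim: typed_PlusE)
  then show ?case by (simp add: t_const)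
next
  case (w_times r s)
  then have "A = RealT" by (auto dest!: closed_App elim: typed_TimesE)
  then show ?case by (simp add: t_const)
next
  case (w_bang M M')
  from closed_Bang[OF w_bang.prems] w_bang.IH show ?case by (auto intro: closed_BangI)
next
  case (w_app1 M M' N)
  from closed_App[OF w_app1.prems] w_app1.IH show ?case by (auto intro: closed_AppI)
next
  case (w_app2 N N' M)
  from closed_App[OF w_app2.prems] w_app2.IH show ?case by (auto intro: closed_AppI)
next
  case (w_tens1 M M' N)
  from closed_Tens[OF w_tens1.prems] w_tens1.IH show ?case by (auto intro: closed_TensI)
next
  case (w_tens2 N N' M)
  from closed_Tens[OF w_tens2.prems] w_tens2.IH show ?case by (auto intro: closed_TensI)
next
  case (w_with1 M M' N)
  from closed_With[OF w_with1.prems] w_with1.IH show ?case by (auto intro: t_with)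
next
  case (w_with2 N N' M)
  from closed_With[OF w_with2.prems] w_with2.IH show ?case by (auto intro: t_with)
qed

lemma wreds_typed: "wreds S M N \<Longrightarrow> typed S {} M A \<Longrightarrow> typed S {} N A"
proof (induction rule: rtranclp_induct)
  case (step M' N)
  then show ?case using wred_typed by blast
qed

lemma wreds_cong1:
  assumes "\<And>M M'. wred S M M' \<Longrightarrow> wred S (C M) (C M')"
  shows "wreds S M M' \<Longrightarrow> wreds S (C M) (C M')"
proof (induction rule: rtranclp_induct)
  case (step N N')
  from step(3) assms[OF step(2)] show ?case by (rule rtranclp.rtrancl_into_rtrancl)
qed simp

lemma wreds_Bang: "wreds S M M' \<Longrightarrow> wreds S (Bang M) (Bang M')"
  by (rule wreds_cong1) (rule w_bang)

lemma wreds_binary: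
  assumes "\<And>M M' N. wred S M M' \<Longrightarrow> wred S (C M N) (C M' N)"
    and "\<And>M N N'. wred S N N' \<Longrightarrow> wred S (C M N) (C M N')"
  shows "wreds S M M' \<Longrightarrow> wreds S N N' \<Longrightarrow> wreds S (C M N) (C M' N')"
  using wreds_cong1[of S "\<lambda>X. C X N" M M'] wreds_cong1[of S "C M'" N N'] assms
  by (meson rtranclp_trans)

lemma wreds_App: "wreds S M M' \<Longrightarrow> wreds S N N' \<Longrightarrow> wreds S (App M N) (App M' N')"
  by (rule wreds_binary) (auto intro: wred.intros)

lemma wreds_Tens: "wreds S M M' \<Longrightarrow> wreds S N N' \<Longrightarrow> wreds S (Tens M N) (Tens M' N')"
  by (rule wreds_binary) (auto intro: wred.intros)

lemma wreds_With: "wreds S M M' \<Longrightarrow> wreds S N N' \<Longrightarrow> wreds S (With M N) (With M' N')"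
  by (rule wreds_binary) (auto intro: wred.intros)

lemma wreds_beta:
  assumes "wreds S N (value_of u (number 0 p))"
  shows "wreds S (App (Lam p (subst (lifts (plen p) s) M)) N) (subst (bind (plen p) u s) M)"
proof -
  have "wreds S (App (Lam p (subst (lifts (plen p) s) M)) N)
      (App (Lam p (subst (lifts (plen p) s) M)) (value_of u (number 0 p)))"
    using assms by (intro wreds_App) auto
  also have "wred S \<dots> (subst (bind (plen p) u s) M)"
    using w_beta[of S p "subst (lifts (plen p) s) M" u] by (simp add: subst_bind_lifts)
  finally show ?thesis .
qed

subsection \<open>Normalization of closed terms\<close>

text \<open>Logical equivalence at \<open>WithT A B\<close> speaks about projections only, but a tuple pattern matches
  nothing but a pair.  That closed terms of this type reduce to pairs is proved by reducibility.\<close>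

primrec Red :: "'f signature \<Rightarrow> ty \<Rightarrow> 'f tm \<Rightarrow> bool" where
  "Red S RealT = (\<lambda>M. \<exists>r. wreds S M (Const r))"
| "Red S OneT = (\<lambda>M. wreds S M Unit)"
| "Red S TopT = (\<lambda>M. True)"
| "Red S (OfCourse A) = (\<lambda>M. \<exists>M'. wreds S M (Bang M') \<and> Red S A M')"
| "Red S (TensT A B) = (\<lambda>M. \<exists>M1 M2. wreds S M (Tens M1 M2) \<and> Red S A M1 \<and> Red S B M2)"
| "Red S (WithT A B) = (\<lambda>M. \<exists>M1 M2. wreds S M (With M1 M2) \<and> Red S A M1 \<and> Red S B M2)"
| "Red S (Lolli A B) = (\<lambda>M. \<forall>N. Red S A N \<longrightarrow> Red S B (App M N))"

text \<open>Expansion is built into the base clauses, which record only the constructors that a term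
  reaches; at \<open>Lolli\<close> it passes to applications.\<close>

lemma Red_expand: "Red S A N \<Longrightarrow> wreds S M N \<Longrightarrow> Red S A M"
proof (induction A arbitrary: M N)
  case (Lolli A B)
  then show ?case using wreds_App[of S M N] by fastforce
qed (simp; blast intro: rtranclp_trans)+

text \<open>A match requires the constructors of the pattern to be exposed all the way down to its
  variables; \<open>Red\<close> provides them layer by layer.\<close>

lemma Red_match:
  "Red S (pty (number k p)) N \<Longrightarrow>
    \<exists>u. wreds S N (value_of u (number k p)) \<and> (\<forall>(i, A)\<in>set (leaves (number k p)). Red S A (u i))"
proof (induction p arbitrary: k N)
  case (PTens p q)
  then obtain N1 N2 u1 u2 where *: "wreds S N (Tens N1 N2)"
    "wreds S N1 (value_of u1 (number k p))" "\<forall>(i, A)\<in>set (leaves (number k p)). Red S A (u1 i)"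
    "wreds S N2 (value_of u2 (number (k + plen p) q))"
    "\<forall>(i, A)\<in>set (leaves (number (k + plen p) q)). Red S A (u2 i)"
    by simp meson
  \<comment> \<open>The two numberings occupy adjacent ranges, so cutting at
    \<open>k + plen p\<close> merges both assignments without conflict.\<close>
  define u where "u = (\<lambda>i. if i < k + plen p then u1 i else u2 i)"
  have "value_of u (number k p) = value_of u1 (number k p)"
    "value_of u (number (k + plen p) q) = value_of u2 (number (k + plen p) q)"
    by (rule value_of_cong; simp add: u_def)+
  then have "wreds S N (value_of u (number k (PTens p q)))"
    using rtranclp_trans[OF *(1) wreds_Tens[OF *(2,4)]] by simp
  moreover have "\<forall>(i, A)\<in>set (leaves (number k (PTens p q))). Red S A (u i)"
    using *(3,5) by (fastforce simp: u_def dest: in_leaves_number)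
  ultimately show ?case by blast
next
  case (PWith p q)
  then obtain N1 N2 u1 u2 where *: "wreds S N (With N1 N2)"
    "wreds S N1 (value_of u1 (number k p))" "\<forall>(i, A)\<in>set (leaves (number k p)). Red S A (u1 i)"
    "wreds S N2 (value_of u2 (number (k + plen p) q))"
    "\<forall>(i, A)\<in>set (leaves (number (k + plen p) q)). Red S A (u2 i)"
    by simp meson
  define u where "u = (\<lambda>i. if i < k + plen p then u1 i else u2 i)"
  have "value_of u (number k p) = value_of u1 (number k p)"
    "value_of u (number (k + plen p) q) = value_of u2 (number (k + plen p) q)"
    by (rule value_of_cong; simp add: u_def)+
  then have "wreds S N (value_of u (number k (PWith p q)))"
    using rtranclp_trans[OF *(1) wreds_With[OF *(2,4)]] by simp
  moreover have "\<forall>(i, A)\<in>set (leaves (number k (PWith p q))). Red S A (u i)"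
    using *(3,5) by (fastforce simp: u_def dest: in_leaves_number)
  ultimately show ?case by blast
next
  case (PVar A)
  then show ?case by (intro exI[of _ "\<lambda>_. N"]) simp
next
  case (PBang A)
  then obtain M where "wreds S N (Bang M)" "Red S A M" by auto
  then show ?case by (intro exI[of _ "\<lambda>_. M"]) simp
qed simp

lemma Red_nest_Const:
  "Red S (nest TensT OneT (replicate n (OfCourse RealT))) N \<Longrightarrow>
    \<exists>rs. length rs = n \<and> wreds S N (nest Tens Unit (map (\<lambda>r. Bang (Const r)) rs))"
proof (induction n arbitrary: N)
  case (Suc n)
  show ?case
  proof (cases n)
    case 0
    then obtain M r where "wreds S N (Bang M)" "wreds S M (Const r)" using Suc.prems by auto
    then have "wreds S N (Bang (Const r))" using wreds_Bang rtranclp_trans by metis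
    then show ?thesis using 0 by (intro exI[of _ "[r]"]) simp
  next
    case (Suc m)
    then obtain N1 N2 M r where *: "wreds S N (Tens N1 N2)" "wreds S N1 (Bang M)" "wreds S M (Const r)"
      "Red S (nest TensT OneT (replicate n (OfCourse RealT))) N2"
      using Suc.prems by auto
    then obtain rs where rs: "length rs = n" "wreds S N2 (nest Tens Unit (map (\<lambda>r. Bang (Const r)) rs))"
      using Suc.IH by blast
    have "wreds S N1 (Bang (Const r))" using * wreds_Bang rtranclp_trans by metis
    then have "wreds S N (Tens (Bang (Const r)) (nest Tens Unit (map (\<lambda>r. Bang (Const r)) rs)))"
      using *(1) rs(2) wreds_Tens rtranclp_trans by metis
    moreover have "rs \<noteq> []" using rs Suc by auto
    ultimately show ?thesis using rs Suc by (intro exI[of _ "r # rs"]) (cases rs; simp)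
  qed
qed simp

text \<open>Passing from the conclusion of a structural rule to its premise never adds a leaf, so a
  hypothesis about leaves is inherited at once. Only abstraction and the constants require an
  argument.\<close>

theorem typed_Red:
  "typed S D M A \<Longrightarrow> \<forall>p\<in>D. \<forall>(i, B)\<in>set (leaves p). Red S B (s i) \<Longrightarrow> Red S A (subst s M)"
proof (induction arbitrary: s rule: typed.induct)
  case (t_lam p D M B)
  let ?k = "plen p"
  show ?case
  proof (simp, intro allI impI)
    fix N assume "Red S (pty (number 0 p)) N"
    then obtain u where u: "wreds S N (value_of u (number 0 p))"
      "\<forall>(i, A)\<in>set (leaves (number 0 p)). Red S A (u i)"
      using Red_match by blast
    have "Red S B (subst (bind ?k u s) M)"
    proof (rule t_lam.IH, rule ballI)
      fix q assume "q \<in> insert (number 0 p) (shift_env ?k D)"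
      then consider "q = number 0 p" | q' where "q' \<in> D" "q = map_pat (\<lambda>(i, A). (i + ?k, A)) q'"
        by (auto simp: shift_env_def)
      then show "\<forall>(i, B)\<in>set (leaves q). Red S B (bind ?k u s i)"
      proof cases
        case 1
        then show ?thesis using u(2) by (fastforce simp: bind_def dest: in_leaves_number)
      next
        case 2
        then show ?thesis using t_lam.prems by (fastforce simp: bind_def)
      qed
    qed
    then show "Red S B (App (Lam p (subst (lifts ?k s) M)) N)"
      using wreds_beta[OF u(1)] Red_expand by blast
  qed
next
  case (t_fun f)
  show ?case
  proof (simp, intro allI impI)
    fix N assume "Red S (nest TensT OneT (replicate (arity S f) (OfCourse RealT))) N"
    then obtain rs where rs: "length rs = arity S f"
      "wreds S N (nest Tens Unit (map (\<lambda>r. Bang (Const r)) rs))"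
      using Red_nest_Const by blast
    then have "wreds S (App (Fun f) N) (Bang (Const (interp S f rs)))"
      using wreds_App[OF _ rs(2), of "Fun f" "Fun f"] w_fun[of rs S f] by (simp add: rtranclp.rtrancl_into_rtrancl)
    then show "\<exists>M'. wreds S (App (Fun f) N) (Bang M') \<and> (\<exists>r. wreds S M' (Const r))" by blast
  qed
next
  case t_plus
  show ?case
  proof (simp, intro allI impI, elim exE conjE)
    fix N M1 M2 r s assume "wreds S N (With M1 M2)" "wreds S M1 (Const r)" "wreds S M2 (Const s)"
    then have "wreds S N (With (Const r) (Const s))" using wreds_With rtranclp_trans by metis
    then have "wreds S (App Plus N) (App Plus (With (Const r) (Const s)))" by (intro wreds_App) auto
    then show "\<exists>r. wreds S (App Plus N) (Const r)" using w_plus rtranclp.rtrancl_into_rtrancl by metis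
  qed
next
  case t_times
  show ?case
  proof (simp, intro allI impI, elim exE conjE)
    fix M N r s assume "wreds S M (Const r)" "wreds S N (Const s)"
    then have "wreds S (App (App Times M) N) (App (App Times (Const r)) (Const s))" by (intro wreds_App) auto
    then show "\<exists>r. wreds S (App (App Times M) N) (Const r)" using w_times rtranclp.rtrancl_into_rtrancl by metis
  qed
next
  case (t_app G1 D1 M A B G2 D2 N)
  have "Red S (Lolli A B) (subst s M)" by (rule t_app.IH(1)) (use t_app.prems in auto)
  moreover have "Red S A (subst s N)" by (rule t_app.IH(2)) (use t_app.prems in auto)
  ultimately show ?case by simp
next
  case (t_tens G1 D1 M A G2 D2 N B)
  have "Red S A (subst s M)" by (rule t_tens.IH(1)) (use t_tens.prems in auto)
  moreover have "Red S B (subst s N)" by (rule t_tens.IH(2)) (use t_tens.prems in auto)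
  ultimately show ?case by auto
next
  case (t_ptens p q D M C)
  show ?case by (rule t_ptens.IH) (use t_ptens.prems in auto)
next
  case (t_with D M A N B)
  then show ?case by auto
qed auto

lemma typed_closed_Red: "typed S {} M A \<Longrightarrow> Red S A M"
  using typed_Red[of S "{}" M A Var] by simp

subsection \<open>Congruence of beta-equality\<close>

lemma beta_eq_cong:
  assumes "\<And>M M'. red S M M' \<Longrightarrow> red S (C M) (C M')"
  shows "beta_eq S M M' \<Longrightarrow> beta_eq S (C M) (C M')"
proof (induction rule: equivclp_induct)
  case (step N N')
  then have "beta_eq S (C N) (C N')" using assms by (metis equivclp_sym r_into_equivclp)
  with step.IH show ?case by (rule equivclp_trans)
qed simp

lemma reds_beta_eq: "reds S M N \<Longrightarrow> beta_eq S M N"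
  by (induction rule: rtranclp_induct) (auto intro: equivclp_trans r_into_equivclp)

lemma wreds_beta_eq: "wreds S M N \<Longrightarrow> beta_eq S M N"
  by (intro reds_beta_eq wreds_reds)

lemma beta_eq_binary:
  assumes "\<And>M M' N. red S M M' \<Longrightarrow> red S (C M N) (C M' N)"
    and "\<And>M N N'. red S N N' \<Longrightarrow> red S (C M N) (C M N')"
  shows "beta_eq S M M' \<Longrightarrow> beta_eq S N N' \<Longrightarrow> beta_eq S (C M N) (C M' N')"
  using beta_eq_cong[of S "\<lambda>X. C X N" M M'] beta_eq_cong[of S "C M'" N N'] assms
  by (meson equivclp_trans)

lemma beta_eq_App: "beta_eq S M M' \<Longrightarrow> beta_eq S N N' \<Longrightarrow> beta_eq S (App M N) (App M' N')"
  by (rule beta_eq_binary) (auto intro: red.intros)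

lemma beta_eq_Tens: "beta_eq S M M' \<Longrightarrow> beta_eq S N N' \<Longrightarrow> beta_eq S (Tens M N) (Tens M' N')"
  by (rule beta_eq_binary) (auto intro: red.intros)

lemma beta_eq_With: "beta_eq S M M' \<Longrightarrow> beta_eq S N N' \<Longrightarrow> beta_eq S (With M N) (With M' N')"
  by (rule beta_eq_binary) (auto intro: red.intros)

lemma beta_eq_Bang: "beta_eq S M M' \<Longrightarrow> beta_eq S (Bang M) (Bang M')"
  by (rule beta_eq_cong) (rule red.bang)

lemma wred_proj_With:
  "wred S (App (Lam (PWith (PVar A) (PVar B)) (Var 0)) (With M N)) M"
  "wred S (App (Lam (PWith (PVar A) (PVar B)) (Var 1)) (With M N)) N"
  using w_beta[of S "PWith (PVar A) (PVar B)" "Var 0" "\<lambda>i. if i = 0 then M else N"]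
    w_beta[of S "PWith (PVar A) (PVar B)" "Var 1" "\<lambda>i. if i = 0 then M else N"]
  by auto

lemma wreds_proj_With:
  assumes "wreds S M (With M1 M2)"
  shows "wreds S (App (Lam (PWith (PVar A) (PVar B)) (Var 0)) M) M1"
    "wreds S (App (Lam (PWith (PVar A) (PVar B)) (Var 1)) M) M2"
  using wreds_App[OF rtranclp.rtrancl_refl assms] wred_proj_With
  by (meson rtranclp.rtrancl_into_rtrancl)+

text \<open>Projections separate the components, so no confluence is needed here.\<close>

lemma beta_eq_Tens_inj:
  assumes "beta_eq S (Tens M1 M2) (Tens N1 N2)"
  shows "beta_eq S M1 N1" "beta_eq S M2 N2"
proof -
  \<comment> \<open>\<open>OneT\<close> is a dummy annotation: reduction does not look at the types
    in a binder.\<close>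
  have p: "beta_eq S (App (Lam (PTens (PVar OneT) (PVar OneT)) (Var 0)) (Tens M N)) M"
    "beta_eq S (App (Lam (PTens (PVar OneT) (PVar OneT)) (Var 1)) (Tens M N)) N" for M N
    using beta[of S "PTens (PVar OneT) (PVar OneT)" "Var 0" "\<lambda>i. if i = 0 then M else N"]
      beta[of S "PTens (PVar OneT) (PVar OneT)" "Var 1" "\<lambda>i. if i = 0 then M else N"]
    by (auto intro: r_into_equivclp)
  show "beta_eq S M1 N1" "beta_eq S M2 N2"
    using p beta_eq_App[OF equivclp_refl assms] by (meson equivclp_sym equivclp_trans)+
qed

text \<open>A binder \<open>!x\<close> with body \<open>x\<close> strips the exponential by a single
  contraction on both sides.\<close>

lemma beta_eq_Bang_inj:
  assumes "beta_eq S (Bang M) (Bang N)"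
  shows "beta_eq S M N"
proof -
  have p: "beta_eq S (App (Lam (PBang OneT) (Var 0)) (Bang M)) M" for M
    using beta[of S "PBang OneT" "Var 0" "\<lambda>_. M"] by (auto intro: r_into_equivclp)
  show ?thesis
    using p beta_eq_App[OF equivclp_refl assms] by (meson equivclp_sym equivclp_trans)
qed

subsection \<open>Values and their representation by terms\<close>

text \<open>Values are untyped: exponentials leave no trace, and \<open>VU\<close> stands for the
  primal and the tangent unit and is also the default of the pair selectors. Total selectors allow
  the semantics to be defined without typing hypotheses.\<close>

datatype val = VR real | VU | VP val val

fun unR :: "val \<Rightarrow> real" where "unR (VR r) = r" | "unR _ = 0"
fun vfst :: "val \<Rightarrow> val" where "vfst (VP v w) = v" | "vfst _ = VU"
fun vsnd :: "val \<Rightarrow> val" where "vsnd (VP v w) = w" | "vsnd _ = VU"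

abbreviation vtuple :: "val list \<Rightarrow> val" where "vtuple \<equiv> nest VP VU"

text \<open>At \<open>RealT\<close> the numeral need only be beta-equal to the represented real.  Beta-equal numerals
  are in fact identical, but that is confluence, which is avoided this way.\<close>

primrec rep :: "'f signature \<Rightarrow> ty \<Rightarrow> 'f tm \<Rightarrow> val \<Rightarrow> bool" where
  "rep S RealT = (\<lambda>M v. \<exists>r. wreds S M (Const r) \<and> beta_eq S (Const r) (Const (unR v)))"
| "rep S OneT = (\<lambda>M v. wreds S M Unit)"
| "rep S TopT = (\<lambda>M v. True)"
| "rep S (OfCourse A) = (\<lambda>M v. \<exists>M'. wreds S M (Bang M') \<and> rep S A M' v)"
| "rep S (TensT A B) =
    (\<lambda>M v. \<exists>M1 M2. wreds S M (Tens M1 M2) \<and> rep S A M1 (vfst v) \<and> rep S B M2 (vsnd v))"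
| "rep S (WithT A B) =
    (\<lambda>M v. \<exists>M1 M2. wreds S M (With M1 M2) \<and> rep S A M1 (vfst v) \<and> rep S B M2 (vsnd v))"
| "rep S (Lolli A B) = (\<lambda>M v. False)"

lemma rep_expand: "rep S A N v \<Longrightarrow> wreds S M N \<Longrightarrow> rep S A M v"
  by (cases A; simp; blast intro: rtranclp_trans)

text \<open>The types whose closed terms are data. At \<open>Lolli\<close> no value is ever
  represented by \<open>rep\<close>, and \<open>frep\<close> takes over.\<close>

primrec lolli_free :: "ty \<Rightarrow> bool" where
  "lolli_free RealT = True"
| "lolli_free OneT = True"
| "lolli_free TopT = True"
| "lolli_free (OfCourse A) = lolli_free A"
| "lolli_free (TensT A B) = (lolli_free A \<and> lolli_free B)"
| "lolli_free (WithT A B) = (lolli_free A \<and> lolli_free B)"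
| "lolli_free (Lolli A B) = False"

lemma lolli_free_ty [simp]: "lolli_free (tyP \<tau>)" "lolli_free (tyT \<tau>)"
  by (induction \<tau>) auto

lemma lolli_free_with_ty: "\<forall>A\<in>set As. lolli_free A \<Longrightarrow> lolli_free (with_ty As)"
  by (induction WithT TopT As rule: nest.induct) auto

lemma leq_typed: "leq_closed S A M N \<Longrightarrow> typed S {} M A \<and> typed S {} N A"
  by (cases A) (auto simp: closed_typed_def)

text \<open>The reducts supplied by \<open>leq_closed\<close> come from full reduction and need not
  be those found by weak evaluation of \<open>M\<close> and \<open>N\<close>. Carrying equivalent
  \<open>P\<close> and \<open>Q\<close> that are merely beta-equal to \<open>M\<close> and
  \<open>N\<close> bridges the gap: injectivity of pairs and exponentials under beta-equality passes
  the link on to the components.\<close>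

lemma leq_rep_beta_eq:
  assumes "lolli_free A" "leq_closed S A P Q" "beta_eq S P M" "beta_eq S Q N" "Red S A M" "Red S A N"
  shows "\<exists>v. rep S A M v \<and> rep S A N v"
  using assms
proof (induction A arbitrary: P Q M N)
  case RealT
  then obtain r t where *: "wreds S M (Const r)" "wreds S N (Const t)" by auto
  have "beta_eq S (Const t) (Const r)"
    using RealT.prems(2-4) *[THEN wreds_beta_eq] by simp (meson equivclp_sym equivclp_trans)
  \<comment> \<open>The value is read off from \<open>M\<close>; the numeral of \<open>N\<close>
    agrees with it up to beta-equality.\<close>
  then show ?case using * by (intro exI[of _ "VR r"]) auto
next
  case OneT
  then show ?case by simp
next
  case TopT
  then show ?case by simp
next
  case (OfCourse A)
  then obtain P' Q' M' N' where *: "reds S P (Bang P')" "reds S Q (Bang Q')" "leq_closed S A P' Q'"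
    "wreds S M (Bang M')" "wreds S N (Bang N')" "Red S A M'" "Red S A N'" by auto
  have "beta_eq S (Bang P') (Bang M')" "beta_eq S (Bang Q') (Bang N')"
    using OfCourse.prems(3,4) *(1,2)[THEN reds_beta_eq] *(4,5)[THEN wreds_beta_eq]
    by (meson equivclp_sym equivclp_trans)+
  then have "beta_eq S P' M'" "beta_eq S Q' N'" by (auto dest: beta_eq_Bang_inj)
  then obtain v where "rep S A M' v" "rep S A N' v"
    using OfCourse.IH[of P' Q' M' N'] OfCourse.prems(1) * by auto
  then show ?case using * by auto
next
  case (TensT A B)
  then obtain P1 P2 Q1 Q2 M1 M2 N1 N2 where *: "reds S P (Tens P1 P2)" "reds S Q (Tens Q1 Q2)"
    "leq_closed S A P1 Q1" "leq_closed S B P2 Q2"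
    "wreds S M (Tens M1 M2)" "wreds S N (Tens N1 N2)"
    "Red S A M1" "Red S A N1" "Red S B M2" "Red S B N2" by auto
  have "beta_eq S (Tens P1 P2) (Tens M1 M2)" "beta_eq S (Tens Q1 Q2) (Tens N1 N2)"
    using TensT.prems(3,4) *(1,2)[THEN reds_beta_eq] *(5,6)[THEN wreds_beta_eq]
    by (meson equivclp_sym equivclp_trans)+
  then have "beta_eq S P1 M1" "beta_eq S P2 M2" "beta_eq S Q1 N1" "beta_eq S Q2 N2"
    by (auto dest: beta_eq_Tens_inj)
  then obtain v w where "rep S A M1 v" "rep S A N1 v" "rep S B M2 w" "rep S B N2 w"
    using TensT.IH(1)[of P1 Q1 M1 N1] TensT.IH(2)[of P2 Q2 M2 N2] TensT.prems(1) * by auto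
  then show ?case using * by (intro exI[of _ "VP v w"]) auto
next
  case (WithT A B)
  let ?p = "\<lambda>i M. App (Lam (PWith (PVar A) (PVar B)) (Var i)) M"
  obtain M1 M2 N1 N2 where *: "wreds S M (With M1 M2)" "wreds S N (With N1 N2)"
    "Red S A M1" "Red S A N1" "Red S B M2" "Red S B N2" using WithT.prems by auto
  have leq: "leq_closed S A (?p 0 P) (?p 0 Q)" "leq_closed S B (?p 1 P) (?p 1 Q)"
    using WithT.prems(2) by auto
  \<comment> \<open>At this type equivalence speaks of projections of \<open>P\<close> and
    \<open>Q\<close>, whereas \<open>M\<close> and \<open>N\<close> evaluate to real pairs;
    contracting the projection of a pair connects the two.\<close>
  have "beta_eq S (?p i P) (?p i M)" "beta_eq S (?p i Q) (?p i N)" for i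
    using WithT.prems(3,4) by (auto intro: beta_eq_App)
  then have "beta_eq S (?p 0 P) M1" "beta_eq S (?p 1 P) M2" "beta_eq S (?p 0 Q) N1" "beta_eq S (?p 1 Q) N2"
    using wreds_proj_With[OF *(1), THEN wreds_beta_eq] wreds_proj_With[OF *(2), THEN wreds_beta_eq]
    by (meson equivclp_trans)+
  then obtain v w where "rep S A M1 v" "rep S A N1 v" "rep S B M2 w" "rep S B N2 w"
    using WithT.IH(1)[OF _ leq(1)] WithT.IH(2)[OF _ leq(2)] WithT.prems(1) * by (metis lolli_free.simps(6))
  then show ?case using * by (intro exI[of _ "VP v w"]) auto
qed simp

lemma leq_rep: "lolli_free A \<Longrightarrow> leq_closed S A M N \<Longrightarrow> \<exists>v. rep S A M v \<and> rep S A N v"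
  using leq_rep_beta_eq[of A S M N M N] leq_typed[of S A M N] by (simp add: typed_closed_Red)

lemma is_env_PWith_vars: "is_env {PWith (PVar (0, A)) (PVar (1, B))}"
  by (simp add: is_env_def)

lemma typed_proj_With:
  "typed S {} (Lam (PWith (PVar A) (PVar B)) (Var 0)) (Lolli (WithT A B) A)"
  "typed S {} (Lam (PWith (PVar A) (PVar B)) (Var 1)) (Lolli (WithT A B) B)"
  using t_lam[of S "PWith (PVar A) (PVar B)" "{}" "Var 0" A] t_lam[of S "PWith (PVar A) (PVar B)" "{}" "Var 1" B]
    t_pwith1[of S "PVar (0, A)" "{}" "Var 0" A "PVar (1, B)"] t_pwith2[of S "PVar (1, B)" "{}" "Var 1" B "PVar (0, A)"]
    is_env_PWith_vars[of A B]
  by (simp_all add: t_var apart_def)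

text \<open>The clauses of \<open>leq_closed\<close> ask for typed terms at every level, so the
  typing assumptions travel along the evaluation to the components by subject reduction.\<close>

lemma rep_leq:
  "rep S A M v \<Longrightarrow> rep S A N v \<Longrightarrow> typed S {} M A \<Longrightarrow> typed S {} N A \<Longrightarrow> leq_closed S A M N"
proof (induction A arbitrary: M N v)
  case RealT
  then show ?case
    by (auto simp: closed_typed_def dest!: wreds_beta_eq) (meson equivclp_sym equivclp_trans)
next
  case OneT
  then show ?case
    by (auto simp: closed_typed_def dest!: wreds_beta_eq) (meson equivclp_sym equivclp_trans)
next
  case TopT
  then show ?case by (auto simp: closed_typed_def)
next
  case (OfCourse A)
  then obtain M' N' where *: "wreds S M (Bang M')" "wreds S N (Bang N')" "rep S A M' v" "rep S A N' v" by auto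
  then have "typed S {} M' A" "typed S {} N' A"
    using wreds_typed[OF *(1) OfCourse.prems(3)] wreds_typed[OF *(2) OfCourse.prems(4)] by (auto dest: closed_Bang)
  then have "leq_closed S A M' N'" using OfCourse.IH * by blast
  then show ?case using * OfCourse.prems(3,4) by (auto simp: closed_typed_def dest!: wreds_reds)
next
  case (TensT A B)
  then obtain M1 M2 N1 N2 where *: "wreds S M (Tens M1 M2)" "wreds S N (Tens N1 N2)"
    "rep S A M1 (vfst v)" "rep S A N1 (vfst v)" "rep S B M2 (vsnd v)" "rep S B N2 (vsnd v)" by auto
  then have "typed S {} M1 A" "typed S {} N1 A" "typed S {} M2 B" "typed S {} N2 B"
    using wreds_typed[OF *(1) TensT.prems(3)] wreds_typed[OF *(2) TensT.prems(4)] by (auto dest: closed_Tens)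
  then have "leq_closed S A M1 N1" "leq_closed S B M2 N2" using TensT.IH * by blast+
  then show ?case using *(1,2)[THEN wreds_reds] TensT.prems(3,4) by (auto simp: closed_typed_def)
next
  case (WithT A B)
  let ?p = "\<lambda>i M. App (Lam (PWith (PVar A) (PVar B)) (Var i)) M"
  obtain M1 M2 N1 N2 where *: "wreds S M (With M1 M2)" "wreds S N (With N1 N2)"
    "rep S A M1 (vfst v)" "rep S A N1 (vfst v)" "rep S B M2 (vsnd v)" "rep S B N2 (vsnd v)"
    using WithT.prems by auto
  have "typed S {} (?p 0 X) A" "typed S {} (?p 1 X) B" if "typed S {} X (WithT A B)" for X
    using typed_proj_With that by (blast intro: closed_AppI)+
  then have "leq_closed S A (?p 0 M) (?p 0 N)" "leq_closed S B (?p 1 M) (?p 1 N)"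
    using WithT.IH WithT.prems(3,4) wreds_proj_With[OF *(1)] wreds_proj_With[OF *(2)] *(3-6)
    by (meson rep_expand)+
  then show ?case using WithT.prems(3,4) by (auto simp: closed_typed_def)
qed simp

text \<open>Because the selectors are total, \<open>w\<close> may have any shape. Peeling it with
  \<open>vfst\<close> and \<open>vsnd\<close> yields a genuine tuple of the right length that the
  same terms represent.\<close>

lemma leq_arg_tuple:
  "rep S (with_ty As) M w \<Longrightarrow> rep S (with_ty As) N w \<Longrightarrow>
    \<exists>ws. length ws = length As \<and> rep S (with_ty As) M (vtuple ws) \<and> rep S (with_ty As) N (vtuple ws)"
proof (induction WithT TopT As arbitrary: M N w rule: nest.induct)
  case (2 A)
  then show ?case by (intro exI[of _ "[w]"]) auto
next
  case (3 A B As)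
  then obtain M1 M2 N1 N2 where *: "wreds S M (With M1 M2)" "wreds S N (With N1 N2)"
    "rep S A M1 (vfst w)" "rep S A N1 (vfst w)"
    "rep S (with_ty (B # As)) M2 (vsnd w)" "rep S (with_ty (B # As)) N2 (vsnd w)" by auto
  then obtain ws where ws: "length ws = length (B # As)"
    "rep S (with_ty (B # As)) M2 (vtuple ws)" "rep S (with_ty (B # As)) N2 (vtuple ws)"
    using 3(1) by blast
  then obtain x xs where "ws = x # xs" by (cases ws) auto
  then show ?case using * ws by (intro exI[of _ "vfst w # ws"]) auto
qed simp

text \<open>The lengths have to agree because a 1-tuple is its component: where the right nesting
  stops depends on them.\<close>

lemma rep_tuple_Cons:
  assumes "rep S A M v" "rep S (with_ty As) (with_tm Ms) (vtuple vs)" "length Ms = length As" "length vs = length As"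
  shows "rep S (with_ty (A # As)) (with_tm (M # Ms)) (vtuple (v # vs))"
  using assms by (cases As; cases Ms; cases vs) auto

lemma rep_tuple_map:
  "\<forall>x\<in>set xs. rep S (A x) (M x) (v x) \<Longrightarrow>
    rep S (with_ty (map A xs)) (with_tm (map M xs)) (vtuple (map v xs))"
proof (induction xs)
  case (Cons x xs)
  then show ?case using rep_tuple_Cons[of S "A x" "M x" "v x" "map A xs" "map M xs" "map v xs"] by simp
qed simp

subsection \<open>Matching tangent patterns\<close>

primrec tangent_pat :: "'v pat \<Rightarrow> bool" where
  "tangent_pat (PVar v) = True"
| "tangent_pat (PBang v) = False"
| "tangent_pat PUnit = False"
| "tangent_pat (PTens p q) = False"
| "tangent_pat (PWith p q) = (tangent_pat p \<and> tangent_pat q)"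

fun pvals :: "'v pat \<Rightarrow> val \<Rightarrow> val list" where
  "pvals (PWith p q) v = pvals p (vfst v) @ pvals q (vsnd v)"
| "pvals p v = [v]"

lemma length_pvals: "tangent_pat p \<Longrightarrow> length (pvals p v) = plen p"
  by (induction p arbitrary: v) auto

text \<open>The analogue of \<open>Red_match\<close> that also tracks values: a tuple pattern takes
  a value apart in the order in which it binds variables.\<close>

lemma rep_match:
  "rep S (pty (number k p)) N v \<Longrightarrow> tangent_pat p \<Longrightarrow>
    \<exists>u. wreds S N (value_of u (number k p)) \<and>
      (\<forall>i<plen p. rep S (leaves p ! i) (u (k + i)) (pvals p v ! i))"
proof (induction p arbitrary: k N v)
  case (PWith p q)
  then obtain N1 N2 u1 u2 where *: "wreds S N (With N1 N2)"
    "wreds S N1 (value_of u1 (number k p))" "\<forall>i<plen p. rep S (leaves p ! i) (u1 (k + i)) (pvals p (vfst v) ! i)"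
    "wreds S N2 (value_of u2 (number (k + plen p) q))"
    "\<forall>i<plen q. rep S (leaves q ! i) (u2 (k + plen p + i)) (pvals q (vsnd v) ! i)"
    by simp meson
  define u where "u = (\<lambda>i. if i < k + plen p then u1 i else u2 i)"
  have "value_of u (number k p) = value_of u1 (number k p)"
    "value_of u (number (k + plen p) q) = value_of u2 (number (k + plen p) q)"
    by (rule value_of_cong; simp add: u_def)+
  then have "wreds S N (value_of u (number k (PWith p q)))"
    using rtranclp_trans[OF *(1) wreds_With[OF *(2,4)]] by simp
  moreover have "rep S (leaves (PWith p q) ! i) (u (k + i)) (pvals (PWith p q) v ! i)"
    if "i < plen (PWith p q)" for i
  proof (cases "i < plen p")
    case True
    then show ?thesis
      using *(3) PWith.prems(2) by (simp add: nth_append length_pvals u_def flip: plen_def)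
  next
    case False
    then show ?thesis
      using *(5)[rule_format, of "i - plen p"] PWith.prems(2) that
      by (simp add: nth_append length_pvals u_def flip: plen_def)
  qed
  ultimately show ?case by blast
next
  case (PVar A)
  then show ?case by (intro exI[of _ "\<lambda>_. N"]) simp
qed auto

text \<open>Correctness of an abstraction is reduced to its body under an arbitrary matching
  environment \<open>u\<close>, about which nothing is known but the values represented at the
  leaves.\<close>

lemma rep_App_Lam:
  assumes "rep S (pty (number 0 p)) N w" "tangent_pat p"
    and "\<And>u. \<forall>i<plen p. rep S (leaves p ! i) (u i) (pvals p w ! i) \<Longrightarrow> rep S B (subst (bind (plen p) u s) M) v"
  shows "rep S B (App (subst s (Lam p M)) N) v"
proof -
  obtain u where u: "wreds S N (value_of u (number 0 p))" "\<forall>i<plen p. rep S (leaves p ! i) (u i) (pvals p w ! i)"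
    using rep_match[OF assms(1,2)] by auto
  show ?thesis using rep_expand[OF assms(3)[OF u(2)] wreds_beta[OF u(1)]] by simp
qed

subsection \<open>Vector space operations on tangent types\<close>

primrec vzero :: "lty \<Rightarrow> val" where
  "vzero LReal = VR 0"
| "vzero LOne = VU"
| "vzero (LTens \<tau> \<sigma>) = VP (vzero \<tau>) (vzero \<sigma>)"

primrec vadd :: "lty \<Rightarrow> val \<Rightarrow> val \<Rightarrow> val" where
  "vadd LReal = (\<lambda>v w. VR (unR v + unR w))"
| "vadd LOne = (\<lambda>v w. VU)"
| "vadd (LTens \<tau> \<sigma>) = (\<lambda>v w. VP (vadd \<tau> (vfst v) (vfst w)) (vadd \<sigma> (vsnd v) (vsnd w)))"

primrec vmul :: "lty \<Rightarrow> val \<Rightarrow> val \<Rightarrow> val" where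
  "vmul LReal = (\<lambda>c v. VR (unR c * unR v))"
| "vmul LOne = (\<lambda>c v. VU)"
| "vmul (LTens \<tau> \<sigma>) = (\<lambda>c v. VP (vmul \<tau> c (vfst v)) (vmul \<sigma> c (vsnd v)))"

lemma fvs_zero_plus [simp]: "fvs (zero_tm (tyT \<tau>)) = {}" "fvs (plus_tm (tyT \<tau>)) = {}"
  by (induction \<tau>) auto

lemma subst_zero_plus [simp]:
  "subst s (zero_tm (tyT \<tau>)) = zero_tm (tyT \<tau>)" "subst s (plus_tm (tyT \<tau>)) = plus_tm (tyT \<tau>)"
  by (simp_all add: subst_closed)

lemma rep_zero: "rep S (tyT \<tau>) (zero_tm (tyT \<tau>)) (vzero \<tau>)"
  by (induction \<tau>) auto

lemma rep_plus:
  "rep S (WithT (tyT \<tau>) (tyT \<tau>)) M v \<Longrightarrow> rep S (tyT \<tau>) (App (plus_tm (tyT \<tau>)) M) (vadd \<tau> (vfst v) (vsnd v))"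
proof (induction \<tau> arbitrary: M v)
  case LReal
  then obtain M1 M2 a b where *: "wreds S M (With M1 M2)" "wreds S M1 (Const a)" "wreds S M2 (Const b)"
    "beta_eq S (Const a) (Const (unR (vfst v)))" "beta_eq S (Const b) (Const (unR (vsnd v)))" by auto
  have "wreds S (App Plus M) (App Plus (With (Const a) (Const b)))"
    using rtranclp_trans[OF *(1) wreds_With[OF *(2,3)]] by (intro wreds_App) auto
  then have 1: "wreds S (App Plus M) (Const (a + b))"
    using w_plus by (rule rtranclp.rtrancl_into_rtrancl)
  \<comment> \<open>\<open>a\<close> and \<open>b\<close> are only beta-equal to the represented
    reals, so the sums are linked by contracting an addition on either pair of numerals.\<close>
  have e: "beta_eq S (App Plus (With (Const x) (Const y))) (Const (x + y))" for x y :: real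
    by (intro r_into_equivclp red.plus)
  have "beta_eq S (App Plus (With (Const a) (Const b))) (App Plus (With (Const (unR (vfst v))) (Const (unR (vsnd v)))))"
    using *(4,5) by (intro beta_eq_App beta_eq_With) auto
  then have "beta_eq S (Const (a + b)) (Const (unR (vfst v) + unR (vsnd v)))"
    using e by (meson equivclp_sym equivclp_trans)
  then show ?case using 1 by auto
next
  case (LTens \<tau> \<sigma>)
  let ?H = "tyT \<tau>" and ?K = "tyT \<sigma>"
  let ?p = "PWith (PWith (PVar ?H) (PVar ?K)) (PWith (PVar ?H) (PVar ?K))"
  have "rep S (WithT ?H ?K) (App (subst Var (plus_tm (WithT ?H ?K))) M)
    (VP (vadd \<tau> (vfst (vfst v)) (vfst (vsnd v))) (vadd \<sigma> (vsnd (vfst v)) (vsnd (vsnd v))))"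
    unfolding plus_tm.simps
  proof (rule rep_App_Lam[of S _ _ v])
    fix u assume "\<forall>i<plen ?p. rep S (leaves ?p ! i) (u i) (pvals ?p v ! i)"
    from this[rule_format, of 0] this[rule_format, of 1] this[rule_format, of 2] this[rule_format, of 3]
    have u: "rep S ?H (u 0) (vfst (vfst v))" "rep S ?K (u 1) (vsnd (vfst v))"
      "rep S ?H (u 2) (vfst (vsnd v))" "rep S ?K (u 3) (vsnd (vsnd v))" by (simp_all add: numeral_eq_Suc)
    have "rep S (WithT ?H ?H) (With (u 0) (u 2)) (VP (vfst (vfst v)) (vfst (vsnd v)))"
      "rep S (WithT ?K ?K) (With (u 1) (u 3)) (VP (vsnd (vfst v)) (vsnd (vsnd v)))" using u by auto
    from LTens.IH(1)[OF this(1)] LTens.IH(2)[OF this(2)]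
    show "rep S (WithT ?H ?K) (subst (bind (plen ?p) u Var)
        (With (App (plus_tm ?H) (With (Var 0) (Var 2))) (App (plus_tm ?K) (With (Var 1) (Var 3)))))
      (VP (vadd \<tau> (vfst (vfst v)) (vfst (vsnd v))) (vadd \<sigma> (vsnd (vfst v)) (vsnd (vsnd v))))"
      by (auto simp: bind_def)
  qed (use LTens.prems in auto)
  then show ?case by simp
qed simp

text \<open>Stated for every \<open>s\<close> and \<open>x\<close> because each recursive call of
  \<open>times_tm\<close> sits under a pattern of two variables and meets the scalar two indices
  further out.\<close>

lemma rep_times:
  "rep S RealT (s x) c \<Longrightarrow> rep S (tyT \<tau>) M v \<Longrightarrow>
    rep S (tyT \<tau>) (App (subst s (times_tm (tyT \<tau>) x)) M) (vmul \<tau> c v)"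
proof (induction \<tau> arbitrary: s x M v)
  case LReal
  then obtain a b where *: "wreds S (s x) (Const a)" "wreds S M (Const b)"
    "beta_eq S (Const a) (Const (unR c))" "beta_eq S (Const b) (Const (unR v))" by auto
  have "wreds S (App (App Times (s x)) M) (App (App Times (Const a)) (Const b))"
    using * by (intro wreds_App) auto
  then have 1: "wreds S (App (App Times (s x)) M) (Const (a * b))"
    using w_times by (rule rtranclp.rtrancl_into_rtrancl)
  have e: "beta_eq S (App (App Times (Const x)) (Const y)) (Const (x * y))" for x y :: real
    by (intro r_into_equivclp red.times)
  have "beta_eq S (App (App Times (Const a)) (Const b)) (App (App Times (Const (unR c))) (Const (unR v)))"
    using *(3,4) by (intro beta_eq_App) auto
  then have "beta_eq S (Const (a * b)) (Const (unR c * unR v))"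
    using e by (meson equivclp_sym equivclp_trans)
  then show ?case using 1 by auto
next
  case (LTens \<tau> \<sigma>)
  let ?H = "tyT \<tau>" and ?K = "tyT \<sigma>"
  let ?p = "PWith (PVar ?H) (PVar ?K)"
  have "rep S (WithT ?H ?K) (App (subst s (times_tm (WithT ?H ?K) x)) M)
    (VP (vmul \<tau> c (vfst v)) (vmul \<sigma> c (vsnd v)))"
    unfolding times_tm.simps
  proof (rule rep_App_Lam[of S _ _ v])
    fix u assume "\<forall>i<plen ?p. rep S (leaves ?p ! i) (u i) (pvals ?p v ! i)"
    from this[rule_format, of 0] this[rule_format, of 1]
    have u: "rep S ?H (u 0) (vfst v)" "rep S ?K (u 1) (vsnd v)" by simp_all
    have "rep S RealT (bind 2 u s (x + 2)) c" using LTens.prems(1) by (simp add: bind_def)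
    with u LTens.IH(1)[of "bind 2 u s" "x + 2" "u 0" "vfst v"] LTens.IH(2)[of "bind 2 u s" "x + 2" "u 1" "vsnd v"]
    show "rep S (WithT ?H ?K) (subst (bind (plen ?p) u s)
        (With (App (times_tm ?H (x + 2)) (Var 0)) (App (times_tm ?K (x + 2)) (Var 1))))
      (VP (vmul \<tau> c (vfst v)) (vmul \<sigma> c (vsnd v)))"
      by (auto simp: bind_def numeral_2_eq_2)
  qed (use LTens.prems in auto)
  then show ?case by simp
qed simp

text \<open>The numerals \<open>a x\<close> found by evaluation are known only to be beta-equal to
  the arguments, so the results are compared by firing \<open>f\<close> on both tuples.\<close>

lemma rep_Fun:
  assumes "\<forall>x\<in>set xs. rep S RealT (s x) (\<rho> x)" "length xs = arity S f"
  shows "rep S (OfCourse RealT) (App (Fun f) (nest Tens Unit (map (\<lambda>x. Bang (s x)) xs)))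
    (VR (interp S f (map (\<lambda>x. unR (\<rho> x)) xs)))"
proof -
  have "\<exists>a. \<forall>x\<in>set xs. wreds S (s x) (Const (a x)) \<and> beta_eq S (Const (a x)) (Const (unR (\<rho> x)))"
    using assms(1) by (intro bchoice) auto
  then obtain a where a: "\<forall>x\<in>set xs. wreds S (s x) (Const (a x)) \<and> beta_eq S (Const (a x)) (Const (unR (\<rho> x)))" ..
  let ?n = "\<lambda>g. nest Tens Unit (map (\<lambda>x. Bang (g x)) xs)"
  have "\<forall>x\<in>set ys. wreds S (s x) (Const (a x)) \<Longrightarrow>
    wreds S (nest Tens Unit (map (\<lambda>x. Bang (s x)) ys)) (nest Tens Unit (map (\<lambda>x. Bang (Const (a x))) ys))" for ys
    by (induction ys rule: induct_list012) (auto intro: wreds_Bang wreds_Tens)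
  then have "wreds S (?n s) (?n (\<lambda>x. Const (a x)))" using a by blast
  then have "wreds S (App (Fun f) (?n s)) (App (Fun f) (?n (\<lambda>x. Const (a x))))" by (intro wreds_App) auto
  moreover have "wred S (App (Fun f) (?n (\<lambda>x. Const (a x)))) (Bang (Const (interp S f (map a xs))))"
    using w_fun[of "map a xs" S f] assms(2) by (simp add: comp_def)
  ultimately have 1: "wreds S (App (Fun f) (?n s)) (Bang (Const (interp S f (map a xs))))"
    by (rule rtranclp.rtrancl_into_rtrancl)
  have "\<forall>x\<in>set ys. beta_eq S (Const (a x)) (Const (unR (\<rho> x))) \<Longrightarrow>
    beta_eq S (nest Tens Unit (map (\<lambda>x. Bang (Const (a x))) ys)) (nest Tens Unit (map (\<lambda>x. Bang (Const (unR (\<rho> x)))) ys))" for ys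
    by (induction ys rule: induct_list012) (auto intro: beta_eq_Bang beta_eq_Tens)
  then have "beta_eq S (?n (\<lambda>x. Const (a x))) (?n (\<lambda>x. Const (unR (\<rho> x))))" using a by blast
  then have "beta_eq S (App (Fun f) (?n (\<lambda>x. Const (a x)))) (App (Fun f) (?n (\<lambda>x. Const (unR (\<rho> x)))))"
    by (intro beta_eq_App) auto
  moreover have "beta_eq S (App (Fun f) (?n (\<lambda>x. Const (g x)))) (Bang (Const (interp S f (map g xs))))" for g
    using red.fun_app[of "map g xs" S f] assms(2) by (intro r_into_equivclp) (simp add: comp_def)
  ultimately have "beta_eq S (Bang (Const (interp S f (map a xs)))) (Bang (Const (interp S f (map (\<lambda>x. unR (\<rho> x)) xs))))"
    by (meson equivclp_sym equivclp_trans)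
  then have "beta_eq S (Const (interp S f (map a xs))) (Const (interp S f (map (\<lambda>x. unR (\<rho> x)) xs)))"
    by (rule beta_eq_Bang_inj)
  then show ?thesis using 1 by auto
qed

subsection \<open>A denotational semantics of Linear A\<close>

text \<open>No tangent environment is taken: that primal results do not depend on tangents is the
  reason why the two computations can be separated at all.\<close>

primrec evP :: "'f signature \<Rightarrow> 'f exp \<Rightarrow> (nat \<Rightarrow> val) \<Rightarrow> val" where
  "evP S (EPair x y) = (\<lambda>\<rho>. \<rho> (fst x))"
| "evP S (ELet e1 e2) = (\<lambda>\<rho>. evP S e2 (case_nat (evP S e1 \<rho>) \<rho>))"
| "evP S EUnitP = (\<lambda>\<rho>. VU)"
| "evP S EUnitT = (\<lambda>\<rho>. VU)"
| "evP S (ELetUnitP z e) = evP S e"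
| "evP S (ELetUnitT z e) = evP S e"
| "evP S (ETensT x y) = (\<lambda>\<rho>. VU)"
| "evP S (ELetTensT z \<tau>1 \<tau>2 e) = evP S e"
| "evP S (EZero \<tau>) = (\<lambda>\<rho>. VU)"
| "evP S (EAdd x y) = (\<lambda>\<rho>. VU)"
| "evP S (EMul x y) = (\<lambda>\<rho>. VU)"
| "evP S (EConst r) = (\<lambda>\<rho>. VR r)"
| "evP S (EFun f xs) = (\<lambda>\<rho>. VR (interp S f (map (\<lambda>x. unR (\<rho> x)) xs)))"
| "evP S (EDup x) = (\<lambda>\<rho>. VU)"
| "evP S (EDrop e) = (\<lambda>\<rho>. VU)"

text \<open>For fixed \<open>\<rho>\<close> this is a map on tangents, the one that the function
  component of the translation computes.\<close>

primrec evT :: "'f signature \<Rightarrow> 'f exp \<Rightarrow> (nat \<Rightarrow> val) \<Rightarrow> (nat \<Rightarrow> val) \<Rightarrow> val" where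
  "evT S (EPair x y) = (\<lambda>\<rho> \<mu>. \<mu> (fst y))"
| "evT S (ELet e1 e2) = (\<lambda>\<rho> \<mu>. evT S e2 (case_nat (evP S e1 \<rho>) \<rho>) (case_nat (evT S e1 \<rho> \<mu>) \<mu>))"
| "evT S EUnitP = (\<lambda>\<rho> \<mu>. VU)"
| "evT S EUnitT = (\<lambda>\<rho> \<mu>. VU)"
| "evT S (ELetUnitP z e) = evT S e"
| "evT S (ELetUnitT z e) = evT S e"
| "evT S (ETensT x y) = (\<lambda>\<rho> \<mu>. VP (\<mu> (fst x)) (\<mu> (fst y)))"
| "evT S (ELetTensT z \<tau>1 \<tau>2 e) =
    (\<lambda>\<rho> \<mu>. evT S e \<rho> (case_nat (vfst (\<mu> z)) (case_nat (vsnd (\<mu> z)) \<mu>)))"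
| "evT S (EZero \<tau>) = (\<lambda>\<rho> \<mu>. vzero \<tau>)"
| "evT S (EAdd x y) = (\<lambda>\<rho> \<mu>. vadd (snd x) (\<mu> (fst x)) (\<mu> (fst y)))"
| "evT S (EMul x y) = (\<lambda>\<rho> \<mu>. vmul (snd y) (\<rho> x) (\<mu> (fst y)))"
| "evT S (EConst r) = (\<lambda>\<rho> \<mu>. VU)"
| "evT S (EFun f xs) = (\<lambda>\<rho> \<mu>. VU)"
| "evT S (EDup x) = (\<lambda>\<rho> \<mu>. VP (\<mu> (fst x)) (\<mu> (fst x)))"
| "evT S (EDrop e) = (\<lambda>\<rho> \<mu>. VU)"

lemma case_nat_liftn: "case_nat a \<rho> \<circ> liftn (Suc 0) f = case_nat a (\<rho> \<circ> f)"
  "case_nat a (case_nat b \<rho>) \<circ> liftn 2 f = case_nat a (case_nat b (\<rho> \<circ> f))"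
  by (auto simp: liftn_def fun_eq_iff numeral_2_eq_2 split: nat.split)

lemma case_nat_Suc: "case_nat a \<rho> \<circ> Suc = \<rho>"
  by auto

lemma ev_lren:
  "evP S (lren f g e) \<rho> = evP S e (\<rho> \<circ> f)"
  "evT S (lren f g e) \<rho> \<mu> = evT S e (\<rho> \<circ> f) (\<mu> \<circ> g)"
proof -
  \<comment> \<open>The primal claim comes first and for all renamings, because the tangent part of
    a let evaluates its second expression at a primal result.\<close>
  show P: "evP S (lren f g e) \<rho> = evP S e (\<rho> \<circ> f)" for f g e \<rho>
    by (induction e arbitrary: f g \<rho>) (simp_all add: case_nat_liftn, simp add: comp_def)
  show "evT S (lren f g e) \<rho> \<mu> = evT S e (\<rho> \<circ> f) (\<mu> \<circ> g)"
    by (induction e arbitrary: f g \<rho> \<mu>) (simp_all add: case_nat_liftn P)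
qed

lemma ev_sugar [simp]:
  "evP S (letP e1 e2) \<rho> = evP S e2 (case_nat (evP S e1 \<rho>) \<rho>)"
  "evT S (letP e1 e2) \<rho> \<mu> = evT S e2 (case_nat (evP S e1 \<rho>) \<rho>) \<mu>"
  "evP S (letT e1 e2) \<rho> = evP S e2 \<rho>"
  "evT S (letT e1 e2) \<rho> \<mu> = evT S e2 \<rho> (case_nat (evT S e1 \<rho> \<mu>) \<mu>)"
  by (simp_all add: letP_def letT_def ev_lren case_nat_Suc)

lemma ev_pairs [simp]:
  "evP S (varP x) \<rho> = \<rho> (fst x)" "evT S (varT y) \<rho> \<mu> = \<mu> (fst y)"
  "evP S (lpair e1 e2) \<rho> = evP S e1 \<rho>" "evT S (lpair e1 e2) \<rho> \<mu> = evT S e2 \<rho> \<mu>"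
  by (simp_all add: varP_def varT_def lpair_def ev_lren case_nat_Suc)

text \<open>The primal environment seen in the hole of a stack.\<close>

primrec jenv :: "'f signature \<Rightarrow> 'f jframe list \<Rightarrow> (nat \<Rightarrow> val) \<Rightarrow> nat \<Rightarrow> val" where
  "jenv S [] \<rho> = \<rho>"
| "jenv S (fr # E) \<rho> = (case fr of JLet e \<Rightarrow> jenv S E (case_nat (evP S e \<rho>) \<rho>) | JUnit z \<Rightarrow> jenv S E \<rho>)"

lemma ev_jplug:
  "evP S (jplug E e) \<rho> = evP S e (jenv S E \<rho>)" "evT S (jplug E e) \<rho> \<mu> = evT S e (jenv S E \<rho>) \<mu>"
  by (induction E arbitrary: \<rho>) (auto split: jframe.split)

lemma jlen_jren [simp]: "jlen (jren f E) = jlen E"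
  by (induction E arbitrary: f) (auto split: jframe.split)

lemma jenv_append: "jenv S (E1 @ E2) \<rho> = jenv S E2 (jenv S E1 \<rho>)"
  by (induction E1 arbitrary: \<rho>) (auto split: jframe.split)

lemma jenv_shift: "jenv S E \<rho> \<circ> (\<lambda>i. i + jlen E) = \<rho>"
proof (induction E arbitrary: \<rho>)
  case (Cons fr E)
  show ?case
  proof (cases fr)
    case (JLet e)
    have "jenv S E (case_nat (evP S e \<rho>) \<rho>) (Suc i + jlen E) = \<rho> i" for i
      using fun_cong[OF Cons, of "case_nat (evP S e \<rho>) \<rho>" "Suc i"] by simp
    then show ?thesis using JLet by (auto simp: fun_eq_iff)
  next
    case (JUnit z)
    then show ?thesis using Cons[of \<rho>] by simp
  qed
qed auto

lemma jenv_jren: "jenv S (jren f E) \<rho> \<circ> liftn (jlen E) f = jenv S E (\<rho> \<circ> f)"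
proof (induction E arbitrary: f \<rho>)
  case (Cons fr E)
  show ?case
  proof (cases fr)
    case (JLet e)
    let ?v = "evP S e (\<rho> \<circ> f)"
    have "jenv S (jren f (fr # E)) \<rho> \<circ> liftn (jlen (fr # E)) f =
        jenv S (jren (liftn (Suc 0) f) E) (case_nat ?v \<rho>) \<circ> liftn (jlen E) (liftn (Suc 0) f)"
      by (simp add: JLet ev_lren liftn_liftn)
    also have "\<dots> = jenv S E (case_nat ?v \<rho> \<circ> liftn (Suc 0) f)" by (rule Cons)
    also have "\<dots> = jenv S (fr # E) (\<rho> \<circ> f)" by (simp add: JLet case_nat_liftn)
    finally show ?thesis .
  next
    case (JUnit z)
    then show ?thesis using Cons[of f \<rho>] by simp
  qed
qed auto

text \<open>The stack leaves in the primal environment all values on which the tangent part depends;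
  what remains is to check that the shifted indices find them, and only the let shifts
  indices.\<close>

lemma jax_sound:
  "jax e = (E, p, t) \<Longrightarrow> evP S p (jenv S E \<rho>) = evP S e \<rho> \<and> evT S t (jenv S E \<rho>) \<mu> = evT S e \<rho> \<mu>"
proof (induction e arbitrary: E p t \<rho> \<mu>)
  case (ELet e1 e2)
  obtain E1 p1 t1 E2 p2 t2 where j: "jax e1 = (E1, p1, t1)" "jax e2 = (E2, p2, t2)"
    by (metis prod_cases3)
  define r where "r = liftn 1 (\<lambda>i. i + jlen E1)"
  define r' where "r' = liftn (jlen E2) r"
  have eq: "E = E1 @ [JLet p1] @ jren r E2" "p = lren r' id p2"
    "t = letT (lren (\<lambda>i. i + 1 + jlen E2) id t1) (lren r' id t2)"
    using ELet.prems j by (auto simp: r_def r'_def Let_def)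
  let ?\<rho>1 = "jenv S E1 \<rho>"
  let ?\<rho>2 = "case_nat (evP S e1 \<rho>) ?\<rho>1"
  let ?\<rho>3 = "jenv S (jren r E2) ?\<rho>2"
  have env: "jenv S E \<rho> = ?\<rho>3"
    using ELet.IH(1)[OF j(1)] by (simp add: eq jenv_append)
  have "?\<rho>2 \<circ> r = case_nat (evP S e1 \<rho>) \<rho>"
    by (simp add: r_def case_nat_liftn jenv_shift)
  then have r': "?\<rho>3 \<circ> r' = jenv S E2 (case_nat (evP S e1 \<rho>) \<rho>)"
    by (simp add: r'_def jenv_jren)
  have "?\<rho>3 (i + jlen E2) = ?\<rho>2 i" for i
    using fun_cong[OF jenv_shift[of S "jren r E2" ?\<rho>2]] by simp
  \<comment> \<open>The index right behind the variables of \<open>E2\<close> is the let-bound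
    primal variable. The tangent part of \<open>e1\<close> lives in the scope of \<open>E1\<close>
    alone, hence the specialisation to successors.\<close>
  from this[of "Suc _"] have "?\<rho>3 \<circ> (\<lambda>i. i + 1 + jlen E2) = ?\<rho>1"
    by (auto simp: fun_eq_iff)
  then show ?case
    unfolding env unfolding eq
    using ELet.IH(1)[OF j(1)] ELet.IH(2)[OF j(2)] r' by (simp add: ev_lren)
next
  case (ELetUnitP z e)
  then show ?case by (auto split: prod.splits)
next
  case (ELetUnitT z e)
  then show ?case by (auto split: prod.splits)
next
  case (ELetTensT z \<tau>1 \<tau>2 e)
  then show ?case by (auto split: prod.splits)
next
  case (EDrop e)
  then show ?case by (auto split: prod.splits)
qed auto

theorem unzip_jax_sound:
  "evP S (unzip_jax e) \<rho> = evP S e \<rho>" "evT S (unzip_jax e) \<rho> \<mu> = evT S e \<rho> \<mu>"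
  using jax_sound[of e _ _ _ S \<rho>] by (auto simp: unzip_jax_def ev_jplug split: prod.split)

subsection \<open>A relaxed typing of Linear A\<close>

text \<open>The unzipped expression need not be typable in Linear A: the rule for \<open>let \<otimes>() = z in e\<close>
  forbids \<open>z\<close> in \<open>e\<close>, but unzipping extends the scope of this let over expressions that may share \<open>z\<close>.
  Looking up primal variables in a context that is not split is stable under unzipping.\<close>

primrec wt :: "'f signature \<Rightarrow> 'f exp \<Rightarrow> lctx \<Rightarrow> bool" where
  "wt S (EPair x y) = (\<lambda>G. G (fst x) = Some (snd x))"
| "wt S (ELet e1 e2) = (\<lambda>G. wt S e1 G \<and> wt S e2 (push (fst (ety e1)) G) \<and>
    {v \<in> FVt e2. fst v = 0} = {(0, snd (ety e1))})"
| "wt S EUnitP = (\<lambda>G. True)"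
| "wt S EUnitT = (\<lambda>G. True)"
| "wt S (ELetUnitP z e) = (\<lambda>G. G z = Some LOne \<and> wt S e G)"
| "wt S (ELetUnitT z e) = (\<lambda>G. wt S e G \<and> (z, LOne) \<notin> FVt e)"
| "wt S (ETensT x y) = (\<lambda>G. True)"
| "wt S (ELetTensT z \<tau>1 \<tau>2 e) = (\<lambda>G. wt S e G \<and>
    {v \<in> FVt e. fst v < 2} = {(0, \<tau>1), (1, \<tau>2)} \<and> up 2 (z, LTens \<tau>1 \<tau>2) \<notin> FVt e)"
| "wt S (EZero \<tau>) = (\<lambda>G. True)"
| "wt S (EAdd x y) = (\<lambda>G. snd x = snd y)"
| "wt S (EMul x y) = (\<lambda>G. G x = Some LReal)"
| "wt S (EConst r) = (\<lambda>G. True)"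
| "wt S (EFun f xs) = (\<lambda>G. length xs = arity S f \<and> (\<forall>x\<in>set xs. G x = Some LReal))"
| "wt S (EDup x) = (\<lambda>G. True)"
| "wt S (EDrop e) = wt S e"

lemma push_simps [simp]: "push \<tau> G 0 = Some \<tau>" "push \<tau> G (Suc i) = G i"
  by (auto simp: push_def)

lemma push_mono: "G \<subseteq>\<^sub>m G' \<Longrightarrow> push \<tau> G \<subseteq>\<^sub>m push \<tau> G'"
  by (auto simp: map_le_def push_def dom_def split: nat.splits)

lemma finite_dom_push [simp]: "finite (dom (push \<tau> G)) = finite (dom G)"
proof -
  have "dom (push \<tau> G) = insert 0 (Suc ` dom G)"
  proof (rule set_eqI)
    show "i \<in> dom (push \<tau> G) \<longleftrightarrow> i \<in> insert 0 (Suc ` dom G)" for i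
      by (cases i) auto
  qed
  then show ?thesis by (simp add: finite_image_iff)
qed

lemma finite_lin_typed: "lin_typed S G D e \<tau> \<sigma> \<Longrightarrow> finite (dom G)"
  by (induction rule: lin_typed.induct) (simp_all add: dom_map_of_conv_image_fst dom_if)

text \<open>Tangent contexts admit neither weakening nor sharing, so the context is determined by
  the expression.\<close>

lemma FVt_lin_typed: "lin_typed S G D e \<tau> \<sigma> \<Longrightarrow> FVt e = Map.graph D"
proof (induction rule: lin_typed.induct)
  case (l_let G1 D1 e1 \<tau>1 \<sigma>1 G2 D2 e2 \<tau> \<sigma>)
  have "Map.graph (D1 ++ D2) = Map.graph D1 \<union> Map.graph D2"
    using l_let.hyps by (intro graph_map_add) 
  moreover have "{v. up 1 v \<in> Map.graph (push \<sigma>1 D2)} = Map.graph D2"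
    by (auto simp: graph_def up_def)
  ultimately show ?case using l_let.IH by simp
next
  case (l_let_unitT G D e \<tau> \<sigma> z)
  then show ?case by (auto simp: graph_def split: if_splits)
next
  case (l_let_tensT G \<tau>1 \<tau>2 D e \<tau> \<sigma> z)
  have "{v. up 2 v \<in> Map.graph (push \<tau>1 (push \<tau>2 D))} = Map.graph D"
    by (auto simp: graph_def up_def numeral_2_eq_2)
  then show ?case using l_let_tensT by (auto simp: graph_def split: if_splits)
qed (auto simp: graph_def split: if_splits)

text \<open>The slack between \<open>G\<close> and \<open>G'\<close> absorbs the splitting of primal
  contexts. The tangent conditions of \<open>wt\<close> express linearity and are read off from the
  graph of the tangent context.\<close>

lemma wt_lin_typed: "lin_typed S G D e \<tau> \<sigma> \<Longrightarrow> G \<subseteq>\<^sub>m G' \<Longrightarrow> wt S e G'"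
proof (induction arbitrary: G' rule: lin_typed.induct)
  case (l_let G1 D1 e1 \<tau>1 \<sigma>1 G2 D2 e2 \<tau> \<sigma>)
  have "G1 \<subseteq>\<^sub>m G1 ++ G2" unfolding map_le_def
  proof
    fix x assume "x \<in> dom G1"
    then show "G1 x = (G1 ++ G2) x"
      using l_let.hyps(3) by (cases "x \<in> dom G2") (auto simp: map_add_dom_app_simps)
  qed
  moreover have "G2 \<subseteq>\<^sub>m G1 ++ G2" by (rule map_le_map_add)
  ultimately  have "G1 \<subseteq>\<^sub>m G'" "G2 \<subseteq>\<^sub>m G'"
    using l_let.prems by (blast intro: map_le_trans)+
  moreover note push_mono[OF this(2), of \<tau>1]
  moreover have "{v \<in> FVt e2. fst v = 0} = {(0, \<sigma>1)}"
    using FVt_lin_typed[OF l_let.hyps(2)] by (auto simp: graph_def)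
  ultimately show ?case
    using l_let.IH ety_lin_typed[OF l_let.hyps(1)] by simp
next
  case (l_let_unitP G D e \<tau> \<sigma> z)
  have "G \<subseteq>\<^sub>m G(z \<mapsto> LOne)" using l_let_unitP.hyps by (auto simp: map_le_def)
  moreover have le: "G(z \<mapsto> LOne) \<subseteq>\<^sub>m G'" using l_let_unitP.prems by (simp add: fun_upd_def)
  ultimately have "G \<subseteq>\<^sub>m G'" by (rule map_le_trans)
  moreover have "G' z = Some LOne" using le by (force simp: map_le_def)
  ultimately show ?case using l_let_unitP.IH by simp
next
  case (l_let_unitT G D e \<tau> \<sigma> z)
  then show ?case using FVt_lin_typed[OF l_let_unitT.hyps(1)] by (auto simp: graph_def)
next
  case (l_let_tensT G \<tau>1 \<tau>2 D e \<tau> \<sigma> z)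
  have "{v \<in> FVt e. fst v < 2} = {(0, \<tau>1), (1, \<tau>2)}"
    using FVt_lin_typed[OF l_let_tensT.hyps(1)] by (auto simp: graph_def less_2_cases_iff)
  moreover have "up 2 (z, LTens \<tau>1 \<tau>2) \<notin> FVt e"
    using FVt_lin_typed[OF l_let_tensT.hyps(1)] l_let_tensT.hyps(2)
    by (auto simp: graph_def up_def numeral_2_eq_2)
  ultimately show ?case using l_let_tensT by simp
next
  case (l_fun xs f)
  have "map_of (map (\<lambda>x. (x, LReal)) xs) x = Some LReal" if "x \<in> set xs" for x
    using that by (induction xs) auto
  then have "G' x = Some LReal" if "x \<in> set xs" for x
    using l_fun.prems that by (force simp: map_le_def dom_def)
  then show ?case using l_fun by simp
qed (force simp: map_le_def)+

section \<open>Renaming under the relaxed typing\<close>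

lemma ety_lren [simp]: "ety (lren f g e) = ety e"
  by (induction e arbitrary: f g) auto

lemma apfst_liftn_up: "apfst (liftn k g) (up k v) = up k (apfst g v)"
  by (cases v) (simp add: up_def liftn_def)

text \<open>A lifted renaming fixes the indices below \<open>k\<close>, so every preimage of a
  shifted variable is itself shifted.\<close>

lemma up_in_apfst_liftn: "up k v \<in> apfst (liftn k g) ` X \<longleftrightarrow> v \<in> apfst g ` {w. up k w \<in> X}"
proof
  assume "up k v \<in> apfst (liftn k g) ` X"
  then obtain w where w: "w \<in> X" "up k v = apfst (liftn k g) w" by auto
  then have "k \<le> fst w" by (cases w; cases v) (auto simp: up_def liftn_def split: if_splits)
  then have "w = up k (fst w - k, snd w)" by (simp add: up_def)
  with w have "up k v = up k (apfst g (fst w - k, snd w))" "up k (fst w - k, snd w) \<in> X"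
    by (metis apfst_liftn_up)+
  then show "v \<in> apfst g ` {w. up k w \<in> X}"
    by (auto simp: up_def prod_eq_iff intro!: rev_image_eqI[of "(fst w - k, snd w)"])
next
  assume "v \<in> apfst g ` {w. up k w \<in> X}"
  then obtain w where "v = apfst g w" "up k w \<in> X" by auto
  then show "up k v \<in> apfst (liftn k g) ` X"
    using apfst_liftn_up[of k g w] by (metis image_eqI)
qed

lemma fst_less_apfst_liftn: "{v \<in> apfst (liftn k g) ` X. fst v < k} = {v \<in> X. fst v < k}"
  by (force simp: liftn_def split: if_splits)

lemma fst_0_apfst_liftn: "{v \<in> apfst (liftn (Suc 0) g) ` X. fst v = 0} = {v \<in> X. fst v = 0}"
  using fst_less_apfst_liftn[of "Suc 0" g X] by simp

lemma FVt_lren: "FVt (lren f g e) = apfst g ` FVt e"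
proof (induction e arbitrary: f g)
  case (ELet e1 e2)
  then show ?case by (auto simp: up_in_apfst_liftn)
next
  case (ELetTensT z \<tau>1 \<tau>2 e)
  then show ?case by (auto simp: up_in_apfst_liftn)
qed auto

lemma inj_liftn:
  assumes "inj g"
  shows "inj (liftn k g)"
proof (rule injI)
  fix x y assume "liftn k g x = liftn k g y"
  then show "x = y"
    using inj_eq[OF assms, of "x - k" "y - k"] by (simp add: liftn_def split: if_splits)
qed

text \<open>Primal variables are only looked up, so \<open>f\<close> has to preserve lookups and may
  even merge variables. The tangent conditions also speak of absence, hence \<open>g\<close> has to
  be injective.\<close>

lemma wt_lren:
  "wt S e G \<Longrightarrow> \<forall>x \<tau>. G x = Some \<tau> \<longrightarrow> G' (f x) = Some \<tau> \<Longrightarrow> inj g \<Longrightarrow> wt S (lren f g e) G'"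
proof (induction e arbitrary: f g G G')
  case (ELet e1 e2)
  have "\<forall>x \<tau>. push (fst (ety e1)) G x = Some \<tau> \<longrightarrow> push (fst (ety e1)) G' (liftn 1 f x) = Some \<tau>"
    using ELet.prems(2) by (auto simp: push_def liftn_def split: nat.splits)
  then show ?case
    using ELet.IH(1)[of G G' f g] ELet.prems
      ELet.IH(2)[of "push (fst (ety e1)) G" "push (fst (ety e1)) G'" "liftn 1 f" "liftn 1 g"]
      inj_liftn[OF ELet.prems(3), of 1]
    by (simp add: FVt_lren fst_0_apfst_liftn)
next
  case (ELetUnitT z e)
  then show ?case by (auto simp: FVt_lren dest: injD)
next
  case (ELetTensT z \<tau>1 \<tau>2 e)
  have "up 2 (g z, LTens \<tau>1 \<tau>2) \<notin> FVt (lren f (liftn 2 g) e)"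
  proof
    assume "up 2 (g z, LTens \<tau>1 \<tau>2) \<in> FVt (lren f (liftn 2 g) e)"
    then have "(g z, LTens \<tau>1 \<tau>2) \<in> apfst g ` {w. up 2 w \<in> FVt e}"
      by (simp add: FVt_lren up_in_apfst_liftn)
    then show False using ELetTensT.prems by (auto dest: injD)
  qed
  then show ?case
    using ELetTensT inj_liftn[OF ELetTensT.prems(3), of 2] by (auto simp: FVt_lren fst_less_apfst_liftn)
qed auto

section \<open>Relaxed typing of the sugar and of stacks of primal lets\<close>

lemma FVt_sugar [simp]:
  "FVt (letP e1 e2) = FVt e1 \<union> FVt e2"
  "FVt (letT e1 e2) = FVt e1 \<union> {v. up 1 v \<in> FVt e2}"
proof -
  have "inj (apfst Suc)" by (rule injI) (auto simp: prod_eq_iff)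
  moreover have "up 1 v = apfst Suc v" for v by (simp add: up_def prod_eq_iff)
  moreover have "apfst Suc v \<noteq> (0, LOne)" for v by (simp add: prod_eq_iff)
  ultimately show "FVt (letP e1 e2) = FVt e1 \<union> FVt e2" "FVt (letT e1 e2) = FVt e1 \<union> {v. up 1 v \<in> FVt e2}"
    by (simp_all add: letP_def letT_def FVt_lren inj_image_mem_iff)
qed

lemma ety_sugar [simp]: "ety (letP e1 e2) = ety e2" "ety (letT e1 e2) = ety e2"
  by (auto simp: letP_def letT_def)

lemma wt_letP:
  assumes "wt S e1 G" "snd (ety e1) = LOne" "wt S e2 (push (fst (ety e1)) G)"
  shows "wt S (letP e1 e2) G"
  using assms wt_lren[of S e2 "push (fst (ety e1)) G" "push (fst (ety e1)) G" id Suc]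
  by (auto simp: letP_def FVt_lren)

lemma wt_letT:
  assumes "wt S e1 G" "fst (ety e1) = LOne" "wt S e2 G" "{v \<in> FVt e2. fst v = 0} = {(0, snd (ety e1))}"
  shows "wt S (letT e1 e2) G"
  using assms wt_lren[of S e2 G "push LOne G" Suc id]
  by (auto simp: letT_def FVt_lren)

lemma wt_pairs:
  assumes "wt S e1 G" "ety e1 = (\<tau>, LOne)" "FVt e1 = {}" "wt S e2 G" "ety e2 = (LOne, \<sigma>)"
  shows "wt S (lpair e1 e2) G" "ety (lpair e1 e2) = (\<tau>, \<sigma>)" "FVt (lpair e1 e2) = FVt e2"
proof -
  have "wt S (lren Suc id e2) (push \<tau> G)" using assms by (intro wt_lren) auto
  then show "wt S (lpair e1 e2) G"
    unfolding lpair_def using assms by (intro wt_letP wt_letT) auto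
  show "ety (lpair e1 e2) = (\<tau>, \<sigma>)" "FVt (lpair e1 e2) = FVt e2"
    using assms by (auto simp: lpair_def FVt_lren up_def)
qed

lemma wt_vars:
  "ety (varP x) = (snd x, LOne)" "FVt (varP x) = {}" "G (fst x) = Some (snd x) \<Longrightarrow> wt S (varP x) G"
  "ety (varT y) = (LOne, snd y)" "FVt (varT y) = {y}" "wt S (varT y) G"
  by (auto simp: varP_def varT_def up_def intro!: wt_letP wt_letT)

primrec jctx :: "'f jframe list \<Rightarrow> lctx \<Rightarrow> lctx" where
  "jctx [] G = G"
| "jctx (fr # E) G = (case fr of JLet e \<Rightarrow> jctx E (push (fst (ety e)) G) | JUnit z \<Rightarrow> jctx E G)"

primrec jwt :: "'f signature \<Rightarrow> 'f jframe list \<Rightarrow> lctx \<Rightarrow> bool" where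
  "jwt S [] G = True"
| "jwt S (fr # E) G = (case fr of
      JLet e \<Rightarrow> wt S e G \<and> FVt e = {} \<and> snd (ety e) = LOne \<and> jwt S E (push (fst (ety e)) G)
    | JUnit z \<Rightarrow> G z = Some LOne \<and> jwt S E G)"

text \<open>Well-typed frames contain no free tangent variables, so plugging preserves tangent
  variables along with types.\<close>

lemma jplug_wt:
  "jwt S E G \<Longrightarrow> wt S e (jctx E G) \<Longrightarrow> wt S (jplug E e) G \<and> ety (jplug E e) = ety e \<and> FVt (jplug E e) = FVt e"
  by (induction E arbitrary: G) (auto split: jframe.splits intro: wt_letP)

lemma jctx_append: "jctx (E1 @ E2) G = jctx E2 (jctx E1 G)"
  by (induction E1 arbitrary: G) (auto split: jframe.split)

lemma jwt_append: "jwt S (E1 @ E2) G \<longleftrightarrow> jwt S E1 G \<and> jwt S E2 (jctx E1 G)"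
  by (induction E1 arbitrary: G) (auto split: jframe.split)

lemma jctx_shift: "jctx E G (i + jlen E) = G i"
proof (induction E arbitrary: G i)
  case (Cons fr E)
  show ?case
  proof (cases fr)
    case (JLet e)
    then show ?thesis using Cons[of "push (fst (ety e)) G" "Suc i"] by simp
  next
    case (JUnit z)
    then show ?thesis using Cons[of G i] by simp
  qed
qed auto

lemma push_liftn:
  "\<forall>x \<tau>. G x = Some \<tau> \<longrightarrow> G' (f x) = Some \<tau> \<Longrightarrow>
    \<forall>x \<tau>. push \<sigma> G x = Some \<tau> \<longrightarrow> push \<sigma> G' (liftn 1 f x) = Some \<tau>"
  by (auto simp: push_def liftn_def split: nat.splits)

text \<open>Contexts are compared by preservation of lookups rather than equality, because the new
  context may also contain variables that \<open>f\<close> jumps over.\<close>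

lemma jwt_jren:
  "jwt S E G \<Longrightarrow> \<forall>x \<tau>. G x = Some \<tau> \<longrightarrow> G' (f x) = Some \<tau> \<Longrightarrow>
    jwt S (jren f E) G' \<and>
    (\<forall>x \<tau>. jctx E G x = Some \<tau> \<longrightarrow> jctx (jren f E) G' (liftn (jlen E) f x) = Some \<tau>)"
proof (induction E arbitrary: G G' f)
  case (Cons fr E)
  show ?case
  proof (cases fr)
    case (JLet e)
    let ?\<tau> = "fst (ety e)"
    have *: "wt S e G" "FVt e = {}" "snd (ety e) = LOne" "jwt S E (push ?\<tau> G)"
      using Cons.prems(1) JLet by auto
    have "wt S (lren f id e) G'" using *(1) Cons.prems(2) by (rule wt_lren) simp
    moreover have "jwt S (jren (liftn 1 f) E) (push ?\<tau> G') \<and>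
      (\<forall>x \<tau>. jctx E (push ?\<tau> G) x = Some \<tau> \<longrightarrow>
        jctx (jren (liftn 1 f) E) (push ?\<tau> G') (liftn (jlen E) (liftn 1 f) x) = Some \<tau>)"
      using *(4) push_liftn[of G G' f ?\<tau>, OF Cons.prems(2)] by (rule Cons.IH)
    ultimately show ?thesis using * JLet by (simp add: FVt_lren liftn_liftn)
  next
    case (JUnit z)
    then show ?thesis using Cons.prems Cons.IH[of G G' f] by simp
  qed
qed simp

text \<open>All tangent variables of \<open>e\<close> move into \<open>t\<close>, while the stack
  and the primal part keep none: this is the form in which linearity of tangents survives
  unzipping.\<close>

lemma jax_wt:
  "wt S e G \<Longrightarrow> jax e = (E, p, t) \<Longrightarrow>
    jwt S E G \<and> wt S p (jctx E G) \<and> FVt p = {} \<and> ety p = (fst (ety e), LOne) \<and>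
    wt S t (jctx E G) \<and> FVt t = FVt e \<and> ety t = (LOne, snd (ety e))"
proof (induction e arbitrary: E p t G)
  case (ELet e1 e2)
  obtain E1 p1 t1 E2 p2 t2 where j: "jax e1 = (E1, p1, t1)" "jax e2 = (E2, p2, t2)"
    by (metis prod_cases3)
  define r where "r = liftn 1 (\<lambda>i. i + jlen E1)"
  define r' where "r' = liftn (jlen E2) r"
  have eq: "E = E1 @ [JLet p1] @ jren r E2" "p = lren r' id p2"
    "t = letT (lren (\<lambda>i. i + 1 + jlen E2) id t1) (lren r' id t2)"
    using ELet.prems j by (auto simp: r_def r'_def Let_def)
  let ?\<tau> = "fst (ety e1)"
  let ?G1 = "jctx E1 G" and ?G2 = "jctx E2 (push ?\<tau> G)"
  let ?G3 = "jctx (jren r E2) (push ?\<tau> ?G1)"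
  have wt: "wt S e1 G" "wt S e2 (push ?\<tau> G)" "{v \<in> FVt e2. fst v = 0} = {(0, snd (ety e1))}"
    using ELet.prems(1) by auto
  note 1 = ELet.IH(1)[OF wt(1) j(1)] and 2 = ELet.IH(2)[OF wt(2) j(2)]
  have r: "\<forall>x \<tau>. push ?\<tau> G x = Some \<tau> \<longrightarrow> push ?\<tau> ?G1 (r x) = Some \<tau>"
    unfolding r_def by (rule push_liftn) (simp add: jctx_shift)
  have r': "\<forall>x \<tau>. ?G2 x = Some \<tau> \<longrightarrow> ?G3 (r' x) = Some \<tau>" and jwt: "jwt S (jren r E2) (push ?\<tau> ?G1)"
    using jwt_jren[of S E2 "push ?\<tau> G" "push ?\<tau> ?G1" r] r 2 by (auto simp: r'_def)
  \<comment> \<open>One index for the let-bound variable and \<open>jlen E2\<close> for the second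
    stack separate the scope of \<open>t1\<close> from the hole.\<close>
  have s: "\<forall>x \<tau>. ?G1 x = Some \<tau> \<longrightarrow> ?G3 (x + 1 + jlen E2) = Some \<tau>"
    using jctx_shift[of "jren r E2" "push ?\<tau> ?G1" "Suc _"] by simp
  have ctx: "jctx E G = ?G3" using 1 by (simp add: eq jctx_append)
  have "wt S (letT (lren (\<lambda>i. i + 1 + jlen E2) id t1) (lren r' id t2)) ?G3"
    using 1 2 wt(3) wt_lren[of S t1 ?G1 ?G3 _ id, OF _ s] wt_lren[of S t2 ?G2 ?G3 r' id] r'
    by (intro wt_letT) (auto simp: FVt_lren)
  moreover have "jwt S E G" using 1 jwt by (simp add: eq jwt_append)
  moreover have "wt S p ?G3" using 2 wt_lren[of S p2 ?G2 ?G3 r' id] r' by (simp add: eq)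
  ultimately show ?case unfolding ctx using 1 2 by (simp add: eq FVt_lren)
next
  case (EPair x y)
  then show ?case by (auto simp: wt_vars)
next
  case (ELetUnitP z e)
  then show ?case by (auto split: prod.splits)
next
  case (ELetUnitT z e)
  then show ?case by (auto split: prod.splits)
next
  case (ELetTensT z \<tau>1 \<tau>2 e)
  then show ?case by (auto split: prod.splits)
next
  case (EDrop e)
  then show ?case by (auto split: prod.splits)
qed auto

theorem unzip_jax_wt:
  assumes "wt S e G"
  shows "wt S (unzip_jax e) G" "ety (unzip_jax e) = ety e" "FVt (unzip_jax e) = FVt e"
proof -
  obtain E p t where j: "jax e = (E, p, t)" by (metis prod_cases3)
  note * = jax_wt[OF assms j]
  have "wt S (lpair p t) (jctx E G)" "ety (lpair p t) = ety e" "FVt (lpair p t) = FVt e"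
    using * wt_pairs[of S p "jctx E G" "fst (ety e)" t "snd (ety e)"] by auto
  then show "wt S (unzip_jax e) G" "ety (unzip_jax e) = ety e" "FVt (unzip_jax e) = FVt e"
    using * jplug_wt[of S E G "lpair p t"] by (auto simp: unzip_jax_def j)
qed

subsection \<open>Tuple patterns\<close>

primrec ppty :: "ty pat \<Rightarrow> ty" where
  "ppty (PVar A) = A"
| "ppty (PBang A) = OfCourse A"
| "ppty PUnit = OneT"
| "ppty (PTens p q) = TensT (ppty p) (ppty q)"
| "ppty (PWith p q) = WithT (ppty p) (ppty q)"

lemma pty_number [simp]: "pty (number k p) = ppty p"
  by (induction p arbitrary: k) auto

lemma ppty_with_pat [simp]: "ppty (with_pat ps) = with_ty (map ppty ps)"
  by (induction ps rule: induct_list012) auto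

lemma tangent_with_pat: "\<forall>p\<in>set ps. tangent_pat p \<Longrightarrow> tangent_pat (with_pat ps)"
  by (induction ps rule: induct_list012) auto

text \<open>The empty tuple is excluded: its pattern is a fresh variable of type
  \<open>TopT\<close>, a leaf that belongs to no component.\<close>

lemma leaves_with_pat: "ps \<noteq> [] \<Longrightarrow> leaves (with_pat ps) = concat (map leaves ps)"
  by (induction ps rule: induct_list012) auto

lemma pvals_with_pat:
  "length vs = length ps \<Longrightarrow> ps \<noteq> [] \<Longrightarrow> pvals (with_pat ps) (vtuple vs) = concat (map2 pvals ps vs)"
proof (induction ps arbitrary: vs rule: induct_list012)
  case (2 p)
  then show ?case by (auto simp: length_Suc_conv)
next
  case (3 p q ps)
  then obtain v w vs' where vs: "vs = v # w # vs'" by (auto simp: length_Suc_conv)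
  then show ?case using 3(2)[of "w # vs'"] 3(3) by simp
qed simp

lemma upat_simps [simp]:
  "upat [] = PVar TopT" "width [] = 1" "ppty (upat \<theta>) = arg_ty \<theta>" "plen (upat \<theta>) = width \<theta>"
  "tangent_pat (upat \<theta>)"
  by (simp_all add: upat_def width_def comp_def tangent_with_pat)

lemma leaves_upat: "\<theta> \<noteq> [] \<Longrightarrow> leaves (upat \<theta>) = map (\<lambda>v. tyT (snd v)) \<theta>"
  by (auto simp: upat_def leaves_with_pat comp_def)

lemma width_eq: "\<theta> \<noteq> [] \<Longrightarrow> width \<theta> = length \<theta>"
  by (simp add: width_def plen_def leaves_upat)

lemma pvals_upat:
  assumes "length vs = length \<theta>" "\<theta> \<noteq> []"
  shows "pvals (upat \<theta>) (vtuple vs) = vs"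
proof -
  have "length vs = length \<theta> \<Longrightarrow> concat (map2 pvals (map (\<lambda>v. PVar (tyT (snd v))) \<theta>) vs) = vs" for \<theta> :: "lvar list" and vs
    by (induction \<theta> vs rule: list_induct2') auto
  then show ?thesis using assms by (simp add: upat_def pvals_with_pat)
qed

lemma upos_Cons: "upos (y # ys) v = (if v = y then 0 else Suc (upos ys v))"
  by (simp add: upos_def)

lemma upos_nth: "y \<in> set \<theta> \<Longrightarrow> upos \<theta> y < length \<theta> \<and> \<theta> ! upos \<theta> y = y"
  by (induction \<theta>) (auto simp: upos_Cons)

lemma upos_width: "y \<in> set \<theta> \<Longrightarrow> upos \<theta> y < width \<theta>"
  using upos_nth[of y \<theta>] width_eq[of \<theta>] by (cases "\<theta> = []") auto

lemma upos_append: "v \<in> set xs \<Longrightarrow> upos (xs @ ys) v = upos xs v"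
  "v \<notin> set xs \<Longrightarrow> upos (xs @ ys) v = length xs + upos ys v"
  by (auto simp: upos_def takeWhile_append)

text \<open>The pattern \<open>u\<^sub>\<theta>[\<langle>x\<^sub>1, x\<^sub>2\<rangle>/u\<^sub>z]\<close> and the position of \<open>u\<^sub>v\<close> in it, for \<open>v\<close> other than \<open>z\<close>.\<close>

definition split_pat :: "lvar list \<Rightarrow> lvar \<Rightarrow> lty \<Rightarrow> lty \<Rightarrow> ty pat" where
  "split_pat \<theta> z \<tau>1 \<tau>2 = with_pat (map (\<lambda>v. if v = z then PWith (PVar (tyT \<tau>1)) (PVar (tyT \<tau>2))
    else PVar (tyT (snd v))) \<theta>)"

definition split_pos :: "lvar list \<Rightarrow> lvar \<Rightarrow> lvar \<Rightarrow> nat" where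
  "split_pos \<theta> z v = (if upos \<theta> v < upos \<theta> z then upos \<theta> v else upos \<theta> v + 1)"

text \<open>Kept general in \<open>f\<close> so that it serves for the types of the leaves and for
  the matched values. Distinctness makes the first occurrence of \<open>z\<close> the place where
  the extra entry is inserted.\<close>

lemma split_nth:
  assumes "\<theta> = xs @ z # ys" "distinct \<theta>"
  shows "(map f xs @ a # b # map f ys) ! upos \<theta> z = a"
    "(map f xs @ a # b # map f ys) ! (upos \<theta> z + 1) = b"
    "v \<in> set \<theta> \<Longrightarrow> v \<noteq> z \<Longrightarrow> (map f xs @ a # b # map f ys) ! split_pos \<theta> z v = f v"
    "upos \<theta> z < length \<theta>"
    "v \<in> set \<theta> \<Longrightarrow> v \<noteq> z \<Longrightarrow> split_pos \<theta> z v < Suc (length \<theta>)"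
proof -
  have z: "upos \<theta> z = length xs" using assms by (simp add: upos_append upos_Cons)
  show "(map f xs @ a # b # map f ys) ! upos \<theta> z = a" "(map f xs @ a # b # map f ys) ! (upos \<theta> z + 1) = b"
    "upos \<theta> z < length \<theta>"
    using assms(1) unfolding z by (simp_all add: nth_append)
  assume v: "v \<in> set \<theta>" "v \<noteq> z"
  then consider "v \<in> set xs" | "v \<notin> set xs" "v \<in> set ys" using assms(1) by auto
  then have "(map f xs @ a # b # map f ys) ! split_pos \<theta> z v = f v \<and> split_pos \<theta> z v < Suc (length \<theta>)"
  proof cases
    case 1
    then show ?thesis
      using upos_nth[OF 1] assms(1) unfolding split_pos_def z by (simp add: upos_append nth_append)
  next
    case 2
    then show ?thesis
      using upos_nth[OF 2(2)] assms(1) v(2) unfolding split_pos_def z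
      by (simp add: upos_append upos_Cons nth_append)
  qed
  then show "(map f xs @ a # b # map f ys) ! split_pos \<theta> z v = f v" "split_pos \<theta> z v < Suc (length \<theta>)"
    by auto
qed

lemma split_pat:
  assumes "\<theta> = xs @ z # ys" "distinct \<theta>" "snd z = LTens \<tau>1 \<tau>2"
  defines "q \<equiv> split_pat \<theta> z \<tau>1 \<tau>2" and "f \<equiv> \<lambda>v. tyT (snd v)"
  shows "leaves q = map f xs @ tyT \<tau>1 # tyT \<tau>2 # map f ys" "tangent_pat q" "ppty q = arg_ty \<theta>"
    "plen q = Suc (length \<theta>)"
    "pvals q (vtuple (map g \<theta>)) = map g xs @ vfst (g z) # vsnd (g z) # map g ys"
proof -
  let ?h = "\<lambda>v. if v = z then PWith (PVar (tyT \<tau>1)) (PVar (tyT \<tau>2)) else PVar (tyT (snd v))"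
  have h: "map ?h xs = map (\<lambda>v. PVar (f v)) xs" "map ?h ys = map (\<lambda>v. PVar (f v)) ys"
    using assms(1,2) by (auto simp: f_def)
  have c: "concat (map (\<lambda>x. leaves (?h x)) zs) = map f zs" if "z \<notin> set zs" for zs
    using that by (induction zs) (auto simp: f_def)
  show l: "leaves q = map f xs @ tyT \<tau>1 # tyT \<tau>2 # map f ys"
    using assms(1,2) c[of xs] c[of ys] by (simp add: q_def split_pat_def leaves_with_pat comp_def)
  show "tangent_pat q" unfolding q_def split_pat_def by (rule tangent_with_pat) auto
  have "map (ppty \<circ> ?h) \<theta> = map (\<lambda>v. tyT (snd v)) \<theta>" using assms(3) by auto
  then show "ppty q = arg_ty \<theta>" by (simp only: q_def split_pat_def ppty_with_pat map_map)
  show "plen q = Suc (length \<theta>)" unfolding plen_def l using assms(1) by simp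
  have p: "concat (map2 pvals (map ?h zs) (map g zs)) = map g zs" if "z \<notin> set zs" for zs
    using that by (induction zs) auto
  have "pvals q (vtuple (map g \<theta>)) = concat (map2 pvals (map ?h \<theta>) (map g \<theta>))"
    using assms(1) unfolding q_def split_pat_def by (intro pvals_with_pat) auto
  also have "\<dots> = map g xs @ vfst (g z) # vsnd (g z) # map g ys"
    using assms(1,2) p[of xs] p[of ys] by simp
  finally show "pvals q (vtuple (map g \<theta>)) = map g xs @ vfst (g z) # vsnd (g z) # map g ys" .
qed

subsection \<open>The linear functions in the translation\<close>

text \<open>Representation of linear functions, kept apart from \<open>rep\<close> because
  \<open>h\<close> acts on a tangent environment rather than on a tuple: composing tangent maps then
  becomes extending an environment by \<open>case_nat\<close>.\<close>

definition frep :: "'f signature \<Rightarrow> lvar list \<Rightarrow> lty \<Rightarrow> 'f tm \<Rightarrow> ((nat \<Rightarrow> val) \<Rightarrow> val) \<Rightarrow> bool" where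
  "frep S \<theta> \<sigma> F h \<longleftrightarrow> (\<forall>N \<mu>. rep S (arg_ty \<theta>) N (vtuple (map (\<lambda>v. \<mu> (fst v)) \<theta>)) \<longrightarrow>
    rep S (tyT \<sigma>) (App F N) (h \<mu>))"

lemma frep_expand: "frep S \<theta> \<sigma> F' h \<Longrightarrow> wreds S F F' \<Longrightarrow> frep S \<theta> \<sigma> F h"
  unfolding frep_def by (meson rep_expand rtranclp.rtrancl_refl wreds_App)

lemma frep_upat:
  assumes "\<And>\<mu> u. \<forall>y\<in>set \<theta>. rep S (tyT (snd y)) (u (upos \<theta> y)) (\<mu> (fst y)) \<Longrightarrow>
    rep S (tyT \<sigma>) (subst (bind (width \<theta>) u s) M) (h \<mu>)"
  shows "frep S \<theta> \<sigma> (subst s (Lam (upat \<theta>) M)) h"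
  unfolding frep_def
proof (intro allI impI)
  fix N \<mu> assume N: "rep S (arg_ty \<theta>) N (vtuple (map (\<lambda>v. \<mu> (fst v)) \<theta>))"
  let ?w = "vtuple (map (\<lambda>v. \<mu> (fst v)) \<theta>)"
  show "rep S (tyT \<sigma>) (App (subst s (Lam (upat \<theta>) M)) N) (h \<mu>)"
  proof (rule rep_App_Lam[of S _ _ ?w])
    fix u assume u: "\<forall>i<plen (upat \<theta>). rep S (leaves (upat \<theta>) ! i) (u i) (pvals (upat \<theta>) ?w ! i)"
    have "rep S (tyT (snd y)) (u (upos \<theta> y)) (\<mu> (fst y))" if "y \<in> set \<theta>" for y
    proof -
      have "\<theta> \<noteq> []" using that by auto
      then show ?thesis
        using u[rule_format, of "upos \<theta> y"] upos_nth[OF that]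
        by (simp add: width_eq leaves_upat pvals_upat)
    qed
    then show "rep S (tyT \<sigma>) (subst (bind (plen (upat \<theta>)) u s) M) (h \<mu>)"
      using assms by simp
  qed (use N in auto)
qed

text \<open>This and the next three definitions are the functions built by the compound cases of
  \<open>delta\<close>, with the indices of the function variables they call as parameters.
  Unzipping moves these functions to other scopes and changes nothing but those indices.\<close>

definition let_fun :: "lvar list \<Rightarrow> lvar list \<Rightarrow> lvar list \<Rightarrow> nat \<Rightarrow> nat \<Rightarrow> 'f tm" where
  "let_fun \<theta> \<theta>1 \<theta>2 a b = Lam (upat \<theta>) (App (Var (width \<theta> + a))
    (with_tm (App (Var (width \<theta> + b)) (with_tm (map (uvar \<theta>) \<theta>1)) # map (uvar \<theta>) \<theta>2)))"

definition unit_fun :: "lvar list \<Rightarrow> lvar list \<Rightarrow> nat \<Rightarrow> 'f tm" where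
  "unit_fun \<theta> \<theta>' a = Lam (upat \<theta>) (App (Var (width \<theta> + a)) (with_tm (map (uvar \<theta>) \<theta>')))"

definition split_fun :: "lvar list \<Rightarrow> lvar \<Rightarrow> lty \<Rightarrow> lty \<Rightarrow> nat \<Rightarrow> 'f tm" where
  "split_fun \<theta> z \<tau>1 \<tau>2 a = Lam (split_pat \<theta> z \<tau>1 \<tau>2) (App (Var (plen (split_pat \<theta> z \<tau>1 \<tau>2) + a))
    (with_tm (Var (upos \<theta> z) # Var (upos \<theta> z + 1) # map (\<lambda>v. Var (split_pos \<theta> z v)) (removeAll z \<theta>))))"

definition drop_fun :: "lvar list \<Rightarrow> lty \<Rightarrow> nat \<Rightarrow> 'f tm" where
  "drop_fun \<theta> \<sigma> a = Lam (PVar (arg_ty \<theta>)) (LetIn (PVar (tyT \<sigma>)) (App (Var (Suc a)) (Var 0)) Top)"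

lemma subst_with_tm [simp]: "subst s (with_tm Ms) = with_tm (map (subst s) Ms)"
  by (induction Ms rule: induct_list012) auto

lemma ren_with_tm [simp]: "ren f (with_tm Ms) = with_tm (map (ren f) Ms)"
  by (induction Ms rule: induct_list012) auto

lemma subst_nest_Tens [simp]: "subst s (nest Tens Unit Ms) = nest Tens Unit (map (subst s) Ms)"
  by (induction Ms rule: induct_list012) auto

lemma bind_less: "i < k \<Longrightarrow> bind k u s i = u i" and bind_add: "bind k u s (k + i) = s i"
  by (auto simp: bind_def)

text \<open>Composition of tangent maps: the tuple handed to \<open>s a\<close> represents the
  environment extended by the result of \<open>s b\<close>, because the new tangent variable has
  index 0 and the others are shifted by one.\<close>

lemma frep_let_fun:
  assumes "set \<theta>1 \<subseteq> set \<theta>" "set \<theta>2 \<subseteq> set \<theta>"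
    and 1: "frep S \<theta>1 \<sigma>1 (s b) h1" and 2: "frep S ((0, \<sigma>1) # map (up 1) \<theta>2) \<sigma> (s a) h2"
  shows "frep S \<theta> \<sigma> (subst s (let_fun \<theta> \<theta>1 \<theta>2 a b)) (\<lambda>\<mu>. h2 (case_nat (h1 \<mu>) \<mu>))"
  unfolding let_fun_def
proof (rule frep_upat)
  fix \<mu> u assume u: "\<forall>y\<in>set \<theta>. rep S (tyT (snd y)) (u (upos \<theta> y)) (\<mu> (fst y))"
  let ?w = "width \<theta>"
  let ?s = "bind ?w u s"
  have var: "?s (upos \<theta> y) = u (upos \<theta> y)" if "y \<in> set \<theta>" for y
    using upos_width[OF that] by (rule bind_less)
  have "rep S (arg_ty \<theta>1) (with_tm (map (\<lambda>y. ?s (upos \<theta> y)) \<theta>1)) (vtuple (map (\<lambda>v. \<mu> (fst v)) \<theta>1))"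
    using u assms(1) by (intro rep_tuple_map) (auto simp: var subset_eq)
  then have f: "rep S (tyT \<sigma>1) (App (s b) (with_tm (map (\<lambda>y. ?s (upos \<theta> y)) \<theta>1))) (h1 \<mu>)"
    using 1 by (auto simp: frep_def)
  have "rep S (arg_ty \<theta>2) (with_tm (map (\<lambda>y. ?s (upos \<theta> y)) \<theta>2)) (vtuple (map (\<lambda>v. \<mu> (fst v)) \<theta>2))"
    using u assms(2) by (intro rep_tuple_map) (auto simp: var subset_eq)
  from rep_tuple_Cons[OF f this]
  have "rep S (arg_ty ((0, \<sigma>1) # map (up 1) \<theta>2))
      (with_tm (App (s b) (with_tm (map (\<lambda>y. ?s (upos \<theta> y)) \<theta>1)) # map (\<lambda>y. ?s (upos \<theta> y)) \<theta>2))
      (vtuple (map (\<lambda>v. case_nat (h1 \<mu>) \<mu> (fst v)) ((0, \<sigma>1) # map (up 1) \<theta>2)))"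
    by (simp add: up_def comp_def)
  then show "rep S (tyT \<sigma>) (subst ?s (App (Var (?w + a)) (with_tm (App (Var (?w + b))
      (with_tm (map (uvar \<theta>) \<theta>1)) # map (uvar \<theta>) \<theta>2)))) (h2 (case_nat (h1 \<mu>) \<mu>))"
    using 2 by (simp add: frep_def bind_add comp_def)
qed

lemma frep_unit_fun:
  assumes "set \<theta>' \<subseteq> set \<theta>" and "frep S \<theta>' \<sigma> (s a) h"
  shows "frep S \<theta> \<sigma> (subst s (unit_fun \<theta> \<theta>' a)) h"
  unfolding unit_fun_def
proof (rule frep_upat)
  fix \<mu> u assume u: "\<forall>y\<in>set \<theta>. rep S (tyT (snd y)) (u (upos \<theta> y)) (\<mu> (fst y))"
  let ?w = "width \<theta>"
  let ?s = "bind ?w u s"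
  have var: "?s (upos \<theta> y) = u (upos \<theta> y)" if "y \<in> set \<theta>" for y
    using upos_width[OF that] by (rule bind_less)
  have "rep S (arg_ty \<theta>') (with_tm (map (\<lambda>y. ?s (upos \<theta> y)) \<theta>')) (vtuple (map (\<lambda>v. \<mu> (fst v)) \<theta>'))"
    using u assms(1) by (intro rep_tuple_map) (auto simp: var subset_eq)
  then show "rep S (tyT \<sigma>) (subst ?s (App (Var (?w + a)) (with_tm (map (uvar \<theta>) \<theta>')))) (h \<mu>)"
    using assms(2) by (simp add: frep_def bind_add comp_def)
qed

lemma frep_split_fun:
  assumes "distinct \<theta>" "z \<in> set \<theta>" "snd z = LTens \<tau>1 \<tau>2"
    and f: "frep S ((0, \<tau>1) # (1, \<tau>2) # map (up 2) (removeAll z \<theta>)) \<sigma> (s a) h"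
  shows "frep S \<theta> \<sigma> (subst s (split_fun \<theta> z \<tau>1 \<tau>2 a))
    (\<lambda>\<mu>. h (case_nat (vfst (\<mu> (fst z))) (case_nat (vsnd (\<mu> (fst z))) \<mu>)))"
  unfolding frep_def
proof (intro allI impI)
  fix N \<mu> assume N: "rep S (arg_ty \<theta>) N (vtuple (map (\<lambda>v. \<mu> (fst v)) \<theta>))"
  obtain xs ys where xs: "\<theta> = xs @ z # ys" using split_list[OF assms(2)] by auto
  let ?q = "split_pat \<theta> z \<tau>1 \<tau>2" and ?g = "\<lambda>v. \<mu> (fst v)" and ?k = "upos \<theta> z"
  note q = split_pat[OF xs assms(1,3)]
  show "rep S (tyT \<sigma>) (App (subst s (split_fun \<theta> z \<tau>1 \<tau>2 a)) N)
      (h (case_nat (vfst (\<mu> (fst z))) (case_nat (vsnd (\<mu> (fst z))) \<mu>)))"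
    unfolding split_fun_def
  proof (rule rep_App_Lam[of S _ _ "vtuple (map ?g \<theta>)"])
    fix u assume u: "\<forall>i<plen ?q. rep S (leaves ?q ! i) (u i) (pvals ?q (vtuple (map ?g \<theta>)) ! i)"
    let ?s = "bind (plen ?q) u s"
    note nth = split_nth[OF xs assms(1)]
    have k: "rep S (tyT \<tau>1) (u ?k) (vfst (?g z))" "rep S (tyT \<tau>2) (u (?k + 1)) (vsnd (?g z))"
      using u[rule_format, of ?k] u[rule_format, of "?k + 1"] nth(4)
      by (simp_all add: q nth[simplified])
    have r: "rep S (tyT (snd v)) (?s (split_pos \<theta> z v)) (?g v)" if "v \<in> set (removeAll z \<theta>)" for v
      using u[rule_format, of "split_pos \<theta> z v"] nth(5)[of v] that
        nth(3)[of v "\<lambda>v. tyT (snd v)" "tyT \<tau>1" "tyT \<tau>2"] nth(3)[of v ?g "vfst (?g z)" "vsnd (?g z)"]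
      by (simp add: q bind_less)
    have "rep S (arg_ty (removeAll z \<theta>)) (with_tm (map (\<lambda>v. ?s (split_pos \<theta> z v)) (removeAll z \<theta>)))
        (vtuple (map ?g (removeAll z \<theta>)))"
      using r by (intro rep_tuple_map) auto
    from rep_tuple_Cons[OF k(1) rep_tuple_Cons[OF k(2) this]]
    have "rep S (arg_ty ((0, \<tau>1) # (1, \<tau>2) # map (up 2) (removeAll z \<theta>)))
        (with_tm (u ?k # u (?k + 1) # map (\<lambda>v. ?s (split_pos \<theta> z v)) (removeAll z \<theta>)))
        (vtuple (map (\<lambda>v. case_nat (vfst (?g z)) (case_nat (vsnd (?g z)) \<mu>) (fst v))
          ((0, \<tau>1) # (1, \<tau>2) # map (up 2) (removeAll z \<theta>))))"
      by (simp add: up_def comp_def numeral_2_eq_2)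
    then have "rep S (tyT \<sigma>) (App (s a)
        (with_tm (u ?k # u (?k + 1) # map (\<lambda>v. ?s (split_pos \<theta> z v)) (removeAll z \<theta>))))
        (h (case_nat (vfst (?g z)) (case_nat (vsnd (?g z)) \<mu>)))"
      using f by (simp add: frep_def)
    then show "rep S (tyT \<sigma>) (subst ?s (App (Var (plen ?q + a)) (with_tm (Var ?k # Var (?k + 1) #
        map (\<lambda>v. Var (split_pos \<theta> z v)) (removeAll z \<theta>)))))
        (h (case_nat (vfst (?g z)) (case_nat (vsnd (?g z)) \<mu>)))"
      using nth(4) q(4) by (simp add: bind_def comp_def)
  qed (use N q in auto)
qed

text \<open>\<open>tyT LOne\<close> is \<open>TopT\<close>, where every term represents every
  value.\<close>

lemma frep_LOne: "frep S \<theta> LOne F h"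
  by (simp add: frep_def)

subsection \<open>Correctness of the translation\<close>

definition renv :: "'f signature \<Rightarrow> lctx \<Rightarrow> (nat \<Rightarrow> 'f tm) \<Rightarrow> (nat \<Rightarrow> val) \<Rightarrow> bool" where
  "renv S G s \<rho> \<longleftrightarrow> (\<forall>x \<tau>. G x = Some \<tau> \<longrightarrow> rep S (tyP \<tau>) (s x) (\<rho> x))"

lemma renv_push: "renv S G s \<rho> \<Longrightarrow> rep S (tyP \<tau>) M v \<Longrightarrow> renv S (push \<tau> G) (case_nat M s) (case_nat v \<rho>)"
  by (auto simp: renv_def push_def split: nat.splits)

text \<open>The expressions translated to a plain pair, which unzipping in lambda-LL returns
  unchanged.\<close>

fun is_leaf :: "'f exp \<Rightarrow> bool" where
  "is_leaf (ELet e1 e2) = False"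
| "is_leaf (ELetUnitP z e) = False"
| "is_leaf (ELetUnitT z e) = False"
| "is_leaf (ELetTensT z \<tau>1 \<tau>2 e) = False"
| "is_leaf (EDrop e) = False"
| "is_leaf e = True"

text \<open>The first component is some \<open>P\<close> rather than an exponential because a
  function symbol still has to be applied.\<close>

lemma delta_leaf_rep:
  assumes "is_leaf e" "wt S e G" "set \<theta> = FVt e" "renv S G s \<rho>"
  shows "\<exists>P F. delta e \<theta> = Tens P (sect F) \<and> rep S (OfCourse (tyP (fst (ety e)))) (subst s P) (evP S e \<rho>) \<and>
    frep S \<theta> (snd (ety e)) (subst s F) (evT S e \<rho>)"
proof -
  have var: "bind (width \<theta>) u s (upos \<theta> y) = u (upos \<theta> y)" if "y \<in> FVt e" for u y
    using upos_width[of y \<theta>] that assms(3) by (auto intro: bind_less)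
  \<comment> \<open>An expression without tangent variables is translated with a single binder of
    type \<open>TopT\<close>, which is the tuple pattern of the empty enumeration.\<close>
  have nil: "FVt e = {} \<Longrightarrow> PVar TopT = upat \<theta>" using assms(3) by simp
  show ?thesis
  proof (cases e)
    case (EPair x y)
    have "frep S \<theta> (snd y) (subst s (Lam (upat \<theta>) (uvar \<theta> y))) (\<lambda>\<mu>. \<mu> (fst y))"
      by (rule frep_upat) (use assms EPair var in auto)
    then show ?thesis using EPair assms by (auto simp: renv_def)
  next
    case (ETensT x y)
    have "frep S \<theta> (LTens (snd x) (snd y)) (subst s (Lam (upat \<theta>) (With (uvar \<theta> x) (uvar \<theta> y))))
      (\<lambda>\<mu>. VP (\<mu> (fst x)) (\<mu> (fst y)))"
      by (rule frep_upat) (use assms ETensT var in auto)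
    then show ?thesis using ETensT by auto
  next
    case (EZero \<tau>)
    have "frep S \<theta> \<tau> (subst s (Lam (upat \<theta>) (zero_tm (tyT \<tau>)))) (\<lambda>\<mu>. vzero \<tau>)"
      by (rule frep_upat) (simp add: rep_zero)
    then show ?thesis using EZero nil by auto
  next
    case (EAdd x y)
    have "frep S \<theta> (snd x) (subst s (Lam (upat \<theta>) (App (plus_tm (tyT (snd x))) (With (uvar \<theta> x) (uvar \<theta> y)))))
      (\<lambda>\<mu>. vadd (snd x) (\<mu> (fst x)) (\<mu> (fst y)))"
    proof (rule frep_upat)
      fix \<mu> u assume u: "\<forall>y\<in>set \<theta>. rep S (tyT (snd y)) (u (upos \<theta> y)) (\<mu> (fst y))"
      have "rep S (WithT (tyT (snd x)) (tyT (snd x))) (With (u (upos \<theta> x)) (u (upos \<theta> y))) (VP (\<mu> (fst x)) (\<mu> (fst y)))"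
        using u assms EAdd by auto
      from rep_plus[OF this] show "rep S (tyT (snd x)) (subst (bind (width \<theta>) u s)
        (App (plus_tm (tyT (snd x))) (With (uvar \<theta> x) (uvar \<theta> y)))) (vadd (snd x) (\<mu> (fst x)) (\<mu> (fst y)))"
        using var EAdd by simp
    qed
    then show ?thesis using EAdd by auto
  next
    case (EMul x y)
    have "frep S \<theta> (snd y) (subst s (Lam (upat \<theta>) (App (times_tm (tyT (snd y)) (x + width \<theta>)) (uvar \<theta> y))))
      (\<lambda>\<mu>. vmul (snd y) (\<rho> x) (\<mu> (fst y)))"
    proof (rule frep_upat)
      fix \<mu> u assume u: "\<forall>y\<in>set \<theta>. rep S (tyT (snd y)) (u (upos \<theta> y)) (\<mu> (fst y))"
      have "rep S RealT (bind (width \<theta>) u s (x + width \<theta>)) (\<rho> x)"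
        using assms(2,4) EMul by (fastforce simp: renv_def bind_def)
      moreover have "rep S (tyT (snd y)) (u (upos \<theta> y)) (\<mu> (fst y))" using u assms EMul by auto
      ultimately show "rep S (tyT (snd y)) (subst (bind (width \<theta>) u s)
        (App (times_tm (tyT (snd y)) (x + width \<theta>)) (uvar \<theta> y))) (vmul (snd y) (\<rho> x) (\<mu> (fst y)))"
        using rep_times[of S "bind (width \<theta>) u s"] var EMul by simp
    qed
    then show ?thesis using EMul by auto
  next
    case (EFun f xs)
    have "\<forall>x\<in>set xs. rep S RealT (s x) (\<rho> x)" using assms(2,4) EFun by (fastforce simp: renv_def)
    then have "rep S (OfCourse RealT) (App (Fun f) (nest Tens Unit (map (\<lambda>x. Bang (s x)) xs)))
      (VR (interp S f (map (\<lambda>x. unR (\<rho> x)) xs)))"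
      using assms(2) EFun by (intro rep_Fun) auto
    then show ?thesis using EFun by (simp add: comp_def frep_LOne)
  next
    case (EDup y)
    have "frep S \<theta> (LTens (snd y) (snd y)) (subst s (Lam (upat \<theta>) (With (uvar \<theta> y) (uvar \<theta> y))))
      (\<lambda>\<mu>. VP (\<mu> (fst y)) (\<mu> (fst y)))"
      by (rule frep_upat) (use assms EDup var in auto)
    then show ?thesis using EDup by auto
  next
    case (EConst r)
    then show ?thesis by (auto simp: frep_LOne intro!: exI[of _ "Const r"])
  qed (use assms(1) in \<open>auto simp: frep_LOne\<close>)
qed

lemma delta_leaf_wreds:
  assumes "is_leaf e" "wt S e G" "renv S G s \<rho>" "set \<theta> = FVt e"
  shows "\<exists>V F. wreds S (subst s (delta e \<theta>)) (Tens (Bang V) (sect F)) \<and>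
      rep S (tyP (fst (ety e))) V (evP S e \<rho>) \<and> frep S \<theta> (snd (ety e)) F (evT S e \<rho>)"
proof -
  obtain P F V where *: "delta e \<theta> = Tens P (sect F)" "wreds S (subst s P) (Bang V)"
    "rep S (tyP (fst (ety e))) V (evP S e \<rho>)" "frep S \<theta> (snd (ety e)) (subst s F) (evT S e \<rho>)"
    using delta_leaf_rep[OF assms(1,2,4,3)] by auto
  have "wreds S (subst s (delta e \<theta>)) (Tens (Bang V) (sect (subst s F)))"
    using *(1,2) by (simp add: wreds_Tens)
  with *(3,4) show ?thesis by blast
qed

lemma bind_case_nat: "bind (Suc 0) u s = case_nat (u 0) s" "bind 2 u s = case_nat (u 0) (case_nat (u 1) s)"
  by (auto simp: bind_def fun_eq_iff numeral_2_eq_2 less_Suc_eq split: nat.split)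

lemma wreds_let_xf:
  assumes "wreds S (subst s N) (Tens (Bang V) (sect F))"
  shows "wreds S (subst s (LetIn (xf_pat \<theta> r) N M)) (subst (case_nat V (case_nat F s)) M)"
  using wreds_beta[of S "subst s N" "\<lambda>i. if i = 0 then V else F" "xf_pat \<theta> r" s M] assms
  by (simp add: xf_pat_def bind_case_nat flip: numeral_2_eq_2)

lemma wreds_let_sect:
  "wreds S (subst s (LetIn (sect_pat (PVar B)) (sect F) M)) (subst (case_nat (subst s F) s) M)"
  using wreds_beta[of S "subst s (sect F)" "\<lambda>i. subst s F" "sect_pat (PVar B)" s M]
  by (simp add: bind_case_nat)

lemma wreds_let_unit: "wreds S (subst s N) Unit \<Longrightarrow> wreds S (subst s (LetIn PUnit N M)) (subst s M)"
  using wreds_beta[of S "subst s N" s PUnit s M] by (simp add: bind_def)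

text \<open>The relaxed typing guarantees that the tangent bound by the let does occur in
  \<open>e2\<close>, and with the tangent type of \<open>e1\<close>, so prefixing it to the
  enumeration is exact.\<close>

lemma filter_FVt_ELet:
  assumes "set \<theta> = FVt (ELet e1 e2)" "distinct \<theta>" "wt S (ELet e1 e2) G"
  defines "\<theta>1 \<equiv> filter (\<lambda>v. v \<in> FVt e1) \<theta>" and "\<theta>2 \<equiv> filter (\<lambda>v. up 1 v \<in> FVt e2) \<theta>"
  defines "\<theta>2' \<equiv> (0, snd (ety e1)) # map (up 1) \<theta>2"
  shows "set \<theta>1 = FVt e1" "distinct \<theta>1" "set \<theta>2' = FVt e2" "distinct \<theta>2'"
proof -
  have mem: "v \<in> FVt e2 \<longleftrightarrow> v = (0, snd (ety e1)) \<or> (\<exists>w. v = up 1 w \<and> up 1 w \<in> FVt e2)" for v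
  proof (cases "fst v = 0")
    case True
    then have "v \<in> FVt e2 \<longleftrightarrow> v \<in> {v \<in> FVt e2. fst v = 0}" by simp
    also have "\<dots> \<longleftrightarrow> v = (0, snd (ety e1))" using assms(3) by simp
    finally show ?thesis using True by (auto simp: up_def)
  next
    case False
    then have "v = up 1 (fst v - 1, snd v)" by (simp add: up_def)
    then show ?thesis using False by (metis fst_conv)
  qed
  show "set \<theta>2' = FVt e2"
  proof (rule set_eqI)
    fix v
    have "v \<in> set \<theta>2' \<longleftrightarrow> v = (0, snd (ety e1)) \<or> (\<exists>w. v = up 1 w \<and> up 1 w \<in> FVt e2)"
      using assms(1) by (auto simp: \<theta>2'_def \<theta>2_def)
    then show "v \<in> set \<theta>2' \<longleftrightarrow> v \<in> FVt e2" unfolding mem[of v] .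
  qed
  show "set \<theta>1 = FVt e1" "distinct \<theta>1" using assms(1,2) by (auto simp: \<theta>1_def)
  have "inj (up 1)" by (rule injI) (auto simp: up_def prod_eq_iff)
  then show "distinct \<theta>2'"
    using assms(2) by (auto simp: \<theta>2'_def \<theta>2_def distinct_map up_def intro: inj_on_subset)
qed

lemma removeAll_FVt_ELetTensT:
  assumes "set \<theta> = FVt (ELetTensT z \<tau>1 \<tau>2 e)" "distinct \<theta>" "wt S (ELetTensT z \<tau>1 \<tau>2 e) G"
  defines "\<theta>' \<equiv> (0, \<tau>1) # (1, \<tau>2) # map (up 2) (removeAll (z, LTens \<tau>1 \<tau>2) \<theta>)"
  shows "set \<theta>' = FVt e" "distinct \<theta>'"
proof -
  have mem: "v \<in> FVt e \<longleftrightarrow> v = (0, \<tau>1) \<or> v = (1, \<tau>2) \<or> (\<exists>w. v = up 2 w \<and> up 2 w \<in> FVt e)" for v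
  proof (cases "fst v < 2")
    case True
    then have "v \<in> FVt e \<longleftrightarrow> v \<in> {v \<in> FVt e. fst v < 2}" by simp
    also have "\<dots> \<longleftrightarrow> v = (0, \<tau>1) \<or> v = (1, \<tau>2)" using assms(3) by simp
    finally show ?thesis using True by (auto simp: up_def)
  next
    case False
    then have "v = up 2 (fst v - 2, snd v)" by (simp add: up_def prod_eq_iff)
    moreover have "v \<noteq> (0, \<tau>1)" "v \<noteq> (1, \<tau>2)" using False by auto
    ultimately show ?thesis by metis
  qed
  have z: "up 2 (z, LTens \<tau>1 \<tau>2) \<notin> FVt e" using assms(3) by simp
  show "set \<theta>' = FVt e"
  proof (rule set_eqI)
    fix v
    have "v \<in> set \<theta>' \<longleftrightarrow> v = (0, \<tau>1) \<or> v = (1, \<tau>2) \<or> (\<exists>w. v = up 2 w \<and> up 2 w \<in> FVt e)"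
      using assms(1) z by (auto simp: \<theta>'_def)
    then show "v \<in> set \<theta>' \<longleftrightarrow> v \<in> FVt e" unfolding mem[of v] .
  qed
  have "inj (up 2)" by (rule injI) (auto simp: up_def prod_eq_iff)
  then show "distinct \<theta>'"
    using assms(2) by (auto simp: \<theta>'_def distinct_map distinct_removeAll up_def intro: inj_on_subset)
qed

text \<open>The function variable has index 1 right inside its pattern, and index 3 once the second
  pattern of a let has bound two more variables.\<close>

lemma delta_let_fun:
  "delta (ELet e1 e2) \<theta> = (let \<theta>1 = filter (\<lambda>v. v \<in> FVt e1) \<theta>;
        \<theta>2 = filter (\<lambda>v. up 1 v \<in> FVt e2) \<theta>; \<theta>2' = (0, snd (ety e1)) # map (up 1) \<theta>2
    in LetIn (xf_pat \<theta>1 (ety e1)) (delta e1 \<theta>1)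
        (LetIn (xf_pat \<theta>2' (ety e2)) (ren (liftn 1 Suc) (delta e2 \<theta>2'))
          (Tens (Bang (Var 0)) (sect (let_fun \<theta> \<theta>1 \<theta>2 1 3)))))"
  "delta (ELetUnitT z e) \<theta> = (let \<theta>' = removeAll (z, LOne) \<theta>
    in LetIn (xf_pat \<theta>' (ety e)) (delta e \<theta>') (Tens (Bang (Var 0)) (sect (unit_fun \<theta> \<theta>' 1))))"
  "delta (ELetTensT z \<tau>1 \<tau>2 e) \<theta> = (let zv = (z, LTens \<tau>1 \<tau>2);
        \<theta>' = (0, \<tau>1) # (1, \<tau>2) # map (up 2) (removeAll zv \<theta>)
    in LetIn (xf_pat \<theta>' (ety e)) (delta e \<theta>') (Tens (Bang (Var 0)) (sect (split_fun \<theta> zv \<tau>1 \<tau>2 1))))"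
  "delta (EDrop e) \<theta> = LetIn (xf_pat \<theta> (ety e)) (delta e \<theta>)
    (Tens (Bang Unit) (sect (drop_fun \<theta> (snd (ety e)) 1)))"
  by (simp_all add: Let_def let_fun_def unit_fun_def split_fun_def drop_fun_def split_pat_def split_pos_def
      if_distrib[of Var] numeral_2_eq_2)

text \<open>Weak evaluation contracts the lets and stops at the pair, whose second component is a
  closure over the functions evaluated before; its correctness is that of the named functions such
  as \<open>let_fun\<close>.\<close>

theorem delta_rep:
  "wt S e G \<Longrightarrow> renv S G s \<rho> \<Longrightarrow> set \<theta> = FVt e \<Longrightarrow> distinct \<theta> \<Longrightarrow>
    \<exists>V F. wreds S (subst s (delta e \<theta>)) (Tens (Bang V) (sect F)) \<and>
      rep S (tyP (fst (ety e))) V (evP S e \<rho>) \<and> frep S \<theta> (snd (ety e)) F (evT S e \<rho>)"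
proof (induction e arbitrary: G s \<rho> \<theta>)
  case (ELet e1 e2)
  define \<theta>1 where "\<theta>1 = filter (\<lambda>v. v \<in> FVt e1) \<theta>"
  define \<theta>2 where "\<theta>2 = filter (\<lambda>v. up 1 v \<in> FVt e2) \<theta>"
  define \<theta>2' where "\<theta>2' = (0, snd (ety e1)) # map (up 1) \<theta>2"
  note \<theta> = filter_FVt_ELet[OF ELet.prems(3,4,1), folded \<theta>1_def \<theta>2_def, folded \<theta>2'_def]
  obtain V1 F1 where 1: "wreds S (subst s (delta e1 \<theta>1)) (Tens (Bang V1) (sect F1))"
    "rep S (tyP (fst (ety e1))) V1 (evP S e1 \<rho>)" "frep S \<theta>1 (snd (ety e1)) F1 (evT S e1 \<rho>)"
    using ELet.IH(1)[of G s \<rho> \<theta>1] ELet.prems \<theta> by auto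
  let ?s1 = "case_nat V1 (case_nat F1 s)"
  \<comment> \<open>\<open>liftn 1 Suc\<close> jumps over the function variable of the first
    pattern, which \<open>e2\<close> does not know.\<close>
  have s1: "?s1 \<circ> liftn 1 Suc = case_nat V1 s"
    by (auto simp: liftn_def fun_eq_iff split: nat.split)
  obtain V2 F2 where 2: "wreds S (subst ?s1 (ren (liftn 1 Suc) (delta e2 \<theta>2'))) (Tens (Bang V2) (sect F2))"
    "rep S (tyP (fst (ety e2))) V2 (evP S (ELet e1 e2) \<rho>)"
    "frep S \<theta>2' (snd (ety e2)) F2 (evT S e2 (case_nat (evP S e1 \<rho>) \<rho>))"
    using ELet.IH(2)[OF _ renv_push[OF ELet.prems(2) 1(2)], of \<theta>2'] ELet.prems(1) \<theta>
    by (auto simp: subst_ren s1[simplified])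
  let ?s2 = "case_nat V2 (case_nat F2 ?s1)"
  have "frep S \<theta> (snd (ety e2)) (subst ?s2 (let_fun \<theta> \<theta>1 \<theta>2 1 3))
     (\<lambda>\<mu>. evT S e2 (case_nat (evP S e1 \<rho>) \<rho>) (case_nat (evT S e1 \<rho> \<mu>) \<mu>))"
    using 1(3) 2(3) by (intro frep_let_fun) (auto simp: \<theta>1_def \<theta>2_def \<theta>2'_def numeral_3_eq_3)
  moreover have "delta (ELet e1 e2) \<theta> = LetIn (xf_pat \<theta>1 (ety e1)) (delta e1 \<theta>1)
      (LetIn (xf_pat \<theta>2' (ety e2)) (ren (liftn 1 Suc) (delta e2 \<theta>2'))
        (Tens (Bang (Var 0)) (sect (let_fun \<theta> \<theta>1 \<theta>2 1 3))))"
    by (simp only: delta_let_fun(1) Let_def \<theta>1_def \<theta>2_def \<theta>2'_def)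
  then have "wreds S (subst s (delta (ELet e1 e2) \<theta>)) (Tens (Bang V2) (sect (subst ?s2 (let_fun \<theta> \<theta>1 \<theta>2 1 3))))"
    using rtranclp_trans[OF wreds_let_xf[OF 1(1), of \<theta>1 "ety e1"]
        wreds_let_xf[OF 2(1), of \<theta>2' "ety e2" "Tens (Bang (Var 0)) (sect (let_fun \<theta> \<theta>1 \<theta>2 1 3))"]]
    by simp
  ultimately show ?case using 2(2) by (auto simp del: delta.simps)
next
  case (ELetUnitP z e)
  obtain V F where 1: "wreds S (subst s (delta e \<theta>)) (Tens (Bang V) (sect F))"
    "rep S (tyP (fst (ety e))) V (evP S e \<rho>)" "frep S \<theta> (snd (ety e)) F (evT S e \<rho>)"
    using ELetUnitP.IH[of G s \<rho> \<theta>] ELetUnitP.prems by auto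
  have "wreds S (subst s (Var z)) Unit" using ELetUnitP.prems(1,2) by (fastforce simp: renv_def)
  from rtranclp_trans[OF wreds_let_unit[OF this] 1(1)]
  have "wreds S (subst s (delta (ELetUnitP z e) \<theta>)) (Tens (Bang V) (sect F))" by simp
  then show ?case using 1 by auto
next
  case (ELetUnitT z e)
  let ?\<theta>' = "removeAll (z, LOne) \<theta>"
  have \<theta>': "set ?\<theta>' = FVt e" "distinct ?\<theta>'"
    using ELetUnitT.prems by (auto simp: distinct_removeAll)
  obtain V F where 1: "wreds S (subst s (delta e ?\<theta>')) (Tens (Bang V) (sect F))"
    "rep S (tyP (fst (ety e))) V (evP S e \<rho>)" "frep S ?\<theta>' (snd (ety e)) F (evT S e \<rho>)"
    using ELetUnitT.IH[of G s \<rho> ?\<theta>'] ELetUnitT.prems \<theta>' by auto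
  let ?s = "case_nat V (case_nat F s)"
  have "frep S \<theta> (snd (ety e)) (subst ?s (unit_fun \<theta> ?\<theta>' 1)) (evT S e \<rho>)"
    using 1(3) by (intro frep_unit_fun) auto
  moreover have "wreds S (subst s (delta (ELetUnitT z e) \<theta>)) (Tens (Bang V) (sect (subst ?s (unit_fun \<theta> ?\<theta>' 1))))"
    using wreds_let_xf[OF 1(1), of ?\<theta>' "ety e" "Tens (Bang (Var 0)) (sect (unit_fun \<theta> ?\<theta>' 1))"]
    by (simp add: delta_let_fun(2) Let_def del: delta.simps)
  ultimately show ?case using 1(2) by (auto simp del: delta.simps)
next
  case (ELetTensT z \<tau>1 \<tau>2 e)
  let ?z = "(z, LTens \<tau>1 \<tau>2)"
  let ?\<theta>' = "(0, \<tau>1) # (1, \<tau>2) # map (up 2) (removeAll ?z \<theta>)"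
  note \<theta>' = removeAll_FVt_ELetTensT[OF ELetTensT.prems(3,4,1)]
  obtain V F where 1: "wreds S (subst s (delta e ?\<theta>')) (Tens (Bang V) (sect F))"
    "rep S (tyP (fst (ety e))) V (evP S e \<rho>)" "frep S ?\<theta>' (snd (ety e)) F (evT S e \<rho>)"
    using ELetTensT.IH[OF _ ELetTensT.prems(2) \<theta>'] ELetTensT.prems(1) by auto
  let ?s = "case_nat V (case_nat F s)"
  have "frep S \<theta> (snd (ety e)) (subst ?s (split_fun \<theta> ?z \<tau>1 \<tau>2 1)) (evT S (ELetTensT z \<tau>1 \<tau>2 e) \<rho>)"
    using 1(3) ELetTensT.prems(3,4) frep_split_fun[of \<theta> ?z \<tau>1 \<tau>2 S "snd (ety e)" ?s 1 "evT S e \<rho>"] by simp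
  moreover have "wreds S (subst s (delta (ELetTensT z \<tau>1 \<tau>2 e) \<theta>))
      (Tens (Bang V) (sect (subst ?s (split_fun \<theta> ?z \<tau>1 \<tau>2 1))))"
    using wreds_let_xf[OF 1(1), of ?\<theta>' "ety e" "Tens (Bang (Var 0)) (sect (split_fun \<theta> ?z \<tau>1 \<tau>2 1))"]
    by (simp add: delta_let_fun(3) Let_def del: delta.simps)
  ultimately show ?case using 1(2) by (auto simp del: delta.simps)
next
  case (EDrop e)
  obtain V F where 1: "wreds S (subst s (delta e \<theta>)) (Tens (Bang V) (sect F))"
    using EDrop.IH[of G s \<rho> \<theta>] EDrop.prems by auto
  let ?s = "case_nat V (case_nat F s)"
  have "wreds S (subst s (delta (EDrop e) \<theta>)) (Tens (Bang Unit) (sect (subst ?s (drop_fun \<theta> (snd (ety e)) 1))))"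
    using wreds_let_xf[OF 1, of \<theta> "ety e" "Tens (Bang Unit) (sect (drop_fun \<theta> (snd (ety e)) 1))"]
    by (simp add: delta_let_fun(4) del: delta.simps)
  then show ?case by (auto simp: frep_LOne simp del: delta.simps)
qed (rule delta_leaf_wreds, simp, assumption+)+

subsection \<open>Unzipping of translated expressions\<close>

lemma cren_cren: "cren f (cren g E) = cren (f \<circ> g) E"
  by (induction E arbitrary: f g) (auto simp: ren_ren liftn_comp)

lemma cren_append: "cren f (E1 @ E2) = cren f E1 @ cren (liftn (clen E1) f) E2"
  by (induction E1 arbitrary: f) (auto simp: clen_def liftn_liftn add.commute)

lemma clen_simps [simp]:
  "clen [] = 0" "clen (fr # E) = plen (fst fr) + clen E" "clen (E1 @ E2) = clen E1 + clen E2"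
  "clen (cren f E) = clen E"
proof -
  show "clen (cren f E) = clen E" by (induction E arbitrary: f) (auto simp: clen_def)
qed (auto simp: clen_def)

lemma plen_xf_pat [simp]: "plen (xf_pat \<theta> r) = 2"
  by (simp add: xf_pat_def)

text \<open>Computing the unzipping directly by recursion on the Linear A expression avoids the renamings
  in \<^const>\<open>unzb\<close> that are not injective.\<close>

primrec uz :: "'f exp \<Rightarrow> lvar list \<Rightarrow> 'f lctxt \<times> 'f tm \<times> 'f tm" where
  "uz (EPair x y) = (\<lambda>\<theta>. unzb (delta (EPair x y) \<theta>))"
| "uz (ELet e1 e2) = (\<lambda>\<theta>.
    let \<theta>1 = filter (\<lambda>v. v \<in> FVt e1) \<theta>;
        \<theta>2 = filter (\<lambda>v. up 1 v \<in> FVt e2) \<theta>;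
        \<theta>2' = (0, snd (ety e1)) # map (up 1) \<theta>2;
        (E1, P1, F1) = uz e1 \<theta>1; (E2, P2, F2) = uz e2 \<theta>2';
        g = liftn 1 (\<lambda>i. i + clen E1); g' = liftn (clen E2) g
    in (E1 @ [(PBang (tyP (fst (ety e1))), P1)] @ cren g E2 @ [(PBang (tyP (fst (ety e2))), ren g' P2)],
        Bang (Var 0),
        LetIn (sect_pat (PVar (Lolli (arg_ty \<theta>1) (tyT (snd (ety e1)))))) (sect (ren (\<lambda>i. i + clen E2 + 2) F1))
          (LetIn (sect_pat (PVar (Lolli (arg_ty \<theta>2') (tyT (snd (ety e2)))))) (sect (ren (\<lambda>i. g' i + 2) F2))
            (let_fun \<theta> \<theta>1 \<theta>2 0 1))))"
| "uz EUnitP = (\<lambda>\<theta>. unzb (delta EUnitP \<theta>))"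
| "uz EUnitT = (\<lambda>\<theta>. unzb (delta EUnitT \<theta>))"
| "uz (ELetUnitP z e) = (\<lambda>\<theta>. let (E, P, F) = uz e \<theta> in ((PUnit, Var z) # E, P, F))"
| "uz (ELetUnitT z e) = (\<lambda>\<theta>. let \<theta>' = removeAll (z, LOne) \<theta>; (E, P, F) = uz e \<theta>'
    in (E @ [(PBang (tyP (fst (ety e))), P)], Bang (Var 0),
        LetIn (sect_pat (PVar (Lolli (arg_ty \<theta>') (tyT (snd (ety e)))))) (sect (ren Suc F)) (unit_fun \<theta> \<theta>' 0)))"
| "uz (ETensT x y) = (\<lambda>\<theta>. unzb (delta (ETensT x y) \<theta>))"
| "uz (ELetTensT z \<tau>1 \<tau>2 e) = (\<lambda>\<theta>. let zv = (z, LTens \<tau>1 \<tau>2);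
        \<theta>' = (0, \<tau>1) # (1, \<tau>2) # map (up 2) (removeAll zv \<theta>); (E, P, F) = uz e \<theta>'
    in (E @ [(PBang (tyP (fst (ety e))), P)], Bang (Var 0),
        LetIn (sect_pat (PVar (Lolli (arg_ty \<theta>') (tyT (snd (ety e)))))) (sect (ren Suc F))
          (split_fun \<theta> zv \<tau>1 \<tau>2 0)))"
| "uz (EZero \<tau>) = (\<lambda>\<theta>. unzb (delta (EZero \<tau>) \<theta>))"
| "uz (EAdd x y) = (\<lambda>\<theta>. unzb (delta (EAdd x y) \<theta>))"
| "uz (EMul x y) = (\<lambda>\<theta>. unzb (delta (EMul x y) \<theta>))"
| "uz (EConst r) = (\<lambda>\<theta>. unzb (delta (EConst r) \<theta>))"
| "uz (EFun f xs) = (\<lambda>\<theta>. unzb (delta (EFun f xs) \<theta>))"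
| "uz (EDup x) = (\<lambda>\<theta>. unzb (delta (EDup x) \<theta>))"
| "uz (EDrop e) = (\<lambda>\<theta>. let (E, P, F) = uz e \<theta>
    in (E @ [(PBang (tyP (fst (ety e))), P)], Bang Unit,
        LetIn (sect_pat (PVar (Lolli (arg_ty \<theta>) (tyT (snd (ety e)))))) (sect (ren Suc F))
          (drop_fun \<theta> (snd (ety e)) 0)))"

section \<open>Renaming of the function components\<close>

lemma map_ren_uvar:
  assumes "set \<theta>' \<subseteq> set \<theta>"
  shows "map (ren (liftn (width \<theta>) f) \<circ> uvar \<theta>) \<theta>' = map (uvar \<theta>) \<theta>'"
proof (rule map_cong[OF refl])
  fix y assume "y \<in> set \<theta>'"
  then have "upos \<theta> y < width \<theta>" using assms by (intro upos_width) auto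
  then show "(ren (liftn (width \<theta>) f) \<circ> uvar \<theta>) y = uvar \<theta> y" by (simp add: liftn_def)
qed

lemma liftn_less: "i < k \<Longrightarrow> liftn k f i = i"
  by (simp add: liftn_def)

lemma liftn_add: "liftn k f (k + a) = k + f a"
  by (simp add: liftn_def)

lemma ren_let_fun [simp]:
  "set \<theta>1 \<subseteq> set \<theta> \<Longrightarrow> set \<theta>2 \<subseteq> set \<theta> \<Longrightarrow> ren f (let_fun \<theta> \<theta>1 \<theta>2 a b) = let_fun \<theta> \<theta>1 \<theta>2 (f a) (f b)"
  by (simp add: let_fun_def liftn_add map_ren_uvar)

lemma ren_unit_fun [simp]:
  "set \<theta>' \<subseteq> set \<theta> \<Longrightarrow> ren f (unit_fun \<theta> \<theta>' a) = unit_fun \<theta> \<theta>' (f a)"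
  by (simp add: unit_fun_def liftn_add map_ren_uvar)

lemma ren_drop_fun [simp]: "ren f (drop_fun \<theta> \<sigma> a) = drop_fun \<theta> \<sigma> (f a)"
  by (simp add: drop_fun_def liftn_def)

lemma split_pos_less: "v \<in> set \<theta> \<Longrightarrow> split_pos \<theta> z v < Suc (length \<theta>)"
  using upos_nth[of v \<theta>] by (auto simp: split_pos_def)

text \<open>A lower bound suffices to see that the indices in the tuple are bound by the pattern,
  and it holds for repeated entries too.\<close>

lemma plen_split_pat: "z \<in> set \<theta> \<Longrightarrow> Suc (length \<theta>) \<le> plen (split_pat \<theta> z \<tau>1 \<tau>2)"
proof -
  let ?h = "\<lambda>v. if v = z then PWith (PVar (tyT \<tau>1)) (PVar (tyT \<tau>2)) else PVar (tyT (snd v))"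
  assume z: "z \<in> set \<theta>"
  have "length \<theta> \<le> length (concat (map leaves (map ?h \<theta>)))"
    and "z \<in> set \<theta> \<Longrightarrow> Suc (length \<theta>) \<le> length (concat (map leaves (map ?h \<theta>)))" for \<theta>
    by (induction \<theta>) auto
  then show ?thesis using z leaves_with_pat[of "map ?h \<theta>"] by (cases "\<theta> = []") (auto simp: split_pat_def plen_def)
qed

lemma ren_split_fun [simp]:
  assumes "z \<in> set \<theta>"
  shows "ren f (split_fun \<theta> z \<tau>1 \<tau>2 a) = (split_fun \<theta> z \<tau>1 \<tau>2 (f a) :: 'f tm)"
proof -
  let ?n = "plen (split_pat \<theta> z \<tau>1 \<tau>2)"
  have "map (ren (liftn ?n f) \<circ> (\<lambda>v. Var (split_pos \<theta> z v))) (removeAll z \<theta>) =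
      (map (\<lambda>v. Var (split_pos \<theta> z v)) (removeAll z \<theta>) :: 'f tm list)"
  proof (rule map_cong[OF refl])
    fix y assume "y \<in> set (removeAll z \<theta>)"
    then show "(ren (liftn ?n f) \<circ> (\<lambda>v. Var (split_pos \<theta> z v))) y = Var (split_pos \<theta> z y)"
      using split_pos_less[of y \<theta> z] plen_split_pat[OF assms, of \<tau>1 \<tau>2] by (simp add: liftn_def)
  qed
  moreover have "liftn ?n f (upos \<theta> z) = upos \<theta> z" "liftn ?n f (upos \<theta> z + 1) = upos \<theta> z + 1"
    using upos_nth[OF assms] plen_split_pat[OF assms, of \<tau>1 \<tau>2] by (auto simp: liftn_def)
  ultimately show ?thesis
    by (simp only: split_fun_def ren.simps ren_with_tm list.map map_map liftn_add)
qed

lemma unzb_let: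
  assumes "unzb M1 = (E1, P1, F1)" "unzb M2 = (E2, P2, F2)" "clen E1 = n1" "clen E2 = n2"
  shows "unzb (LetIn (xf_pat \<theta> r) M1 M2) =
    (E1 @ [(PBang (tyP (fst r)), P1)] @ cren (liftn 1 (\<lambda>i. i - 1 + n1)) E2,
     ren (liftn n2 (liftn 1 (\<lambda>i. i - 1 + n1))) P2,
     LetIn (sect_pat (PVar (Lolli (arg_ty \<theta>) (tyT (snd r))))) (sect (ren (\<lambda>i. i + 1 + n2) F1))
       (ren (\<lambda>i. if i \<le> n2 then i + 1 else if i = n2 + 1 then 0 else i + n1) F2))"
  unfolding assms(3,4)[symmetric] using assms(1,2) by (simp add: xf_pat_def Let_def)

lemma unzb_let_xf:
  assumes "unzb N = (E, P, F)"
  shows "unzb (LetIn (xf_pat \<theta> r) N (Tens P' (sect F'))) =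
    (E @ [(PBang (tyP (fst r)), P)], ren (liftn 1 (\<lambda>i. i - 1 + clen E)) P',
     LetIn (sect_pat (PVar (Lolli (arg_ty \<theta>) (tyT (snd r))))) (sect (ren Suc F))
       (ren (\<lambda>i. if i = 0 then 1 else if i = 1 then 0 else i + clen E) F'))"
  using unzb_let[OF assms, of "Tens P' (sect F')" "[]" P' F' _ 0 \<theta> r] by (simp cong: if_cong)

text \<open>The renaming \<open>f\<close> is forced by the induction: \<open>delta\<close> weakens
  the translation of \<open>e2\<close> by a function variable before \<open>unzb\<close> meets it.
  Composed with this weakening, the renamings of \<open>unzb\<close> that would lose information
  agree with the plain shifts of \<open>uz\<close>.\<close>

theorem unzb_ren_delta:
  "set \<theta> = FVt e \<Longrightarrow> distinct \<theta> \<Longrightarrow> wt S e G \<Longrightarrow> uz e \<theta> = (E, P, F) \<Longrightarrow>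
    unzb (ren f (delta e \<theta>)) = (cren f E, ren (liftn (clen E) f) P, ren (liftn (clen E) f) F)"
proof (induction e arbitrary: \<theta> E P F f G)
  case (ELet e1 e2)
  define \<theta>1 where "\<theta>1 = filter (\<lambda>v. v \<in> FVt e1) \<theta>"
  define \<theta>2 where "\<theta>2 = filter (\<lambda>v. up 1 v \<in> FVt e2) \<theta>"
  define \<theta>2' where "\<theta>2' = (0, snd (ety e1)) # map (up 1) \<theta>2"
  note \<theta> = filter_FVt_ELet[OF ELet.prems(1-3), folded \<theta>1_def \<theta>2_def, folded \<theta>2'_def]
  have sub: "set \<theta>1 \<subseteq> set \<theta>" "set \<theta>2 \<subseteq> set \<theta>" by (auto simp: \<theta>1_def \<theta>2_def)
  obtain E1 P1 F1 E2 P2 F2 where uz: "uz e1 \<theta>1 = (E1, P1, F1)" "uz e2 \<theta>2' = (E2, P2, F2)"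
    by (metis prod_cases3)
  define n1 n2 where "n1 = clen E1" and "n2 = clen E2"
  define g where "g = liftn 1 (\<lambda>i. i + n1)"
  \<comment> \<open>The renaming under which \<open>e2\<close> occurs: the weakening by the function
    variable, followed by \<open>f\<close> carried under the two variables of the pattern.\<close>
  define h where "h = liftn 2 f \<circ> liftn 1 Suc"
  have EPF: "E = E1 @ [(PBang (tyP (fst (ety e1))), P1)] @ cren g E2 @ [(PBang (tyP (fst (ety e2))), ren (liftn n2 g) P2)]"
    "P = Bang (Var 0)"
    "F = LetIn (sect_pat (PVar (Lolli (arg_ty \<theta>1) (tyT (snd (ety e1)))))) (sect (ren (\<lambda>i. i + n2 + 2) F1))
          (LetIn (sect_pat (PVar (Lolli (arg_ty \<theta>2') (tyT (snd (ety e2)))))) (sect (ren (\<lambda>i. liftn n2 g i + 2) F2))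
            (let_fun \<theta> \<theta>1 \<theta>2 0 1))"
    using ELet.prems(4) unfolding uz.simps Let_def \<theta>1_def[symmetric] \<theta>2_def[symmetric]
    unfolding \<theta>2'_def[symmetric] uz n1_def g_def n2_def
    by auto
  have u1: "unzb (ren f (delta e1 \<theta>1)) = (cren f E1, ren (liftn n1 f) P1, ren (liftn n1 f) F1)"
    unfolding n1_def using ELet.IH(1)[OF \<theta>(1,2) _ uz(1), where G = G] ELet.prems(3) by simp
  have u2: "unzb (ren h (delta e2 \<theta>2')) = (cren h E2, ren (liftn n2 h) P2, ren (liftn n2 h) F2)"
    unfolding n2_def using ELet.IH(2)[OF \<theta>(3,4) _ uz(2), where G = "push (fst (ety e1)) G"] ELet.prems(3) by simp
  let ?B2 = "PVar (Lolli (arg_ty \<theta>2') (tyT (snd (ety e2))))"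
  let ?inner = "LetIn (xf_pat \<theta>2' (ety e2)) (ren h (delta e2 \<theta>2')) (Tens (Bang (Var 0)) (sect (let_fun \<theta> \<theta>1 \<theta>2 1 3)))"
  have inner: "unzb ?inner = (cren h E2 @ [(PBang (tyP (fst (ety e2))), ren (liftn n2 h) P2)], Bang (Var 0),
     LetIn (sect_pat ?B2) (sect (ren Suc (ren (liftn n2 h) F2))) (let_fun \<theta> \<theta>1 \<theta>2 0 (3 + n2)))"
    using sub by (simp add: unzb_let_xf[OF u2] n2_def liftn_def)
  let ?r = "liftn 1 (\<lambda>i. i - 1 + n1)"
  let ?k = "\<lambda>i. if i \<le> n2 + 1 then i + 1 else if i = n2 + 1 + 1 then 0 else i + n1"
  have d: "ren f (delta (ELet e1 e2) \<theta>) = LetIn (xf_pat \<theta>1 (ety e1)) (ren f (delta e1 \<theta>1)) ?inner"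
    using sub by (simp add: delta_let_fun(1) Let_def ren_ren h_def liftn_def numeral_3_eq_3 \<theta>1_def \<theta>2_def \<theta>2'_def del: delta.simps)
  have "unzb (ren f (delta (ELet e1 e2) \<theta>)) = (cren f E1 @ [(PBang (tyP (fst (ety e1))), ren (liftn n1 f) P1)] @
      cren ?r (cren h E2 @ [(PBang (tyP (fst (ety e2))), ren (liftn n2 h) P2)]),
      ren (liftn (n2 + 1) ?r) (Bang (Var 0)),
      LetIn (sect_pat (PVar (Lolli (arg_ty \<theta>1) (tyT (snd (ety e1))))))
        (sect (ren (\<lambda>i. i + 1 + (n2 + 1)) (ren (liftn n1 f) F1)))
        (ren ?k (LetIn (sect_pat ?B2) (sect (ren Suc (ren (liftn n2 h) F2))) (let_fun \<theta> \<theta>1 \<theta>2 0 (3 + n2)))))"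
    unfolding d by (rule unzb_let[OF u1 inner, of n1 "n2 + 1" \<theta>1 "ety e1"]) (simp_all add: n1_def n2_def)
  also have "\<dots> = (cren f E, ren (liftn (clen E) f) P, ren (liftn (clen E) f) F)"
  proof -
    \<comment> \<open>\<open>h\<close> never takes the value 1, the place of the function variable,
      so the predecessor in \<open>?r\<close> merely undoes a successor.\<close>
    have rh: "?r \<circ> h = liftn (n1 + 1) f \<circ> g"
      by (auto simp: fun_eq_iff h_def g_def liftn_def)
    have E2: "cren ?r (cren h E2) = cren (liftn (n1 + 1) f) (cren g E2)"
      by (simp only: cren_cren rh)
    have P2: "ren (liftn n2 ?r) (ren (liftn n2 h) P2) = ren (liftn (n1 + 1 + n2) f) (ren (liftn n2 g) P2)"
    proof -
      have "liftn n2 ?r \<circ> liftn n2 h = liftn n2 (liftn (n1 + 1) f) \<circ> liftn n2 g"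
        by (simp only: liftn_comp rh)
      then show ?thesis by (simp only: ren_ren liftn_liftn add.commute[of n2])
    qed
    let ?N = "n1 + n2 + 2"
    have N: "clen E = ?N" by (simp add: EPF n1_def n2_def)
    have "(\<lambda>i. i + 1 + (n2 + 1)) \<circ> liftn n1 f = liftn ?N f \<circ> (\<lambda>i. i + n2 + 2)"
      by (auto simp: fun_eq_iff liftn_def)
    then have F1: "ren (\<lambda>i. i + 1 + (n2 + 1)) (ren (liftn n1 f) F1) = ren (liftn ?N f) (ren (\<lambda>i. i + n2 + 2) F1)"
      by (simp only: ren_ren)
    \<comment> \<open>The value \<open>n2 + 2\<close>, which \<open>?k\<close> treats as the
      function variable of \<open>e1\<close>, is not hit here either.\<close>
    have "?k \<circ> (Suc \<circ> liftn n2 h) = liftn 1 (liftn ?N f) \<circ> (\<lambda>i. liftn n2 g i + 2)"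
      by (auto simp: fun_eq_iff h_def g_def liftn_def)
    then have F2: "ren ?k (ren Suc (ren (liftn n2 h) F2)) =
        ren (liftn 1 (liftn ?N f)) (ren (\<lambda>i. liftn n2 g i + 2) F2)"
      by (simp only: ren_ren)
    \<comment> \<open>The function variable of \<open>e2\<close> stays at 0, while that of
      \<open>e1\<close>, seen at \<open>3 + n2\<close> behind everything bound since, is brought
      next to it at 1.\<close>
    have B: "ren (liftn 1 ?k) (let_fun \<theta> \<theta>1 \<theta>2 0 (3 + n2)) = let_fun \<theta> \<theta>1 \<theta>2 0 1"
      "ren (liftn 1 (liftn 1 (liftn ?N f))) (let_fun \<theta> \<theta>1 \<theta>2 0 1) = let_fun \<theta> \<theta>1 \<theta>2 0 1"
      using sub by (simp_all add: liftn_def)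
    have "cren f E = cren f E1 @ [(PBang (tyP (fst (ety e1))), ren (liftn n1 f) P1)] @
      cren ?r (cren h E2 @ [(PBang (tyP (fst (ety e2))), ren (liftn n2 h) P2)])"
      using E2 P2 by (simp add: EPF cren_append liftn_liftn add.commute[of n2 n1] flip: n1_def n2_def)
    moreover have "ren (liftn (clen E) f) F = LetIn (sect_pat (PVar (Lolli (arg_ty \<theta>1) (tyT (snd (ety e1))))))
        (sect (ren (\<lambda>i. i + 1 + (n2 + 1)) (ren (liftn n1 f) F1)))
        (ren ?k (LetIn (sect_pat ?B2) (sect (ren Suc (ren (liftn n2 h) F2))) (let_fun \<theta> \<theta>1 \<theta>2 0 (3 + n2))))"
      unfolding N EPF(3) ren.simps plen_simps add_0 F1 F2 B ..
    moreover have "ren (liftn (n2 + 1) ?r) (Bang (Var 0)) = ren (liftn (clen E) f) P"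
      by (simp add: N EPF(2) liftn_def)
    ultimately show ?thesis by simp
  qed
  finally show ?case .
next
  case (ELetUnitP z e)
  obtain E1 P1 F1 where uz: "uz e \<theta> = (E1, P1, F1)" by (metis prod_cases3)
  then show ?case using ELetUnitP.IH[OF _ _ _ uz, of G f] ELetUnitP.prems by auto
next
  case (ELetUnitT z e)
  let ?\<theta>' = "removeAll (z, LOne) \<theta>"
  have \<theta>': "set ?\<theta>' = FVt e" "distinct ?\<theta>'" and sub: "set ?\<theta>' \<subseteq> set \<theta>"
    using ELetUnitT.prems by (auto simp: distinct_removeAll)
  obtain E1 P1 F1 where uz: "uz e ?\<theta>' = (E1, P1, F1)" by (metis prod_cases3)
  have u: "unzb (ren f (delta e ?\<theta>')) = (cren f E1, ren (liftn (clen E1) f) P1, ren (liftn (clen E1) f) F1)"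
    using ELetUnitT.IH[OF \<theta>' _ uz, where G = G] ELetUnitT.prems(3) by simp
  have "liftn (Suc (clen E1)) f \<circ> Suc = Suc \<circ> liftn (clen E1) f" by (auto simp: liftn_def)
  then have "ren (liftn (Suc (clen E1)) f) (ren Suc F1) = ren Suc (ren (liftn (clen E1) f) F1)"
    by (simp only: ren_ren)
  then show ?case
    using ELetUnitT.prems(4) uz sub unzb_let_xf[OF u, of ?\<theta>' "ety e" "Bang (Var 0)" "unit_fun \<theta> ?\<theta>' 1"]
    by (auto simp: delta_let_fun(2) Let_def cren_append liftn_less simp del: delta.simps removeAll.simps)
next
  case (ELetTensT z \<tau>1 \<tau>2 e)
  let ?z = "(z, LTens \<tau>1 \<tau>2)"
  let ?\<theta>' = "(0, \<tau>1) # (1, \<tau>2) # map (up 2) (removeAll ?z \<theta>)"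
  note \<theta>' = removeAll_FVt_ELetTensT[OF ELetTensT.prems(1-3)]
  have z: "?z \<in> set \<theta>" using ELetTensT.prems(1) by simp
  obtain E1 P1 F1 where uz: "uz e ?\<theta>' = (E1, P1, F1)" by (metis prod_cases3)
  have u: "unzb (ren f (delta e ?\<theta>')) = (cren f E1, ren (liftn (clen E1) f) P1, ren (liftn (clen E1) f) F1)"
    using ELetTensT.IH[OF \<theta>' _ uz, where G = G] ELetTensT.prems(3) by simp
  have "liftn (Suc (clen E1)) f \<circ> Suc = Suc \<circ> liftn (clen E1) f" by (auto simp: liftn_def)
  then have "ren (liftn (Suc (clen E1)) f) (ren Suc F1) = ren Suc (ren (liftn (clen E1) f) F1)"
    by (simp only: ren_ren)
  then show ?case
    using ELetTensT.prems(4) uz z unzb_let_xf[OF u, of ?\<theta>' "ety e" "Bang (Var 0)" "split_fun \<theta> ?z \<tau>1 \<tau>2 1"]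
    by (auto simp: delta_let_fun(3) Let_def cren_append liftn_less simp del: delta.simps removeAll.simps)
next
  case (EDrop e)
  obtain E1 P1 F1 where uz: "uz e \<theta> = (E1, P1, F1)" by (metis prod_cases3)
  have u: "unzb (ren f (delta e \<theta>)) = (cren f E1, ren (liftn (clen E1) f) P1, ren (liftn (clen E1) f) F1)"
    using EDrop.IH[OF _ _ _ uz, where G = G] EDrop.prems by simp
  have "liftn (Suc (clen E1)) f \<circ> Suc = Suc \<circ> liftn (clen E1) f" by (auto simp: liftn_def)
  then have "ren (liftn (Suc (clen E1)) f) (ren Suc F1) = ren Suc (ren (liftn (clen E1) f) F1)"
    by (simp only: ren_ren)
  then show ?case
    using EDrop.prems(4) uz unzb_let_xf[OF u, of \<theta> "ety e" "Bang Unit" "drop_fun \<theta> (snd (ety e)) 1"]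
    by (auto simp: delta_let_fun(4) Let_def cren_append liftn_less simp del: delta.simps)
qed (auto simp: Let_def)

corollary unzb_delta:
  assumes "set \<theta> = FVt e" "distinct \<theta>" "wt S e G"
  shows "unzb (delta e \<theta>) = uz e \<theta>"
proof -
  obtain E P F where uz: "uz e \<theta> = (E, P, F)" by (metis prod_cases3)
  have "cren id E = E" for E :: "'a lctxt" by (induction E) auto
  then show ?thesis using unzb_ren_delta[OF assms uz, of id] uz by simp
qed

subsection \<open>Evaluation of contexts\<close>

text \<open>Evaluation of a stack of lets to the environment of its hole, the lambda-LL counterpart
  of \<open>jenv\<close>. It is a relation because a bound term may be evaluated further than its
  pattern demands.\<close>

inductive ceval :: "'f signature \<Rightarrow> (nat \<Rightarrow> 'f tm) \<Rightarrow> 'f lctxt \<Rightarrow> (nat \<Rightarrow> 'f tm) \<Rightarrow> bool" for S where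
  ceval_Nil: "ceval S s [] s"
| ceval_Cons: "wreds S (subst s N) (value_of u (number 0 p)) \<Longrightarrow> ceval S (bind (plen p) u s) E s' \<Longrightarrow>
    ceval S s ((p, N) # E) s'"

lemma ceval_cplug: "ceval S s E s' \<Longrightarrow> wreds S (subst s (cplug E M)) (subst s' M)"
proof (induction rule: ceval.induct)
  case (ceval_Cons s N u p E s')
  from rtranclp_trans[OF wreds_beta[OF ceval_Cons.hyps(1)] ceval_Cons.IH] show ?case by simp
qed simp

lemma ceval_append: "ceval S s E1 s1 \<Longrightarrow> ceval S s1 E2 s2 \<Longrightarrow> ceval S s (E1 @ E2) s2"
  by (induction rule: ceval.induct) (auto intro: ceval_Cons)

lemma ceval_Bang:
  assumes "wreds S (subst s P) (Bang V)"
  shows "ceval S s [(PBang A, P)] (case_nat V s)"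
  using ceval_Cons[of S s P "\<lambda>_. V" "PBang A" "[]" "bind (Suc 0) (\<lambda>_. V) s"] assms
  by (simp add: ceval_Nil) (simp add: bind_case_nat)

lemma ceval_shift: "ceval S s E s' \<Longrightarrow> s' (clen E + i) = s i"
proof (induction arbitrary: i rule: ceval.induct)
  case (ceval_Cons s N u p E s')
  have "s' (clen E + (plen p + i)) = s i"
    unfolding ceval_Cons.IH by (simp add: bind_def)
  then show ?case by (simp add: ac_simps)
qed simp

text \<open>The counterpart of \<open>jenv_jren\<close>: evaluation binds the same values, and the
  original environment is recovered by reindexing the larger one.\<close>

lemma ceval_cren:
  "ceval S t E s' \<Longrightarrow> t = s \<circ> f \<Longrightarrow> \<exists>s''. ceval S s (cren f E) s'' \<and> s'' \<circ> liftn (clen E) f = s'"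
proof (induction arbitrary: s f rule: ceval.induct)
  case (ceval_Nil t)
  then show ?case by (auto intro: ceval.intros)
next
  case (ceval_Cons t N u p E s')
  have "bind (plen p) u t = bind (plen p) u s \<circ> liftn (plen p) f"
    by (simp only: bind_comp_liftn ceval_Cons.prems)
  from ceval_Cons.IH[OF this] obtain s'' where
    "ceval S (bind (plen p) u s) (cren (liftn (plen p) f) E) s''"
    "s'' \<circ> liftn (clen E) (liftn (plen p) f) = s'" by blast
  moreover have "wreds S (subst s (ren f N)) (value_of u (number 0 p))"
    using ceval_Cons.hyps(1) unfolding ceval_Cons.prems subst_ren .
  ultimately show ?case by (auto simp: liftn_liftn add.commute intro!: ceval.ceval_Cons)
qed

lemma uz_leaf_rep:
  assumes "is_leaf e" "wt S e G" "renv S G s \<rho>" "set \<theta> = FVt e" "uz e \<theta> = (E, P, F)"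
  shows "\<exists>s'. ceval S s E s' \<and> rep S (OfCourse (tyP (fst (ety e)))) (subst s' P) (evP S e \<rho>) \<and>
      frep S \<theta> (snd (ety e)) (subst s' F) (evT S e \<rho>)"
proof -
  have "uz e \<theta> = unzb (delta e \<theta>)" using assms(1) by (cases e) auto
  then show ?thesis
    using delta_leaf_rep[OF assms(1,2,4,3)] assms(5) by (intro exI[of _ s]) (auto intro: ceval_Nil)
qed

text \<open>Once the stack is evaluated, the function component of a compound expression consists of
  \<open>sect_pat\<close> lets around a named function. Contracting them yields the kind of closure
  met for \<open>delta\<close>, so the same \<open>frep\<close> lemmas apply.\<close>

theorem uz_rep:
  "wt S e G \<Longrightarrow> renv S G s \<rho> \<Longrightarrow> set \<theta> = FVt e \<Longrightarrow> distinct \<theta> \<Longrightarrow> uz e \<theta> = (E, P, F) \<Longrightarrow>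
    \<exists>s'. ceval S s E s' \<and> rep S (OfCourse (tyP (fst (ety e)))) (subst s' P) (evP S e \<rho>) \<and>
      frep S \<theta> (snd (ety e)) (subst s' F) (evT S e \<rho>)"
proof (induction e arbitrary: G s \<rho> \<theta> E P F)
  case (ELet e1 e2)
  define \<theta>1 where "\<theta>1 = filter (\<lambda>v. v \<in> FVt e1) \<theta>"
  define \<theta>2 where "\<theta>2 = filter (\<lambda>v. up 1 v \<in> FVt e2) \<theta>"
  define \<theta>2' where "\<theta>2' = (0, snd (ety e1)) # map (up 1) \<theta>2"
  note \<theta> = filter_FVt_ELet[OF ELet.prems(3,4,1), folded \<theta>1_def \<theta>2_def, folded \<theta>2'_def]
  have sub: "set \<theta>1 \<subseteq> set \<theta>" "set \<theta>2 \<subseteq> set \<theta>" by (auto simp: \<theta>1_def \<theta>2_def)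
  obtain E1 P1 F1 E2 P2 F2 where uz: "uz e1 \<theta>1 = (E1, P1, F1)" "uz e2 \<theta>2' = (E2, P2, F2)"
    by (metis prod_cases3)
  define g where "g = liftn 1 (\<lambda>i. i + clen E1)"
  let ?B1 = "PVar (Lolli (arg_ty \<theta>1) (tyT (snd (ety e1))))"
  let ?B2 = "PVar (Lolli (arg_ty \<theta>2') (tyT (snd (ety e2))))"
  have EPF: "E = E1 @ [(PBang (tyP (fst (ety e1))), P1)] @ cren g E2 @ [(PBang (tyP (fst (ety e2))), ren (liftn (clen E2) g) P2)]"
    "P = Bang (Var 0)"
    "F = LetIn (sect_pat ?B1) (sect (ren (\<lambda>i. i + clen E2 + 2) F1))
          (LetIn (sect_pat ?B2) (sect (ren (\<lambda>i. liftn (clen E2) g i + 2) F2)) (let_fun \<theta> \<theta>1 \<theta>2 0 1))"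
    using ELet.prems(5) unfolding uz.simps Let_def \<theta>1_def[symmetric] \<theta>2_def[symmetric]
    unfolding \<theta>2'_def[symmetric] uz g_def
    by auto
  obtain s1 V1 where 1: "ceval S s E1 s1" "wreds S (subst s1 P1) (Bang V1)"
    "rep S (tyP (fst (ety e1))) V1 (evP S e1 \<rho>)" "frep S \<theta>1 (snd (ety e1)) (subst s1 F1) (evT S e1 \<rho>)"
    using ELet.IH(1)[OF _ ELet.prems(2) \<theta>(1,2) uz(1)] ELet.prems(1) by auto
  define s2 where "s2 = case_nat V1 s1"
  \<comment> \<open>The primal result of \<open>e1\<close> stays in front while \<open>g\<close>
    skips what \<open>E1\<close> has bound.\<close>
  have s2: "s2 \<circ> g = case_nat V1 s"
    using ceval_shift[OF 1(1)] by (auto simp: s2_def g_def liftn_def fun_eq_iff add.commute split: nat.split)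
  obtain s3 V2 where 2: "ceval S (case_nat V1 s) E2 s3" "wreds S (subst s3 P2) (Bang V2)"
    "rep S (tyP (fst (ety e2))) V2 (evP S (ELet e1 e2) \<rho>)"
    "frep S \<theta>2' (snd (ety e2)) (subst s3 F2) (evT S e2 (case_nat (evP S e1 \<rho>) \<rho>))"
    using ELet.IH(2)[OF _ renv_push[OF ELet.prems(2) 1(3)] \<theta>(3,4) uz(2)] ELet.prems(1) by auto
  obtain s4 where 4: "ceval S s2 (cren g E2) s4" "s4 \<circ> liftn (clen E2) g = s3"
    using ceval_cren[OF 2(1) s2[symmetric]] by blast
  define s5 where "s5 = case_nat V2 s4"
  have "ceval S s E s5"
    unfolding EPF(1) s5_def
    using 1 2 4 by (intro ceval_append[OF 1(1)] ceval_append[of S s1 _ s2] ceval_append[OF 4(1)] ceval_Bang)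
      (auto simp: s2_def subst_ren intro: ceval_Bang)
  moreover have "rep S (OfCourse (tyP (fst (ety e2)))) (subst s5 P) (evP S (ELet e1 e2) \<rho>)"
    using 2(3) by (auto simp: EPF(2) s5_def)
  moreover have "frep S \<theta> (snd (ety e2)) (subst s5 F) (evT S (ELet e1 e2) \<rho>)"
  proof -
    define X1 where "X1 = subst s5 (ren (\<lambda>i. i + clen E2 + 2) F1)"
    define X2 where "X2 = subst (case_nat X1 s5) (ren (\<lambda>i. liftn (clen E2) g i + 2) F2)"
    \<comment> \<open>The two extra places are the primal results of \<open>e2\<close> and of
      \<open>e1\<close>, on either side of the variables of \<open>E2\<close>.\<close>
    have "s5 (i + clen E2 + 2) = s1 i" for i
      using ceval_shift[OF 4(1), of "Suc i"] by (simp add: s5_def s2_def add.commute)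
    then have X1: "X1 = subst s1 F1" by (simp add: X1_def subst_ren comp_def)
    have "case_nat X1 s5 \<circ> (\<lambda>i. liftn (clen E2) g i + 2) = s3"
      using 4(2) by (auto simp: s5_def fun_eq_iff)
    then have X2: "X2 = subst s3 F2" by (simp add: X2_def subst_ren)
    have "frep S \<theta> (snd (ety e2)) (subst (case_nat X2 (case_nat X1 s5)) (let_fun \<theta> \<theta>1 \<theta>2 0 1))
        (\<lambda>\<mu>. evT S e2 (case_nat (evP S e1 \<rho>) \<rho>) (case_nat (evT S e1 \<rho> \<mu>) \<mu>))"
      using 1(4) 2(4) sub by (intro frep_let_fun) (auto simp: X1 X2 \<theta>2'_def)
    moreover have "wreds S (subst s5 F) (subst (case_nat X2 (case_nat X1 s5)) (let_fun \<theta> \<theta>1 \<theta>2 0 1))"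
      unfolding EPF(3) X2_def X1_def by (rule rtranclp_trans[OF wreds_let_sect wreds_let_sect])
    ultimately show ?thesis by (auto intro: frep_expand)
  qed
  ultimately show ?case by auto
next
  case (ELetUnitP z e)
  obtain E1 P1 F1 where uz: "uz e \<theta> = (E1, P1, F1)" by (metis prod_cases3)
  obtain s' where s': "ceval S s E1 s'" "rep S (OfCourse (tyP (fst (ety e)))) (subst s' P1) (evP S e \<rho>)"
      "frep S \<theta> (snd (ety e)) (subst s' F1) (evT S e \<rho>)"
    using ELetUnitP.IH[OF _ ELetUnitP.prems(2) _ ELetUnitP.prems(4) uz] ELetUnitP.prems(1,3) by auto
  have "wreds S (subst s (Var z)) Unit" using ELetUnitP.prems(1,2) by (fastforce simp: renv_def)
  then have "ceval S s ((PUnit, Var z) # E1) s'"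
    using s'(1) by (intro ceval_Cons[of _ _ _ s]) (simp_all add: bind_def)
  then show ?case using s'(2,3) ELetUnitP.prems(5) uz by auto
next
  case (ELetUnitT z e)
  let ?\<theta>' = "removeAll (z, LOne) \<theta>"
  have \<theta>': "set ?\<theta>' = FVt e" "distinct ?\<theta>'"
    using ELetUnitT.prems by (auto simp: distinct_removeAll)
  obtain E1 P1 F1 where uz: "uz e ?\<theta>' = (E1, P1, F1)" by (metis prod_cases3)
  obtain s' V where s': "ceval S s E1 s'" "wreds S (subst s' P1) (Bang V)"
      "rep S (tyP (fst (ety e))) V (evP S e \<rho>)" "frep S ?\<theta>' (snd (ety e)) (subst s' F1) (evT S e \<rho>)"
    using ELetUnitT.IH[OF _ ELetUnitT.prems(2) \<theta>' uz] ELetUnitT.prems(1) by auto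
  have EPF: "E = E1 @ [(PBang (tyP (fst (ety e))), P1)]" "P = Bang (Var 0)"
    "F = LetIn (sect_pat (PVar (Lolli (arg_ty (?\<theta>')) (tyT (snd (ety e)))))) (sect (ren Suc F1)) (unit_fun \<theta> ?\<theta>' 0)"
    using ELetUnitT.prems(5) uz by (simp_all add: Let_def)
  let ?s = "case_nat V s'"
  have X: "subst ?s (ren Suc F1) = subst s' F1" by (simp add: subst_ren comp_def)
  have "frep S \<theta> (snd (ety e)) (subst (case_nat (subst ?s (ren Suc F1)) ?s) (unit_fun \<theta> ?\<theta>' 0)) (evT S e \<rho>)"
    using s'(4) by (intro frep_unit_fun) (auto simp: X)
  from frep_expand[OF this wreds_let_sect]
  have "frep S \<theta> (snd (ety e)) (subst ?s F) (evT S e \<rho>)"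
    unfolding EPF(3) .
  then show ?case
    using ceval_append[OF s'(1) ceval_Bang[OF s'(2)]] s'(3) unfolding EPF(1,2)
    by (intro exI[of _ ?s]) auto
next
  case (ELetTensT z \<tau>1 \<tau>2 e)
  let ?z = "(z, LTens \<tau>1 \<tau>2)"
  let ?\<theta>' = "(0, \<tau>1) # (1, \<tau>2) # map (up 2) (removeAll ?z \<theta>)"
  note \<theta>' = removeAll_FVt_ELetTensT[OF ELetTensT.prems(3,4,1)]
  obtain E1 P1 F1 where uz: "uz e ?\<theta>' = (E1, P1, F1)" by (metis prod_cases3)
  obtain s' V where s': "ceval S s E1 s'" "wreds S (subst s' P1) (Bang V)"
      "rep S (tyP (fst (ety e))) V (evP S e \<rho>)" "frep S ?\<theta>' (snd (ety e)) (subst s' F1) (evT S e \<rho>)"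
    using ELetTensT.IH[OF _ ELetTensT.prems(2) \<theta>' uz] ELetTensT.prems(1) by auto
  have EPF: "E = E1 @ [(PBang (tyP (fst (ety e))), P1)]" "P = Bang (Var 0)"
    "F = LetIn (sect_pat (PVar (Lolli (arg_ty (?\<theta>')) (tyT (snd (ety e)))))) (sect (ren Suc F1)) (split_fun \<theta> ?z \<tau>1 \<tau>2 0)"
    using ELetTensT.prems(5) uz by (simp_all add: Let_def)
  let ?s = "case_nat V s'"
  have X: "subst ?s (ren Suc F1) = subst s' F1" by (simp add: subst_ren comp_def)
  have "frep S \<theta> (snd (ety e)) (subst (case_nat (subst ?s (ren Suc F1)) ?s) (split_fun \<theta> ?z \<tau>1 \<tau>2 0))
      (evT S (ELetTensT z \<tau>1 \<tau>2 e) \<rho>)"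
    using s'(4) ELetTensT.prems(3,4)
      frep_split_fun[of \<theta> ?z \<tau>1 \<tau>2 S "snd (ety e)" "case_nat (subst ?s (ren Suc F1)) ?s" 0 "evT S e \<rho>"]
    by (simp add: X)
  from frep_expand[OF this wreds_let_sect]
  have "frep S \<theta> (snd (ety e)) (subst ?s F) (evT S (ELetTensT z \<tau>1 \<tau>2 e) \<rho>)"
    unfolding EPF(3) .
  then show ?case
    using ceval_append[OF s'(1) ceval_Bang[OF s'(2)]] s'(3) unfolding EPF(1,2)
    by (intro exI[of _ ?s]) auto
next
  case (EDrop e)
  obtain E1 P1 F1 where uz: "uz e \<theta> = (E1, P1, F1)" by (metis prod_cases3)
  obtain s' V where s': "ceval S s E1 s'" "wreds S (subst s' P1) (Bang V)"
    using EDrop.IH[OF _ EDrop.prems(2) _ EDrop.prems(4) uz] EDrop.prems(1,3) by auto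
  show ?case
    using EDrop.prems(5) uz ceval_append[OF s'(1) ceval_Bang[OF s'(2)]]
    by (intro exI[of _ "case_nat V s'"]) (auto simp: frep_LOne)
qed (rule uz_leaf_rep, simp, assumption+)+

corollary unzip_delta_rep:
  assumes "wt S e G" "renv S G s \<rho>" "set \<theta> = FVt e" "distinct \<theta>"
  shows "\<exists>V F. wreds S (subst s (unzip (delta e \<theta>))) (Tens (Bang V) (sect F)) \<and>
      rep S (tyP (fst (ety e))) V (evP S e \<rho>) \<and> frep S \<theta> (snd (ety e)) F (evT S e \<rho>)"
proof -
  obtain E P F where uz: "uz e \<theta> = (E, P, F)" by (metis prod_cases3)
  obtain s' V where s': "ceval S s E s'" "wreds S (subst s' P) (Bang V)"
      "rep S (tyP (fst (ety e))) V (evP S e \<rho>)" "frep S \<theta> (snd (ety e)) (subst s' F) (evT S e \<rho>)"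
    using uz_rep[OF assms uz] by auto
  have "unzip (delta e \<theta>) = cplug E (Tens P (sect F))"
    using unzb_delta[OF assms(3,4,1)] uz by (simp add: unzip_def)
  then have "wreds S (subst s (unzip (delta e \<theta>))) (subst s' (Tens P (sect F)))"
    using ceval_cplug[OF s'(1), of "Tens P (sect F)"] by (simp only:)
  also have "wreds S \<dots> (Tens (Bang V) (sect (subst s' F)))"
    using s'(2) by (simp add: wreds_Tens)
  finally show ?thesis using s'(3,4) by blast
qed

subsection \<open>Typing with weakenable environments\<close>

text \<open>The pattern of \<open>\<section>f\<close>.  Unlike a plain variable it may be left unused, by choosing the
  component \<open>()\<close>; this is the purpose of \<open>\<section>\<close>.\<close>

abbreviation sv :: "nat \<Rightarrow> ty \<Rightarrow> (nat \<times> ty) pat" where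
  "sv i A \<equiv> PWith PUnit (PVar (i, A))"

definition weak_env :: "env \<Rightarrow> bool" where
  "weak_env W \<longleftrightarrow> (\<forall>p\<in>W. \<exists>i A. p = PBang (i, A) \<or> p = sv i A)"

lemma weak_env_simps [simp]:
  "weak_env {}" "weak_env (insert (PBang (i, A)) W) = weak_env W" "weak_env (insert (sv i A) W) = weak_env W"
  "weak_env (V \<union> W) \<longleftrightarrow> weak_env V \<and> weak_env W" "bang_env W \<Longrightarrow> weak_env W"
  by (auto simp: weak_env_def bang_env_def)

lemma is_env_simps [simp]:
  "is_env {}" "is_env {PVar v}" "is_env {PBang v}" "is_env {sv i A}" "is_env {number k p}"
  by (auto simp: is_env_def fst_leaves_number)

lemma is_env_Un: "is_env D \<Longrightarrow> is_env E \<Longrightarrow> apart D E \<Longrightarrow> is_env (D \<union> E)"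
  unfolding is_env_def
proof (intro conjI ballI impI)
  assume D: "finite D \<and> (\<forall>p\<in>D. distinct (map fst (leaves p))) \<and> (\<forall>p\<in>D. \<forall>q\<in>D. p \<noteq> q \<longrightarrow> evars {p} \<inter> evars {q} = {})"
    and E: "finite E \<and> (\<forall>p\<in>E. distinct (map fst (leaves p))) \<and> (\<forall>p\<in>E. \<forall>q\<in>E. p \<noteq> q \<longrightarrow> evars {p} \<inter> evars {q} = {})"
    and ap: "apart D E"
  show "finite (D \<union> E)" using D E by simp
  show "distinct (map fst (leaves p))" if "p \<in> D \<union> E" for p using D E that by auto
  fix p q assume pq: "p \<in> D \<union> E" "q \<in> D \<union> E" "p \<noteq> q"
  have mixed: "evars {p'} \<inter> evars {q'} = {}" if "p' \<in> D" "q' \<in> E" for p' q'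
    using evars_mono[of "{p'}" D] evars_mono[of "{q'}" E] ap that unfolding apart_def by blast
  from pq(1,2) consider "p \<in> D" "q \<in> D" | "p \<in> D" "q \<in> E" | "q \<in> D" "p \<in> E" | "p \<in> E" "q \<in> E" by blast
  then show "evars {p} \<inter> evars {q} = {}"
  proof cases
    case 1
    then show ?thesis using D pq(3) by blast
  next
    case 2
    then show ?thesis by (rule mixed)
  next
    case 3
    then have "evars {q} \<inter> evars {p} = {}" by (rule mixed)
    then show ?thesis by (simp only: Int_commute)
  next
    case 4
    then show ?thesis using E pq(3) by blast
  qed
qed

lemma is_env_insertD:
  assumes "is_env (insert p D)" "p \<notin> D"
  shows "apart {p} D"
proof -
  have "\<forall>p'\<in>insert p D. \<forall>q'\<in>insert p D. p' \<noteq> q' \<longrightarrow> evars {p'} \<inter> evars {q'} = {}"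
    using assms(1) unfolding is_env_def by (elim conjE)
  then have "evars {p} \<inter> evars {q} = {}" if "q \<in> D" for q
    using assms(2) that by (metis insertI1 insertI2)
  then show ?thesis by (auto simp: apart_def evars_def)
qed

lemma apart_simps [simp]:
  "apart {} D" "apart D {}" "apart (D \<union> E) F \<longleftrightarrow> apart D F \<and> apart E F" "apart F (D \<union> E) \<longleftrightarrow> apart F D \<and> apart F E"
  by (auto simp: apart_def)

text \<open>An exponential enters by \<open>t_weak\<close>; a pattern \<open>sv i A\<close> enters
  by adding \<open>PUnit\<close> and then turning it into the left component of the pair
  pattern.\<close>

lemma typed_weaken:
  assumes "typed S D M A" "weak_env W" "is_env (W \<union> D)"
  shows "typed S (W \<union> D) M A"
proof -
  have "finite W" using assms(3) by (simp add: is_env_def)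
  then show ?thesis
    using assms(2,3)
  proof (induction W rule: finite_induct)
    case empty
    then show ?case using assms(1) by simp
  next
    case (insert p W)
    show ?case
    proof (cases "p \<in> D")
      case True
      then have "insert p W \<union> D = W \<union> D" by auto
      then show ?thesis using insert by (simp add: weak_env_def)
    next
      case False
      have "is_env (W \<union> D)" using insert.prems(2) by (rule is_env_subset) auto
      then have IH: "typed S (W \<union> D) M A" using insert by (simp add: weak_env_def)
      have ap: "apart {p} (W \<union> D)"
        using insert.prems(2) insert.hyps(2) False by (intro is_env_insertD) auto
      from insert.prems(1) consider i B where "p = PBang (i, B)" | i B where "p = sv i B"
        by (auto simp: weak_env_def)
      then show ?thesis
      proof cases
        case 1
        then show ?thesis using t_weak[OF IH] ap by simp
      next
        case 2
        then show ?thesis using t_pwith1[OF t_punit[OF IH]] ap by simp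
      qed
    qed
  qed
qed

lemma typed_weaken_sup:
  "typed S D M A \<Longrightarrow> D \<subseteq> E \<Longrightarrow> weak_env (E - D) \<Longrightarrow> is_env E \<Longrightarrow> typed S E M A"
  using typed_weaken[of S D M A "E - D"] by (simp add: Un_absorb2)

section \<open>Derived typing rules\<close>

lemma typed_App_linear:
  "typed S D1 M (Lolli A B) \<Longrightarrow> typed S D2 N A \<Longrightarrow> apart D1 D2 \<Longrightarrow> typed S (D1 \<union> D2) (App M N) B"
  using t_app[of S "{}" D1 M A B "{}" D2 N] by (simp add: bang_env_def)

text \<open>An argument without linear resources can share all its variables with the function
  applied to it.\<close>

lemma typed_App_bang:
  "typed S (G \<union> D) M (Lolli A B) \<Longrightarrow> typed S G N A \<Longrightarrow> bang_env G \<Longrightarrow> is_env G \<Longrightarrow> apart G D \<Longrightarrow>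
    typed S (G \<union> D) (App M N) B"
  using t_app[of S G D M A B G "{}" N] by simp

lemma typed_Tens_bang:
  "typed S G M A \<Longrightarrow> typed S G N B \<Longrightarrow> bang_env G \<Longrightarrow> is_env G \<Longrightarrow> typed S G (Tens M N) (TensT A B)"
  using t_tens[of S G "{}" M A G "{}" N B] by simp

lemma typed_bang_unit: "bang_env G \<Longrightarrow> is_env G \<Longrightarrow> typed S G (Bang Unit) (OfCourse OneT)"
  using typed_weaken[OF closed_BangI[OF t_unit], of G S] by simp

lemma typed_sv: "typed S {sv i A} (Var i) A"
  by (intro t_pwith2 t_var) auto

lemma typed_bang_var:
  assumes "PBang (i, A) \<in> G" "bang_env G" "is_env G"
  shows "typed S G (Var i) A" "typed S G (Bang (Var i)) (OfCourse A)"
proof -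
  show "typed S G (Var i) A"
    by (rule typed_weaken_sup[OF t_bvar]) (use assms in \<open>auto simp: weak_env_def bang_env_def\<close>)
  then show "typed S G (Bang (Var i)) (OfCourse A)" using assms(2) by (intro t_bang)
qed

text \<open>A tuple pattern acts as a choice of projection made by the typing rules: each use keeps
  one leaf and discards the others.\<close>

lemma typed_leaf: "tangent_pat p \<Longrightarrow> i < plen p \<Longrightarrow> typed S {number k p} (Var (k + i)) (leaves p ! i)"
proof (induction p arbitrary: k i)
  case (PVar A)
  then show ?case by (simp add: t_var)
next
  case (PWith p q)
  have env: "is_env {PWith (number k p) (number (k + plen p) q)}"
    using is_env_simps(5)[of k "PWith p q"] by simp
  show ?case
  proof (cases "i < plen p")
    case True
    then show ?thesis
      using PWith t_pwith1[OF PWith.IH(1) env] by (simp add: nth_append flip: plen_def)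
  next
    case False
    then show ?thesis
      using PWith.prems t_pwith2[OF PWith.IH(2)[of "i - plen p" "k + plen p"] env]
      by (simp add: nth_append flip: plen_def)
  qed
qed auto

lemma typed_uvar: "y \<in> set \<theta> \<Longrightarrow> typed S {number 0 (upat \<theta>)} (uvar \<theta> y) (tyT (snd y))"
  using typed_leaf[of "upat \<theta>" "upos \<theta> y" S 0] upos_width[of y \<theta>] upos_nth[of y \<theta>] leaves_upat[of \<theta>]
  by (cases "\<theta> = []") auto

lemma typed_with_tm: "is_env D \<Longrightarrow> list_all2 (typed S D) Ms As \<Longrightarrow> typed S D (with_tm Ms) (with_ty As)"
proof (induction Ms arbitrary: As rule: induct_list012)
  case 1
  then show ?case by (simp add: t_top)
next
  case (2 M)
  then show ?case by (auto simp: list_all2_Cons1)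
next
  case (3 M N Ms)
  then obtain A B Bs where "As = A # B # Bs" "typed S D M A" "list_all2 (typed S D) (N # Ms) (B # Bs)"
    by (auto simp: list_all2_Cons1)
  then show ?case using "3.IH"(2)[OF "3.prems"(1)] by (auto intro: t_with)
qed

lemma list_all2_map_same: "list_all2 R (map f xs) (map g xs) \<longleftrightarrow> (\<forall>x\<in>set xs. R (f x) (g x))"
  by (induction xs) auto

lemma typed_utuple:
  assumes "set \<theta>' \<subseteq> set \<theta>"
  shows "typed S {number 0 (upat \<theta>)} (with_tm (map (uvar \<theta>) \<theta>')) (arg_ty \<theta>')"
  using assms by (intro typed_with_tm) (auto simp: list_all2_map_same intro: typed_uvar)

lemma apart_sv_number: "k + plen p \<le> i \<Longrightarrow> apart {sv i A} {number k p}"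
  by (auto simp: apart_def)

lemma shift_env_sv [simp]:
  "shift_env k (insert (sv i A) D) = insert (sv (i + k) A) (shift_env k D)"
  "shift_env k (insert (PBang (i, A)) D) = insert (PBang (i + k, A)) (shift_env k D)"
  by (auto simp: shift_env_def)

section \<open>Typing of the function components and of the vector space operations\<close>

lemma typed_let_fun:
  assumes "set \<theta>1 \<subseteq> set \<theta>" "set \<theta>2 \<subseteq> set \<theta>" "a \<noteq> b"
  shows "typed S {sv a (Lolli (arg_ty ((0, \<sigma>1) # map (up 1) \<theta>2)) B), sv b (Lolli (arg_ty \<theta>1) (tyT \<sigma>1))}
    (let_fun \<theta> \<theta>1 \<theta>2 a b) (Lolli (arg_ty \<theta>) B)"
proof -
  let ?w = "width \<theta>" and ?U = "number 0 (upat \<theta>)"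
  let ?Fa = "Lolli (arg_ty ((0, \<sigma>1) # map (up 1) \<theta>2)) B" and ?Fb = "Lolli (arg_ty \<theta>1) (tyT \<sigma>1)"
  let ?D = "{sv (?w + b) ?Fb} \<union> {?U}"
  have ap: "apart {sv (?w + i) A} {?U}" for i A by (rule apart_sv_number) simp
  then have D: "is_env ?D" by (intro is_env_Un) auto
  have "typed S ?D (App (Var (?w + b)) (with_tm (map (uvar \<theta>) \<theta>1))) (tyT \<sigma>1)"
    by (intro typed_App_linear[OF typed_sv typed_utuple] assms ap)
  \<comment> \<open>All components of an additive tuple share one environment, so those that do not
    call the function at \<open>b\<close> must discard it. This is where its wrapping by \<section>
    is used.\<close>
  moreover have "typed S ?D (uvar \<theta> y) (tyT (snd y))" if "y \<in> set \<theta>2" for y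
    by (rule typed_weaken[OF typed_uvar]) (use that assms D in auto)
  ultimately have "typed S ?D (with_tm (App (Var (?w + b)) (with_tm (map (uvar \<theta>) \<theta>1)) # map (uvar \<theta>) \<theta>2))
      (arg_ty ((0, \<sigma>1) # map (up 1) \<theta>2))"
    using D by (intro typed_with_tm) (auto simp: list_all2_map_same up_def comp_def)
  moreover have "apart {sv (?w + a) ?Fa} ?D" using assms(3) by (auto simp: apart_def)
  ultimately have "typed S ({sv (?w + a) ?Fa} \<union> ?D) (App (Var (?w + a))
      (with_tm (App (Var (?w + b)) (with_tm (map (uvar \<theta>) \<theta>1)) # map (uvar \<theta>) \<theta>2))) B"
    by (rule typed_App_linear[OF typed_sv])
  moreover have "{sv (?w + a) ?Fa} \<union> ?D = insert ?U (shift_env (plen (upat \<theta>)) {sv a ?Fa, sv b ?Fb})"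
    by (auto simp: add.commute)
  ultimately show ?thesis unfolding let_fun_def by (metis t_lam pty_number upat_simps(3))
qed

lemma typed_unit_fun:
  assumes "set \<theta>' \<subseteq> set \<theta>"
  shows "typed S {sv a (Lolli (arg_ty \<theta>') B)} (unit_fun \<theta> \<theta>' a) (Lolli (arg_ty \<theta>) B)"
proof -
  let ?w = "width \<theta>" and ?U = "number 0 (upat \<theta>)" and ?F = "Lolli (arg_ty \<theta>') B"
  have "apart {sv (?w + a) ?F} {?U}" by (rule apart_sv_number) simp
  from typed_App_linear[OF typed_sv typed_utuple this, OF assms]
  have "typed S ({sv (?w + a) ?F} \<union> {?U}) (App (Var (?w + a)) (with_tm (map (uvar \<theta>) \<theta>'))) B" .
  moreover have "{sv (?w + a) ?F} \<union> {?U} = insert ?U (shift_env (plen (upat \<theta>)) {sv a ?F})"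
    by (auto simp: add.commute)
  ultimately show ?thesis unfolding unit_fun_def by (metis t_lam pty_number upat_simps(3))
qed

lemma typed_split_fun:
  assumes "distinct \<theta>" "z \<in> set \<theta>" "snd z = LTens \<tau>1 \<tau>2"
  shows "typed S {sv a (Lolli (arg_ty ((0, \<tau>1) # (1, \<tau>2) # map (up 2) (removeAll z \<theta>))) B)}
    (split_fun \<theta> z \<tau>1 \<tau>2 a) (Lolli (arg_ty \<theta>) B)"
proof -
  obtain xs ys where xs: "\<theta> = xs @ z # ys" using split_list[OF assms(2)] by auto
  let ?q = "split_pat \<theta> z \<tau>1 \<tau>2" and ?k = "upos \<theta> z"
  let ?n = "plen ?q" and ?U = "number 0 ?q"
  let ?As = "tyT \<tau>1 # tyT \<tau>2 # map (\<lambda>v. tyT (snd v)) (removeAll z \<theta>)"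
  let ?F = "Lolli (arg_ty ((0, \<tau>1) # (1, \<tau>2) # map (up 2) (removeAll z \<theta>))) B"
  note q = split_pat[OF xs assms(1,3)]
  note nth = split_nth(1-3)[OF xs assms(1), where f = "\<lambda>v. tyT (snd v)" and a = "tyT \<tau>1" and b = "tyT \<tau>2"]
    and less = split_nth(4,5)[OF xs assms(1)]
  have leaf: "typed S {?U} (Var i) (leaves ?q ! i)" if "i < ?n" for i
    using typed_leaf[OF q(2) that, of S 0] by simp
  have "typed S {?U} (Var ?k) (tyT \<tau>1)" "typed S {?U} (Var (?k + 1)) (tyT \<tau>2)"
    using leaf[of ?k] leaf[of "?k + 1"] nth(1,2) less(1) by (simp_all add: q)
  moreover have "typed S {?U} (Var (split_pos \<theta> z v)) (tyT (snd v))" if "v \<in> set (removeAll z \<theta>)" for v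
    using leaf[of "split_pos \<theta> z v"] nth(3)[of v] less(2)[of v] that by (simp add: q)
  ultimately have "typed S {?U} (with_tm (Var ?k # Var (?k + 1) # map (\<lambda>v. Var (split_pos \<theta> z v)) (removeAll z \<theta>))) (with_ty ?As)"
    by (intro typed_with_tm) (auto simp: list_all2_map_same)
  then have "typed S {?U} (with_tm (Var ?k # Var (?k + 1) # map (\<lambda>v. Var (split_pos \<theta> z v)) (removeAll z \<theta>)))
      (arg_ty ((0, \<tau>1) # (1, \<tau>2) # map (up 2) (removeAll z \<theta>)))"
    by (simp add: up_def comp_def)
  moreover have "apart {sv (?n + a) ?F} {?U}" by (rule apart_sv_number) simp
  ultimately have "typed S ({sv (?n + a) ?F} \<union> {?U}) (App (Var (?n + a))
      (with_tm (Var ?k # Var (?k + 1) # map (\<lambda>v. Var (split_pos \<theta> z v)) (removeAll z \<theta>)))) B"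
    by (rule typed_App_linear[OF typed_sv])
  moreover have "{sv (?n + a) ?F} \<union> {?U} = insert ?U (shift_env ?n {sv a ?F})"
    by (auto simp: add.commute)
  ultimately show ?thesis unfolding split_fun_def by (metis t_lam pty_number q(3))
qed

text \<open>The result of the call is bound linearly and then absorbed by \<open>Top\<close>, which
  is typable in every environment.\<close>

lemma typed_drop_fun:
  "typed S {sv a (Lolli (arg_ty \<theta>) (tyT \<sigma>))} (drop_fun \<theta> \<sigma> a) (Lolli (arg_ty \<theta>) TopT)"
proof -
  let ?F = "Lolli (arg_ty \<theta>) (tyT \<sigma>)" and ?x = "PVar (0, arg_ty \<theta>)"
  have "typed S ({sv (Suc a) ?F} \<union> {?x}) (App (Var (Suc a)) (Var 0)) (tyT \<sigma>)"
    by (intro typed_App_linear[OF typed_sv] t_var) (simp add: apart_def)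
  moreover have "typed S {} (Lam (PVar (tyT \<sigma>)) Top) (Lolli (tyT \<sigma>) TopT)"
    using t_lam[of S "PVar (tyT \<sigma>)" "{}" Top TopT] by (simp add: t_top)
  ultimately have "typed S ({} \<union> ({sv (Suc a) ?F} \<union> {?x})) (LetIn (PVar (tyT \<sigma>)) (App (Var (Suc a)) (Var 0)) Top) TopT"
    using typed_App_linear by (metis apart_simps(1))
  then show ?thesis
    using t_lam[of S "PVar (arg_ty \<theta>)" "{sv a ?F}"] unfolding drop_fun_def
    by (simp add: insert_commute)
qed

lemma typed_zero: "is_env D \<Longrightarrow> typed S D (zero_tm (tyT \<tau>)) (tyT \<tau>)"
  by (induction \<tau>) (auto intro: typed.intros)

lemma typed_plus: "typed S {} (plus_tm (tyT \<tau>)) (Lolli (WithT (tyT \<tau>) (tyT \<tau>)) (tyT \<tau>))"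
proof (induction \<tau>)
  case LReal
  then show ?case by (simp add: t_plus)
next
  case LOne
  then show ?case
    using t_lam[of S "PWith (PVar TopT) (PVar TopT)" "{}" Top TopT] is_env_simps(5)[of 0 "PWith (PVar TopT) (PVar TopT)"]
    by (simp add: t_top)
next
  case (LTens \<tau> \<sigma>)
  let ?H = "tyT \<tau>" and ?K = "tyT \<sigma>"
  let ?p = "PWith (PWith (PVar ?H) (PVar ?K)) (PWith (PVar ?H) (PVar ?K))"
  have leaf: "typed S {number 0 ?p} (Var i) (leaves ?p ! i)" if "i < 4" for i
    using typed_leaf[of ?p i S 0] that by simp
  have "typed S {number 0 ?p} (With (Var 0) (Var 2)) (WithT ?H ?H)" "typed S {number 0 ?p} (With (Var 1) (Var 3)) (WithT ?K ?K)"
    using leaf[of 0] leaf[of 1] leaf[of 2] leaf[of 3] by (auto intro!: t_with simp: numeral_eq_Suc)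
  from this[THEN typed_App_linear[rotated]] LTens
  have "typed S {number 0 ?p} (App (plus_tm ?H) (With (Var 0) (Var 2))) ?H"
    "typed S {number 0 ?p} (App (plus_tm ?K) (With (Var 1) (Var 3))) ?K" by force+
  from t_with[OF this] show ?case using t_lam[of S ?p "{}" _ "WithT ?H ?K"] by simp
qed

lemma typed_times: "typed S {PBang (x, RealT)} (times_tm (tyT \<tau>) x) (Lolli (tyT \<tau>) (tyT \<tau>))"
proof (induction \<tau> arbitrary: x)
  case LReal
  then show ?case
    using typed_App_linear[OF t_times t_bvar] by (metis apart_simps(1) sup_bot_left times_tm.simps(1) tyT.simps(1))
next
  case LOne
  have "is_env {PVar (0, TopT), PBang (Suc x, RealT)}" by (auto simp: is_env_def)
  then show ?case
    using t_lam[of S "PVar TopT" "{PBang (x, RealT)}" Top TopT] by (simp add: t_top)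
next
  case (LTens \<tau> \<sigma>)
  let ?H = "tyT \<tau>" and ?K = "tyT \<sigma>"
  let ?p = "PWith (PVar ?H) (PVar ?K)" and ?x = "PBang (x + 2, RealT)"
  have leaf: "typed S {number 0 ?p} (Var i) (leaves ?p ! i)" if "i < 2" for i
    using typed_leaf[of ?p i S 0] that by simp
  have ap: "apart {?x} {number 0 ?p}" by (auto simp: apart_def)
  have "typed S ({?x} \<union> {number 0 ?p}) (App (times_tm ?H (x + 2)) (Var 0)) ?H"
    using leaf[of 0] by (intro typed_App_linear[OF LTens.IH(1) _ ap]) simp
  moreover have "typed S ({?x} \<union> {number 0 ?p}) (App (times_tm ?K (x + 2)) (Var 1)) ?K"
    using leaf[of 1] by (intro typed_App_linear[OF LTens.IH(2) _ ap]) simp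
  ultimately have "typed S ({?x} \<union> {number 0 ?p}) (With (App (times_tm ?H (x + 2)) (Var 0)) (App (times_tm ?K (x + 2)) (Var 1))) (WithT ?H ?K)"
    by (rule t_with)
  then show ?case using t_lam[of S ?p "{PBang (x, RealT)}" _ "WithT ?H ?K"] by (simp add: insert_commute)
qed

subsection \<open>Typing of the translation\<close>

text \<open>Environments of exponentials as partial maps, so that scopes are computed with
  \<open>case_nat\<close>; \<open>None\<close> can mark an index held by a function variable, which
  is then listed separately.\<close>

definition benv :: "(nat \<rightharpoonup> ty) \<Rightarrow> env" where
  "benv X = {PBang (i, A) | i A. X i = Some A}"

lemma benv_image: "benv X = (\<lambda>i. PBang (i, the (X i))) ` dom X"
  by (force simp: benv_def image_iff)

lemma evars_benv [simp]: "evars (benv X) = dom X"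
  by (simp add: evars_def benv_image)

lemma bang_env_benv [simp]: "bang_env (benv X)"
  by (auto simp: bang_env_def benv_def)

lemma is_env_benv [simp]: "finite (dom X) \<Longrightarrow> is_env (benv X)"
  by (auto simp: is_env_def benv_image)

lemma PBang_in_benv [simp]: "PBang (i, A) \<in> benv X \<longleftrightarrow> X i = Some A"
  by (auto simp: benv_def)

lemma shift_env_0 [simp]: "shift_env 0 D = D"
proof -
  have "(\<lambda>(i, A). (i + 0, A)) = (id :: nat \<times> ty \<Rightarrow> _)" by auto
  then show ?thesis unfolding shift_env_def by (simp only: pat.map_id0 image_id id_apply)
qed

lemma shift_bang_env: "bang_env G \<Longrightarrow> bang_env (shift_env k G)"
  by (fastforce simp: bang_env_def shift_env_def)

lemma bang_env_insert [simp]: "bang_env (insert (PBang v) D) = bang_env D"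
  by (auto simp: bang_env_def)

lemma in_shift_benv: "p \<in> shift_env k (benv X) \<longleftrightarrow> (\<exists>i A. p = PBang (i + k, A) \<and> X i = Some A)"
  by (auto simp: shift_env_def benv_def intro!: image_eqI[of _ _ "PBang (i, A)" for i A])

lemma env_eqI:
  assumes "bang_env D" "bang_env E" "\<And>i A. PBang (i, A) \<in> D \<longleftrightarrow> PBang (i, A) \<in> E"
  shows "D = E"
proof -
  have "p \<in> D \<longleftrightarrow> p \<in> E" for p
    using assms(3)[of "fst v" "snd v" for v] assms(1,2) unfolding bang_env_def by (metis prod.collapse)
  then show ?thesis by auto
qed

lemma benv_push: "insert (PBang (0, A)) (shift_env 1 (benv X)) = benv (case_nat (Some A) X)"
proof (rule env_eqI)
  show "PBang (i, B) \<in> insert (PBang (0, A)) (shift_env 1 (benv X)) \<longleftrightarrow> PBang (i, B) \<in> benv (case_nat (Some A) X)" for i B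
    by (cases i) (auto simp: in_shift_benv)
qed (simp_all add: shift_bang_env)

lemma benv_push2: "insert (PBang (0, A)) (shift_env 2 (benv X)) = benv (case_nat (Some A) (case_nat None X))"
proof (rule env_eqI)
  show "PBang (i, B) \<in> insert (PBang (0, A)) (shift_env 2 (benv X)) \<longleftrightarrow>
      PBang (i, B) \<in> benv (case_nat (Some A) (case_nat None X))" for i B
    by (auto simp: in_shift_benv numeral_2_eq_2 split: nat.splits)
qed (simp_all add: shift_bang_env)

lemma finite_dom_case_nat [simp]: "finite (dom (case_nat a X)) \<longleftrightarrow> finite (dom X)"
proof -
  have "dom (case_nat a X) \<subseteq> insert 0 (Suc ` dom X)"
  proof
    show "i \<in> insert 0 (Suc ` dom X)" if "i \<in> dom (case_nat a X)" for i
      using that by (cases i) auto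
  qed
  moreover have "Suc ` dom X \<subseteq> dom (case_nat a X)" by auto
  ultimately show ?thesis by (metis finite_imageD finite_imageI finite_insert finite_subset inj_Suc)
qed

text \<open>Exponentials can be weakened, so the target environment may exceed the image of the
  renaming.\<close>

lemma typed_ren_benv:
  assumes "typed S (benv X) M A" "inj f" "\<forall>i B. X i = Some B \<longrightarrow> Y (f i) = Some B" "finite (dom Y)"
  shows "typed S (benv Y) (ren f M) A"
proof (rule typed_weaken_sup)
  show "typed S (map_env f (benv X)) (ren f M) A"
    using assms(1,2) by (intro typed_ren) (auto intro: inj_on_subset)
  show "map_env f (benv X) \<subseteq> benv Y" using assms(3) by (auto simp: benv_def)
  show "weak_env (benv Y - map_env f (benv X))" by (auto simp: weak_env_def benv_def)
qed (use assms(4) in simp)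

text \<open>The tensor shares \<open>G\<close> and gives \<open>D\<close> to the second component.
  There the additive pair passes the whole environment to \<open>Unit\<close> as well, which has to
  discard it.\<close>

lemma typed_tens_sect:
  assumes "typed S G P A" "typed S (G \<union> D) F B" "bang_env G" "weak_env D" "is_env (G \<union> D)" "apart G D"
  shows "typed S (G \<union> D) (Tens P (sect F)) (TensT A (sect_ty B))"
proof -
  have "is_env G" using assms(5) by (rule is_env_subset) auto
  moreover have "typed S (G \<union> D) Unit OneT"
    using typed_weaken[OF t_unit, of "G \<union> D" S] assms by simp
  ultimately show ?thesis
    using t_tens[of S G "{}" P A G D "sect F" "sect_ty B"] assms by (simp add: t_with)
qed

lemma typed_let_sect:
  assumes "bang_env G" "is_env G" "apart G D" "typed S G F B" "typed S (insert (sv 0 B) (shift_env 1 (G \<union> D))) M C"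
  shows "typed S (G \<union> D) (LetIn (sect_pat (PVar B)) (sect F) M) C"
proof -
  have "typed S (G \<union> D) (Lam (sect_pat (PVar B)) M) (Lolli (sect_ty B) C)"
    using t_lam[of S "sect_pat (PVar B)"] assms(5) by simp
  moreover have "typed S G (sect F) (sect_ty B)"
    using assms typed_weaken[OF t_unit, of G S] by (simp add: t_with)
  ultimately show ?thesis using assms by (intro typed_App_bang)
qed

lemma typed_let_xf:
  assumes "bang_env G" "is_env G" "apart G D"
    and "typed S G N (TensT (OfCourse (tyP (fst r))) (sect_ty (Lolli (arg_ty \<theta>) (tyT (snd r)))))"
    and "typed S (insert (PBang (0, tyP (fst r))) (insert (sv 1 (Lolli (arg_ty \<theta>) (tyT (snd r)))) (shift_env 2 (G \<union> D)))) M C"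
  shows "typed S (G \<union> D) (LetIn (xf_pat \<theta> r) N M) C"
proof -
  let ?A = "tyP (fst r)" and ?B = "Lolli (arg_ty \<theta>) (tyT (snd r))"
  have "typed S (insert (PTens (PBang (0, ?A)) (sv 1 ?B)) (shift_env 2 (G \<union> D))) M C"
    using assms(5) by (intro t_ptens) (auto simp: apart_def evars_shift_env simp del: shift_env_simps evars_simps(2))
  then have "typed S (G \<union> D) (Lam (xf_pat \<theta> r) M) (Lolli (TensT (OfCourse ?A) (sect_ty ?B)) C)"
    using t_lam[of S "xf_pat \<theta> r" "G \<union> D" M C] by (simp add: xf_pat_def numeral_2_eq_2)
  then show ?thesis using assms by (intro typed_App_bang)
qed

definition tctx :: "lctx \<Rightarrow> nat \<rightharpoonup> ty" where
  "tctx G = (\<lambda>i. map_option tyP (G i))"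

lemma tctx_push [simp]: "tctx (push \<tau> G) = case_nat (Some (tyP \<tau>)) (tctx G)"
  by (auto simp: tctx_def push_def fun_eq_iff split: nat.split)

lemma tctx_Some: "G i = Some \<tau> \<Longrightarrow> tctx G i = Some (tyP \<tau>)"
  by (simp add: tctx_def)

lemma dom_tctx [simp]: "dom (tctx G) = dom G"
  by (auto simp: tctx_def dom_def)

abbreviation (input) fun_ty :: "lvar list \<Rightarrow> lty \<Rightarrow> ty" where
  "fun_ty \<theta> \<sigma> \<equiv> Lolli (arg_ty \<theta>) (tyT \<sigma>)"

lemma typed_closed_benv: "typed S {} M A \<Longrightarrow> finite (dom X) \<Longrightarrow> typed S (benv X) M A"
  using typed_weaken[of S "{}" M A "benv X"] by simp

lemma typed_Lam_upat:
  "typed S {number 0 (upat \<theta>)} M B \<Longrightarrow> typed S {} (Lam (upat \<theta>) M) (Lolli (arg_ty \<theta>) B)"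
  using t_lam[of S "upat \<theta>" "{}" M B] by simp

lemma delta_leaf_typed:
  assumes "is_leaf e" "wt S e G" "set \<theta> = FVt e" "finite (dom G)"
  shows "\<exists>P F. delta e \<theta> = Tens P (sect F) \<and> typed S (benv (tctx G)) P (OfCourse (tyP (fst (ety e)))) \<and>
    typed S (benv (tctx G)) F (fun_ty \<theta> (snd (ety e)))"
proof -
  let ?G = "benv (tctx G)"
  have fin: "finite (dom (tctx G))" using assms(4) by simp
  have G: "is_env ?G" using fin by simp
  have unit: "typed S ?G (Bang Unit) (OfCourse OneT)"
    by (intro typed_closed_benv[OF _ fin] closed_BangI t_unit)
  have U: "typed S {number 0 (upat \<theta>)} M B \<Longrightarrow> typed S ?G (Lam (upat \<theta>) M) (Lolli (arg_ty \<theta>) B)" for M B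
    by (intro typed_closed_benv[OF _ fin] typed_Lam_upat)
  have nil: "FVt e = {} \<Longrightarrow> PVar TopT = upat \<theta>" using assms(3) by simp
  show ?thesis
  proof (cases e)
    case (EPair x y)
    have "typed S ?G (Bang (Var (fst x))) (OfCourse (tyP (snd x)))"
      using assms(2) EPair G by (intro typed_bang_var) (auto simp: tctx_def)
    then show ?thesis using EPair assms(3) U[OF typed_uvar] by simp
  next
    case EUnitP
    then show ?thesis using unit U[OF t_top] nil by simp
  next
    case EUnitT
    then show ?thesis using unit U[OF t_top] nil by simp
  next
    case (ETensT x y)
    then show ?thesis using unit U[OF t_with[OF typed_uvar typed_uvar]] assms(3) by simp
  next
    case (EZero \<tau>)
    then show ?thesis using unit U[OF typed_zero] nil by simp
  next
    case (EAdd x y)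
    have "typed S ({} \<union> {number 0 (upat \<theta>)}) (App (plus_tm (tyT (snd x))) (With (uvar \<theta> x) (uvar \<theta> y))) (tyT (snd x))"
      using assms(2,3) EAdd typed_uvar[of x \<theta> S] typed_uvar[of y \<theta> S]
      by (intro typed_App_linear[OF typed_plus] t_with) auto
    then show ?thesis using EAdd unit U by simp
  next
    case (EMul x y)
    let ?w = "width \<theta>" and ?U = "number 0 (upat \<theta>)"
    have "typed S ({PBang (x + ?w, RealT)} \<union> {?U}) (App (times_tm (tyT (snd y)) (x + ?w)) (uvar \<theta> y)) (tyT (snd y))"
      using assms(3) EMul by (intro typed_App_linear[OF typed_times typed_uvar]) (auto simp: apart_def)
    then have "typed S {PBang (x, RealT)} (Lam (upat \<theta>) (App (times_tm (tyT (snd y)) (x + ?w)) (uvar \<theta> y)))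
        (fun_ty \<theta> (snd y))"
      using t_lam[of S "upat \<theta>" "{PBang (x, RealT)}"] by (simp add: insert_commute)
    then have "typed S ?G (Lam (upat \<theta>) (App (times_tm (tyT (snd y)) (x + ?w)) (uvar \<theta> y))) (fun_ty \<theta> (snd y))"
      by (rule typed_weaken_sup) (use assms(2) EMul G in \<open>auto simp: tctx_def weak_env_def benv_def\<close>)
    then show ?thesis using EMul unit by simp
  next
    case (EConst r)
    have "typed S ?G (Bang (Const r)) (OfCourse RealT)"
      by (intro typed_closed_benv[OF _ fin] closed_BangI t_const)
    then show ?thesis using EConst U[OF t_top] nil by simp
  next
    case (EFun f xs)
    have "typed S ?G (nest Tens Unit (map (\<lambda>x. Bang (Var x)) ys)) (nest TensT OneT (replicate (length ys) (OfCourse RealT)))"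
      if "\<forall>x\<in>set ys. G x = Some LReal" for ys
      using that
    proof (induction ys rule: induct_list012)
      case 1
      then show ?case by (simp add: typed_closed_benv[OF t_unit fin])
    next
      case (2 x)
      then show ?case using G by (simp add: typed_bang_var tctx_def)
    next
      case (3 x y ys)
      then have "typed S ?G (Bang (Var x)) (OfCourse RealT)"
        using G by (intro typed_bang_var) (auto simp: tctx_def)
      with 3 G show ?case by (auto intro: typed_Tens_bang)
    qed
    from this[of xs] have "typed S ?G (nest Tens Unit (map (\<lambda>x. Bang (Var x)) xs)) (nest TensT OneT (replicate (arity S f) (OfCourse RealT)))"
      using assms(2) EFun by simp
    from typed_App_linear[OF t_fun this]
    show ?thesis using EFun U[OF t_top] nil by simp
  next
    case (EDup y)
    then show ?thesis using unit U[OF t_with[OF typed_uvar typed_uvar]] assms(3) by simp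
  qed (use assms(1) in auto)
qed

lemma delta_leaf_tens_typed:
  assumes "is_leaf e" "wt S e G" "finite (dom G)" "set \<theta> = FVt e"
  shows "typed S (benv (tctx G)) (delta e \<theta>) (TensT (OfCourse (tyP (fst (ety e)))) (sect_ty (fun_ty \<theta> (snd (ety e)))))"
proof -
  obtain P F where "delta e \<theta> = Tens P (sect F)" "typed S (benv (tctx G)) P (OfCourse (tyP (fst (ety e))))"
    "typed S (benv (tctx G)) F (fun_ty \<theta> (snd (ety e)))"
    using delta_leaf_typed[OF assms(1,2,4,3)] by auto
  then show ?thesis using typed_tens_sect[of S "benv (tctx G)" P _ "{}" F] assms(3) by simp
qed

lemma is_env_shift_env: "is_env G \<Longrightarrow> is_env (shift_env k G)"
  unfolding shift_env_map_env by (rule is_env_map_env) auto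

lemma is_env_shifted_push: "is_env G \<Longrightarrow> is_env (insert (PBang (0, A)) (shift_env 2 G))"
  using is_env_Un[of "{PBang (0, A)}" "shift_env 2 G"]
  by (simp add: apart_def evars_shift_env is_env_shift_env image_iff)

lemma typed_shifted_bang_var:
  "bang_env G \<Longrightarrow> is_env G \<Longrightarrow>
    typed S (insert (PBang (0, A)) (shift_env 2 G)) (Bang (Var 0)) (OfCourse A)"
  using shift_bang_env[of G 2] by (intro typed_bang_var is_env_shifted_push) (auto simp: bang_env_def)

lemma typed_let_xf_tens:
  assumes G: "bang_env G" "is_env G"
    and N: "typed S G N (TensT (OfCourse (tyP (fst r))) (sect_ty (fun_ty \<theta> (snd r))))"
    and P: "typed S (insert (PBang (0, tyP (fst r))) (shift_env 2 G)) P A"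
    and F: "typed S {sv 1 (fun_ty \<theta> (snd r))} F B"
  shows "typed S G (LetIn (xf_pat \<theta> r) N (Tens P (sect F))) (TensT A (sect_ty B))"
proof -
  let ?G = "insert (PBang (0, tyP (fst r))) (shift_env 2 G)" and ?D = "{sv 1 (fun_ty \<theta> (snd r))}"
  have bang: "bang_env ?G" using shift_bang_env[OF G(1)] by (simp add: bang_env_def)
  have "is_env ?G" by (rule is_env_shifted_push[OF G(2)])
  moreover have ap: "apart ?G ?D" by (auto simp: apart_def evars_shift_env)
  ultimately have env: "is_env (?G \<union> ?D)" by (intro is_env_Un) auto
  have "typed S (?G \<union> ?D) F B" by (rule typed_weaken[OF F]) (use shift_bang_env[OF G(1)] env in auto)
  then have "typed S (?G \<union> ?D) (Tens P (sect F)) (TensT A (sect_ty B))"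
    by (intro typed_tens_sect P bang env ap) simp_all
  then have "typed S (G \<union> {}) (LetIn (xf_pat \<theta> r) N (Tens P (sect F))) (TensT A (sect_ty B))"
    using N by (intro typed_let_xf G) (simp_all add: insert_commute)
  then show ?thesis by simp
qed

text \<open>Assuming only the relaxed typing makes the result applicable to the unzipped expression,
  which may fall outside Linear A.\<close>

theorem delta_typed:
  "wt S e G \<Longrightarrow> finite (dom G) \<Longrightarrow> set \<theta> = FVt e \<Longrightarrow> distinct \<theta> \<Longrightarrow>
    typed S (benv (tctx G)) (delta e \<theta>) (TensT (OfCourse (tyP (fst (ety e)))) (sect_ty (fun_ty \<theta> (snd (ety e)))))"
proof (induction e arbitrary: G \<theta>)
  case (ELet e1 e2)
  define \<theta>1 where "\<theta>1 = filter (\<lambda>v. v \<in> FVt e1) \<theta>"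
  define \<theta>2 where "\<theta>2 = filter (\<lambda>v. up 1 v \<in> FVt e2) \<theta>"
  define \<theta>2' where "\<theta>2' = (0, snd (ety e1)) # map (up 1) \<theta>2"
  note \<theta> = filter_FVt_ELet[OF ELet.prems(3,4,1), folded \<theta>1_def \<theta>2_def, folded \<theta>2'_def]
  have sub: "set \<theta>1 \<subseteq> set \<theta>" "set \<theta>2 \<subseteq> set \<theta>" by (auto simp: \<theta>1_def \<theta>2_def)
  let ?G = "benv (tctx G)" and ?A1 = "tyP (fst (ety e1))" and ?A2 = "tyP (fst (ety e2))"
  let ?f = "fun_ty \<theta>1 (snd (ety e1))" and ?g = "fun_ty \<theta>2' (snd (ety e2))"
  let ?T = "TensT (OfCourse ?A2) (sect_ty (fun_ty \<theta> (snd (ety e2))))"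
  have 1: "typed S ?G (delta e1 \<theta>1) (TensT (OfCourse ?A1) (sect_ty ?f))"
    using ELet.IH(1) ELet.prems(1,2) \<theta>(1,2) by simp
  \<comment> \<open>Index 0 is the primal variable; index 1 belongs to the function variable and is
    left out.\<close>
  let ?X1 = "case_nat (Some ?A1) (case_nat None (tctx G))"
  have 2: "typed S (benv ?X1) (ren (liftn 1 Suc) (delta e2 \<theta>2')) (TensT (OfCourse ?A2) (sect_ty ?g))"
  proof (rule typed_ren_benv)
    show "typed S (benv (tctx (push (fst (ety e1)) G))) (delta e2 \<theta>2') (TensT (OfCourse ?A2) (sect_ty ?g))"
      using ELet.IH(2)[of "push (fst (ety e1)) G" \<theta>2'] ELet.prems(1,2) \<theta>(3,4) by simp
    show "inj (liftn 1 Suc)" by (rule inj_liftn) simp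
  qed (use ELet.prems(2) in \<open>auto simp: liftn_def split: nat.split\<close>)
  let ?X2 = "case_nat (Some ?A2) (case_nat None ?X1)"
  let ?D = "{sv 1 ?g, sv 3 ?f}"
  have fin: "finite (dom ?X1)" "finite (dom ?X2)" using ELet.prems(2) by auto
  have ap: "apart (benv ?X2) ?D" by (auto simp: apart_def numeral_3_eq_3)
  have "is_env ?D" by (auto simp: is_env_def)
  then have env: "is_env (benv ?X2 \<union> ?D)" using fin ap by (intro is_env_Un) auto
  have "typed S ?D (let_fun \<theta> \<theta>1 \<theta>2 1 3) (fun_ty \<theta> (snd (ety e2)))"
    unfolding \<theta>2'_def by (rule typed_let_fun) (use sub in auto)
  then have "typed S (benv ?X2 \<union> ?D) (let_fun \<theta> \<theta>1 \<theta>2 1 3) (fun_ty \<theta> (snd (ety e2)))"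
    using env by (intro typed_weaken) auto
  then have body: "typed S (benv ?X2 \<union> ?D) (Tens (Bang (Var 0)) (sect (let_fun \<theta> \<theta>1 \<theta>2 1 3))) ?T"
    using fin env ap by (intro typed_tens_sect typed_bang_var) auto
  have "typed S (benv ?X1 \<union> {sv 1 ?f}) (LetIn (xf_pat \<theta>2' (ety e2)) (ren (liftn 1 Suc) (delta e2 \<theta>2'))
      (Tens (Bang (Var 0)) (sect (let_fun \<theta> \<theta>1 \<theta>2 1 3)))) ?T"
  proof (rule typed_let_xf)
    have "insert (PBang (0, ?A2)) (insert (sv 1 ?g) (shift_env 2 (benv ?X1 \<union> {sv 1 ?f}))) =
        insert (PBang (0, ?A2)) (shift_env 2 (benv ?X1)) \<union> {sv 1 ?g, sv 3 ?f}" by auto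
    with body show "typed S (insert (PBang (0, ?A2)) (insert (sv 1 ?g) (shift_env 2 (benv ?X1 \<union> {sv 1 ?f}))))
        (Tens (Bang (Var 0)) (sect (let_fun \<theta> \<theta>1 \<theta>2 1 3))) ?T" by (simp only: benv_push2)
  qed (use 2 fin in \<open>auto simp: apart_def\<close>)
  moreover have "insert (PBang (0, ?A1)) (insert (sv 1 ?f) (shift_env 2 (?G \<union> {}))) = benv ?X1 \<union> {sv 1 ?f}"
    unfolding benv_push2[symmetric] by auto
  ultimately have "typed S (?G \<union> {}) (LetIn (xf_pat \<theta>1 (ety e1)) (delta e1 \<theta>1)
      (LetIn (xf_pat \<theta>2' (ety e2)) (ren (liftn 1 Suc) (delta e2 \<theta>2'))
        (Tens (Bang (Var 0)) (sect (let_fun \<theta> \<theta>1 \<theta>2 1 3))))) ?T"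
    using 1 ELet.prems(2) by (intro typed_let_xf) simp_all
  then show ?case by (simp add: delta_let_fun(1) Let_def \<theta>1_def \<theta>2_def \<theta>2'_def del: delta.simps)
next
  case (ELetUnitP z e)
  let ?G = "benv (tctx G)" and ?T = "TensT (OfCourse (tyP (fst (ety e)))) (sect_ty (fun_ty \<theta> (snd (ety e))))"
  have "typed S ?G (delta e \<theta>) ?T" using ELetUnitP by simp
  from t_punit[OF this] have "typed S (?G \<union> {}) (Lam PUnit (delta e \<theta>)) (Lolli OneT ?T)"
    using t_lam[of S PUnit ?G] by simp
  moreover have "typed S ?G (Var z) OneT"
    using ELetUnitP.prems by (intro typed_bang_var) (auto simp: tctx_Some)
  ultimately have "typed S (?G \<union> {}) (LetIn PUnit (Var z) (delta e \<theta>)) ?T"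
    using ELetUnitP.prems(2) by (intro typed_App_bang) auto
  then show ?case by simp
next
  case (ELetUnitT z e)
  let ?\<theta>' = "removeAll (z, LOne) \<theta>"
  have \<theta>': "set ?\<theta>' = FVt e" "distinct ?\<theta>'"
    using ELetUnitT.prems by (auto simp: distinct_removeAll)
  have "typed S (benv (tctx G)) (LetIn (xf_pat ?\<theta>' (ety e)) (delta e ?\<theta>') (Tens (Bang (Var 0)) (sect (unit_fun \<theta> ?\<theta>' 1))))
      (TensT (OfCourse (tyP (fst (ety e)))) (sect_ty (fun_ty \<theta> (snd (ety e)))))"
    using ELetUnitT.IH[OF _ _ \<theta>'] ELetUnitT.prems(1,2)
    by (intro typed_let_xf_tens typed_shifted_bang_var typed_unit_fun) auto
  then show ?case by (simp add: delta_let_fun(2) Let_def del: delta.simps)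
next
  case (ELetTensT z \<tau>1 \<tau>2 e)
  let ?z = "(z, LTens \<tau>1 \<tau>2)"
  let ?\<theta>' = "(0, \<tau>1) # (1, \<tau>2) # map (up 2) (removeAll ?z \<theta>)"
  note \<theta>' = removeAll_FVt_ELetTensT[OF ELetTensT.prems(3,4,1)]
  have "typed S {sv 1 (fun_ty ?\<theta>' (snd (ety e)))} (split_fun \<theta> ?z \<tau>1 \<tau>2 1) (fun_ty \<theta> (snd (ety e)))"
    using ELetTensT.prems(3,4) by (intro typed_split_fun) auto
  then have "typed S (benv (tctx G)) (LetIn (xf_pat ?\<theta>' (ety e)) (delta e ?\<theta>')
      (Tens (Bang (Var 0)) (sect (split_fun \<theta> ?z \<tau>1 \<tau>2 1))))
      (TensT (OfCourse (tyP (fst (ety e)))) (sect_ty (fun_ty \<theta> (snd (ety e)))))"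
    using ELetTensT.IH[OF _ _ \<theta>'] ELetTensT.prems(1,2)
    by (intro typed_let_xf_tens typed_shifted_bang_var) auto
  then show ?case by (simp add: delta_let_fun(3) Let_def del: delta.simps)
next
  case (EDrop e)
  have "typed S (insert (PBang (0, A)) (shift_env 2 (benv (tctx G)))) (Bang Unit) (OfCourse OneT)" for A
    using is_env_shifted_push[of "benv (tctx G)" A] EDrop.prems(2)
    by (intro typed_bang_unit) (simp_all add: shift_bang_env)
  then have "typed S (benv (tctx G)) (LetIn (xf_pat \<theta> (ety e)) (delta e \<theta>)
      (Tens (Bang Unit) (sect (drop_fun \<theta> (snd (ety e)) 1))))
      (TensT (OfCourse OneT) (sect_ty (fun_ty \<theta> LOne)))"
    using EDrop typed_drop_fun[of S 1 \<theta> "snd (ety e)"] by (intro typed_let_xf_tens) auto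
  then show ?case by (simp add: delta_let_fun(4) del: delta.simps)
qed (rule delta_leaf_tens_typed, simp, assumption+)+

subsection \<open>Typing of the unzipped translation\<close>

text \<open>Only these two kinds of frames arise from translated expressions. Neither binds a linear
  variable, so the environment of the hole is again one of exponentials.\<close>

inductive cty :: "'f signature \<Rightarrow> (nat \<rightharpoonup> ty) \<Rightarrow> 'f lctxt \<Rightarrow> (nat \<rightharpoonup> ty) \<Rightarrow> bool" for S where
  cty_Nil: "cty S X [] X"
| cty_Bang: "typed S (benv X) P (OfCourse A) \<Longrightarrow> cty S (case_nat (Some A) X) E X' \<Longrightarrow>
    cty S X ((PBang A, P) # E) X'"
| cty_Unit: "X z = Some OneT \<Longrightarrow> cty S X E X' \<Longrightarrow> cty S X ((PUnit, Var z) # E) X'"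

lemma cty_finite: "cty S X E X' \<Longrightarrow> finite (dom X') \<longleftrightarrow> finite (dom X)"
  by (induction rule: cty.induct) auto

lemma cty_append: "cty S X E1 X1 \<Longrightarrow> cty S X1 E2 X2 \<Longrightarrow> cty S X (E1 @ E2) X2"
  by (induction rule: cty.induct) (auto intro: cty.intros)

lemma cty_snoc: "cty S X E X' \<Longrightarrow> typed S (benv X') P (OfCourse A) \<Longrightarrow> cty S X (E @ [(PBang A, P)]) (case_nat (Some A) X')"
  by (rule cty_append) (auto intro: cty.intros)

lemma cty_shift: "cty S X E X' \<Longrightarrow> X' (clen E + i) = X i"
proof (induction arbitrary: i rule: cty.induct)
  case (cty_Bang X P A E X')
  show ?case using cty_Bang.IH[of "Suc i"] by simp
qed simp_all

lemma cplug_typed: "cty S X E X' \<Longrightarrow> finite (dom X) \<Longrightarrow> typed S (benv X') M C \<Longrightarrow> typed S (benv X) (cplug E M) C"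
proof (induction rule: cty.induct)
  case (cty_Bang X P A E X')
  then have "typed S (insert (number 0 (PBang A)) (shift_env (plen (PBang A)) (benv X))) (cplug E M) C"
    by (simp add: benv_push[simplified])
  from typed_App_bang[of S "benv X" "{}", simplified, OF t_lam[OF this]] cty_Bang show ?case by simp
next
  case (cty_Unit X z E X')
  then have "typed S (insert (number 0 PUnit) (shift_env (plen (PUnit :: ty pat)) (benv X))) (cplug E M) C"
    by (simp add: t_punit)
  moreover have "typed S (benv X) (Var z) OneT"
    using cty_Unit by (intro typed_bang_var) auto
  ultimately show ?case
    using typed_App_bang[of S "benv X" "{}", simplified, OF t_lam] cty_Unit by simp
qed simp

text \<open>The renamed stack may have more variables in scope than the original one, hence an
  inclusion of lookups and an existentially quantified \<open>Y'\<close>.\<close>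

lemma cty_cren:
  "cty S X E X' \<Longrightarrow> inj f \<Longrightarrow> \<forall>i A. X i = Some A \<longrightarrow> Y (f i) = Some A \<Longrightarrow> finite (dom Y) \<Longrightarrow>
    \<exists>Y'. cty S Y (cren f E) Y' \<and> (\<forall>i A. X' i = Some A \<longrightarrow> Y' (liftn (clen E) f i) = Some A)"
proof (induction arbitrary: Y f rule: cty.induct)
  case (cty_Nil X)
  then show ?case by (auto intro: cty.intros)
next
  case (cty_Bang X P A E X')
  have "\<forall>i B. case_nat (Some A) X i = Some B \<longrightarrow> case_nat (Some A) Y (liftn (Suc 0) f i) = Some B"
    using cty_Bang.prems(2) by (auto simp: liftn_def split: nat.splits)
  from cty_Bang.IH[OF inj_liftn[OF cty_Bang.prems(1)] this] cty_Bang.prems(3) obtain Y' where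
    Y': "cty S (case_nat (Some A) Y) (cren (liftn (Suc 0) f) E) Y'"
    "\<forall>i A. X' i = Some A \<longrightarrow> Y' (liftn (clen E) (liftn (Suc 0) f) i) = Some A" by auto
  have "typed S (benv Y) (ren f P) (OfCourse A)"
    using cty_Bang.hyps(1) cty_Bang.prems by (rule typed_ren_benv)
  from cty.cty_Bang[OF this Y'(1)] Y'(2) show ?case by (auto simp: liftn_liftn)
next
  case (cty_Unit X z E X')
  from cty_Unit.IH[OF cty_Unit.prems] obtain Y' where
    "cty S Y (cren f E) Y'" "\<forall>i A. X' i = Some A \<longrightarrow> Y' (liftn (clen E) f i) = Some A" by auto
  then show ?case using cty_Unit.hyps(1) cty_Unit.prems(2) by (auto intro!: cty.cty_Unit)
qed

lemma typed_let_sect_benv: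
  assumes "typed S (benv X) F B" "typed S {sv 0 B} M C" "finite (dom X)"
  shows "typed S (benv X) (LetIn (sect_pat (PVar B)) (sect F) M) C"
proof -
  have bang: "bang_env (shift_env 1 (benv X))" by (rule shift_bang_env) simp
  have "is_env (shift_env 1 (benv X) \<union> {sv 0 B})"
    by (rule is_env_Un) (use assms(3) in \<open>auto simp: is_env_shift_env apart_def evars_shift_env\<close>)
  then have "typed S (shift_env 1 (benv X) \<union> {sv 0 B}) M C"
    using assms(2) bang by (intro typed_weaken) auto
  then have "typed S (insert (sv 0 B) (shift_env 1 (benv X \<union> {}))) M C" by simp
  from typed_let_sect[OF _ _ _ assms(1) this] assms(3) show ?thesis by simp
qed

lemma snoc_typed:
  assumes "cty S (tctx G) E X" "typed S (benv X) P (OfCourse A)" "typed S (benv X) F B" "finite (dom G)"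
  shows "cty S (tctx G) (E @ [(PBang A, P)]) (case_nat (Some A) X)"
    "typed S (benv (case_nat (Some A) X)) (Bang (Var 0)) (OfCourse A)"
    "typed S (benv (case_nat (Some A) X)) (Bang Unit) (OfCourse OneT)"
    "typed S {sv 0 B} M C \<Longrightarrow> typed S (benv (case_nat (Some A) X)) (LetIn (sect_pat (PVar B)) (sect (ren Suc F)) M) C"
proof -
  have fin: "finite (dom (case_nat (Some A) X))" using cty_finite[OF assms(1)] assms(4) by simp
  show "cty S (tctx G) (E @ [(PBang A, P)]) (case_nat (Some A) X)" using assms(1,2) by (rule cty_snoc)
  show "typed S (benv (case_nat (Some A) X)) (Bang (Var 0)) (OfCourse A)"
    by (rule typed_bang_var) (use fin in auto)
  show "typed S (benv (case_nat (Some A) X)) (Bang Unit) (OfCourse OneT)"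
    by (rule typed_bang_unit) (use fin in auto)
  have "typed S (benv (case_nat (Some A) X)) (ren Suc F) B"
    using assms(3) by (rule typed_ren_benv) (use fin in auto)
  then show "typed S (benv (case_nat (Some A) X)) (LetIn (sect_pat (PVar B)) (sect (ren Suc F)) M) C"
    if "typed S {sv 0 B} M C" using that fin by (rule typed_let_sect_benv)
qed

lemma uz_leaf_typed:
  assumes "is_leaf e" "wt S e G" "finite (dom G)" "set \<theta> = FVt e" "uz e \<theta> = (E, P, F)"
  shows "\<exists>X. cty S (tctx G) E X \<and> typed S (benv X) P (OfCourse (tyP (fst (ety e)))) \<and>
      typed S (benv X) F (fun_ty \<theta> (snd (ety e)))"
proof -
  obtain P' F' where *: "delta e \<theta> = Tens P' (sect F')" "typed S (benv (tctx G)) P' (OfCourse (tyP (fst (ety e))))"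
    "typed S (benv (tctx G)) F' (fun_ty \<theta> (snd (ety e)))"
    using delta_leaf_typed[OF assms(1,2,4,3)] by auto
  moreover have "uz e \<theta> = unzb (delta e \<theta>)" using assms(1) by (cases e) auto
  ultimately show ?thesis using assms(5) by (auto intro: cty_Nil)
qed

theorem uz_typed:
  "wt S e G \<Longrightarrow> finite (dom G) \<Longrightarrow> set \<theta> = FVt e \<Longrightarrow> distinct \<theta> \<Longrightarrow> uz e \<theta> = (E, P, F) \<Longrightarrow>
    \<exists>X. cty S (tctx G) E X \<and> typed S (benv X) P (OfCourse (tyP (fst (ety e)))) \<and>
      typed S (benv X) F (fun_ty \<theta> (snd (ety e)))"
proof (induction e arbitrary: G \<theta> E P F)
  case (ELet e1 e2)
  define \<theta>1 where "\<theta>1 = filter (\<lambda>v. v \<in> FVt e1) \<theta>"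
  define \<theta>2 where "\<theta>2 = filter (\<lambda>v. up 1 v \<in> FVt e2) \<theta>"
  define \<theta>2' where "\<theta>2' = (0, snd (ety e1)) # map (up 1) \<theta>2"
  note \<theta> = filter_FVt_ELet[OF ELet.prems(3,4,1), folded \<theta>1_def \<theta>2_def, folded \<theta>2'_def]
  have sub: "set \<theta>1 \<subseteq> set \<theta>" "set \<theta>2 \<subseteq> set \<theta>" by (auto simp: \<theta>1_def \<theta>2_def)
  obtain E1 P1 F1 E2 P2 F2 where uz: "uz e1 \<theta>1 = (E1, P1, F1)" "uz e2 \<theta>2' = (E2, P2, F2)"
    by (metis prod_cases3)
  define g where "g = liftn 1 (\<lambda>i. i + clen E1)"
  define g' where "g' = liftn (clen E2) g"
  let ?A1 = "tyP (fst (ety e1))" and ?A2 = "tyP (fst (ety e2))"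
  let ?f = "fun_ty \<theta>1 (snd (ety e1))" and ?g = "fun_ty \<theta>2' (snd (ety e2))"
  have EPF: "E = E1 @ [(PBang ?A1, P1)] @ cren g E2 @ [(PBang ?A2, ren g' P2)]"
    "P = Bang (Var 0)"
    "F = LetIn (sect_pat (PVar ?f)) (sect (ren (\<lambda>i. i + clen E2 + 2) F1))
          (LetIn (sect_pat (PVar ?g)) (sect (ren (\<lambda>i. g' i + 2) F2)) (let_fun \<theta> \<theta>1 \<theta>2 0 1))"
    using ELet.prems(5) unfolding uz.simps Let_def \<theta>1_def[symmetric] \<theta>2_def[symmetric]
    unfolding \<theta>2'_def[symmetric] uz g_def g'_def
    by auto
  obtain X1 where 1: "cty S (tctx G) E1 X1" "typed S (benv X1) P1 (OfCourse ?A1)" "typed S (benv X1) F1 ?f"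
    using ELet.IH(1)[OF _ ELet.prems(2) \<theta>(1,2) uz(1)] ELet.prems(1) by auto
  obtain X2 where 2: "cty S (case_nat (Some ?A1) (tctx G)) E2 X2" "typed S (benv X2) P2 (OfCourse ?A2)"
    "typed S (benv X2) F2 ?g"
    using ELet.IH(2)[OF _ _ \<theta>(3,4) uz(2), of "push (fst (ety e1)) G"] ELet.prems(1,2) by auto
  have g: "inj g" "inj g'" unfolding g_def g'_def by (intro inj_liftn injI; simp)+
  let ?Y = "case_nat (Some ?A1) X1"
  have "\<forall>i A. case_nat (Some ?A1) (tctx G) i = Some A \<longrightarrow> ?Y (g i) = Some A"
    using cty_shift[OF 1(1)] by (auto simp: g_def liftn_def add.commute split: nat.splits)
  from cty_cren[OF 2(1) g(1) this] obtain X3 where 3: "cty S ?Y (cren g E2) X3"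
    "\<forall>i A. X2 i = Some A \<longrightarrow> X3 (g' i) = Some A"
    using cty_finite[OF 1(1)] ELet.prems(2) by (auto simp: g'_def)
  have fin: "finite (dom X3)" using cty_finite[OF 1(1)] cty_finite[OF 3(1)] ELet.prems(2) by simp
  have P2: "typed S (benv X3) (ren g' P2) (OfCourse ?A2)"
    using 2(2) g(2) 3(2) fin by (rule typed_ren_benv)
  let ?X = "case_nat (Some ?A2) X3"
  have E: "cty S (tctx G) E ?X"
    using cty_append[OF cty_snoc[OF 1(1,2)] cty_snoc[OF 3(1) P2]] by (simp add: EPF(1))
  have F1: "typed S (benv ?X) (ren (\<lambda>i. i + clen E2 + 2) F1) ?f"
  proof (rule typed_ren_benv[OF 1(3)])
    have "X3 (clen E2 + Suc i) = X1 i" for i using cty_shift[OF 3(1), of "Suc i"] by simp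
    then show "\<forall>i B. X1 i = Some B \<longrightarrow> ?X (i + clen E2 + 2) = Some B" by (simp add: add.commute)
    show "inj (\<lambda>i. i + clen E2 + 2)" by (rule injI) simp
  qed (use fin in simp)
  \<comment> \<open>\<open>F2\<close> is placed below the let for the function of \<open>e1\<close>,
    whose variable occupies index 0 and does not occur in it.\<close>
  have F2: "typed S (benv (case_nat None ?X)) (ren (\<lambda>i. g' i + 2) F2) ?g"
  proof (rule typed_ren_benv[OF 2(3)])
    show "inj (\<lambda>i. g' i + 2)" using g(2) by (auto intro!: injI dest: injD)
  qed (use 3(2) fin in auto)
  have "typed S {sv 0 ?g, sv 1 ?f} (let_fun \<theta> \<theta>1 \<theta>2 0 1) (fun_ty \<theta> (snd (ety e2)))"
    unfolding \<theta>2'_def by (rule typed_let_fun) (use sub in auto)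
  moreover have shift: "shift_env 1 (benv Z) = benv (case_nat None Z)" for Z
  proof (rule env_eqI)
    show "PBang (i, B) \<in> shift_env 1 (benv Z) \<longleftrightarrow> PBang (i, B) \<in> benv (case_nat None Z)" for i B
      by (cases i) (auto simp: in_shift_benv)
  qed (simp_all add: shift_bang_env)
  have env: "is_env (benv (case_nat None (case_nat None ?X)) \<union> {sv 0 ?g, sv 1 ?f})"
    by (rule is_env_Un) (use fin in \<open>auto simp: apart_def is_env_def[of "{_, _}"]\<close>)
  ultimately have "typed S (benv (case_nat None (case_nat None ?X)) \<union> {sv 0 ?g, sv 1 ?f})
      (let_fun \<theta> \<theta>1 \<theta>2 0 1) (fun_ty \<theta> (snd (ety e2)))"
    by (intro typed_weaken) auto
  moreover have "benv (case_nat None (case_nat None ?X)) \<union> {sv 0 ?g, sv 1 ?f} =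
      insert (sv 0 ?g) (shift_env 1 (benv (case_nat None ?X) \<union> {sv 0 ?f}))"
    using shift by auto
  ultimately have "typed S (benv (case_nat None ?X) \<union> {sv 0 ?f})
      (LetIn (sect_pat (PVar ?g)) (sect (ren (\<lambda>i. g' i + 2) F2)) (let_fun \<theta> \<theta>1 \<theta>2 0 1)) (fun_ty \<theta> (snd (ety e2)))"
    using F2 fin by (intro typed_let_sect) (auto simp: apart_def)
  moreover have "benv (case_nat None ?X) \<union> {sv 0 ?f} = insert (sv 0 ?f) (shift_env 1 (benv ?X \<union> {}))"
    using shift by auto
  ultimately have "typed S (benv ?X \<union> {}) F (fun_ty \<theta> (snd (ety e2)))"
    unfolding EPF(3) using F1 fin by (intro typed_let_sect) auto
  moreover have "typed S (benv ?X) P (OfCourse ?A2)"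
    unfolding EPF(2) by (rule typed_bang_var) (use fin in auto)
  ultimately show ?case using E by auto
next
  case (ELetUnitP z e)
  obtain E1 P1 F1 where uz: "uz e \<theta> = (E1, P1, F1)" by (metis prod_cases3)
  obtain X where "cty S (tctx G) E1 X" "typed S (benv X) P1 (OfCourse (tyP (fst (ety e))))"
      "typed S (benv X) F1 (fun_ty \<theta> (snd (ety e)))"
    using ELetUnitP.IH[OF _ ELetUnitP.prems(2) _ ELetUnitP.prems(4) uz] ELetUnitP.prems(1,3) by auto
  moreover have "tctx G z = Some OneT" using ELetUnitP.prems(1) tctx_Some[of G z LOne] by simp
  ultimately show ?case using ELetUnitP.prems(5) uz by (auto intro!: cty_Unit)
next
  case (ELetUnitT z e)
  let ?\<theta>' = "removeAll (z, LOne) \<theta>"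
  have \<theta>': "set ?\<theta>' = FVt e" "distinct ?\<theta>'"
    using ELetUnitT.prems by (auto simp: distinct_removeAll)
  obtain E1 P1 F1 where uz: "uz e ?\<theta>' = (E1, P1, F1)" by (metis prod_cases3)
  obtain X where X: "cty S (tctx G) E1 X" "typed S (benv X) P1 (OfCourse (tyP (fst (ety e))))"
      "typed S (benv X) F1 (fun_ty ?\<theta>' (snd (ety e)))"
    using ELetUnitT.IH[OF _ ELetUnitT.prems(2) \<theta>' uz] ELetUnitT.prems(1) by auto
  have EPF: "E = E1 @ [(PBang (tyP (fst (ety e))), P1)]" "P = Bang (Var 0)"
    "F = LetIn (sect_pat (PVar (fun_ty ?\<theta>' (snd (ety e))))) (sect (ren Suc F1)) (unit_fun \<theta> ?\<theta>' 0)"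
    using ELetUnitT.prems(5) uz by (simp_all add: Let_def)
  show ?case
    using snoc_typed[OF X ELetUnitT.prems(2)] typed_unit_fun[of ?\<theta>' \<theta> S 0 "tyT (snd (ety e))"]
    unfolding EPF by auto
next
  case (ELetTensT z \<tau>1 \<tau>2 e)
  let ?z = "(z, LTens \<tau>1 \<tau>2)"
  let ?\<theta>' = "(0, \<tau>1) # (1, \<tau>2) # map (up 2) (removeAll ?z \<theta>)"
  note \<theta>' = removeAll_FVt_ELetTensT[OF ELetTensT.prems(3,4,1)]
  obtain E1 P1 F1 where uz: "uz e ?\<theta>' = (E1, P1, F1)" by (metis prod_cases3)
  obtain X where X: "cty S (tctx G) E1 X" "typed S (benv X) P1 (OfCourse (tyP (fst (ety e))))"
      "typed S (benv X) F1 (fun_ty ?\<theta>' (snd (ety e)))"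
    using ELetTensT.IH[OF _ ELetTensT.prems(2) \<theta>' uz] ELetTensT.prems(1) by auto
  have EPF: "E = E1 @ [(PBang (tyP (fst (ety e))), P1)]" "P = Bang (Var 0)"
    "F = LetIn (sect_pat (PVar (fun_ty ?\<theta>' (snd (ety e))))) (sect (ren Suc F1)) (split_fun \<theta> ?z \<tau>1 \<tau>2 0)"
    using ELetTensT.prems(5) uz by (simp_all add: Let_def)
  have "typed S {sv 0 (fun_ty ?\<theta>' (snd (ety e)))} (split_fun \<theta> ?z \<tau>1 \<tau>2 0) (fun_ty \<theta> (snd (ety e)))"
    using ELetTensT.prems(3,4) by (intro typed_split_fun) auto
  then show ?case using snoc_typed[OF X ELetTensT.prems(2)] unfolding EPF by auto
next
  case (EDrop e)
  obtain E1 P1 F1 where uz: "uz e \<theta> = (E1, P1, F1)" by (metis prod_cases3)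
  obtain X where X: "cty S (tctx G) E1 X" "typed S (benv X) P1 (OfCourse (tyP (fst (ety e))))"
      "typed S (benv X) F1 (fun_ty \<theta> (snd (ety e)))"
    using EDrop.IH[OF _ EDrop.prems(2) _ EDrop.prems(4) uz] EDrop.prems(1,3) by auto
  have EPF: "E = E1 @ [(PBang (tyP (fst (ety e))), P1)]" "P = Bang Unit"
    "F = LetIn (sect_pat (PVar (fun_ty \<theta> (snd (ety e))))) (sect (ren Suc F1)) (drop_fun \<theta> (snd (ety e)) 0)"
    using EDrop.prems(5) uz by (simp_all add: Let_def)
  show ?case
    using snoc_typed[OF X EDrop.prems(2)] typed_drop_fun[of S 0 \<theta> "snd (ety e)"]
    unfolding EPF by auto
qed (rule uz_leaf_typed, simp, assumption+)+

corollary unzip_delta_typed: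
  assumes "wt S e G" "finite (dom G)" "set \<theta> = FVt e" "distinct \<theta>"
  shows "typed S (benv (tctx G)) (unzip (delta e \<theta>))
    (TensT (OfCourse (tyP (fst (ety e)))) (sect_ty (fun_ty \<theta> (snd (ety e)))))"
proof -
  obtain E P F where uz: "uz e \<theta> = (E, P, F)" by (metis prod_cases3)
  obtain X where X: "cty S (tctx G) E X" "typed S (benv X) P (OfCourse (tyP (fst (ety e))))"
      "typed S (benv X) F (fun_ty \<theta> (snd (ety e)))"
    using uz_typed[OF assms uz] by auto
  have "unzip (delta e \<theta>) = cplug E (Tens P (sect F))"
    using unzb_delta[OF assms(3,4,1)] uz by (simp add: unzip_def)
  moreover have "typed S (benv X \<union> {}) (Tens P (sect F)) (TensT (OfCourse (tyP (fst (ety e)))) (sect_ty (fun_ty \<theta> (snd (ety e)))))"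
    using X(2,3) cty_finite[OF X(1)] assms(2) by (intro typed_tens_sect) auto
  ultimately show ?thesis using cplug_typed[OF X(1)] assms(2) by simp
qed

subsection \<open>Soundness\<close>

text \<open>\<open>\<mu>\<close> sees only the index of a variable, so the indices themselves have
  to be distinct.\<close>

lemma tangent_env_exists:
  assumes "distinct (map fst \<theta>)" "length ws = length \<theta>"
  shows "\<exists>\<mu>. map (\<lambda>v. \<mu> (fst v)) \<theta> = ws"
proof -
  have "map (\<lambda>v. the (map_of (zip (map fst \<theta>) ws) (fst v))) \<theta> = ws"
  proof (rule nth_equalityI)
    fix i assume "i < length (map (\<lambda>v. the (map_of (zip (map fst \<theta>) ws) (fst v))) \<theta>)"
    then show "map (\<lambda>v. the (map_of (zip (map fst \<theta>) ws) (fst v))) \<theta> ! i = ws ! i"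
      using map_of_zip_nth[of "map fst \<theta>" ws i] assms by simp
  qed (use assms in simp)
  then show ?thesis by (rule exI[of _ "\<lambda>i. the (map_of (zip (map fst \<theta>) ws) i)"])
qed

lemma closed_typed_components:
  assumes "typed S {} M (TensT (OfCourse A) (sect_ty B))" "wreds S M (Tens (Bang V) (sect F))"
  shows "typed S {} V A" "typed S {} F B"
  using wreds_typed[OF assms(2,1)] by (auto dest!: closed_Tens closed_With closed_Bang)

text \<open>Equivalent arguments represent a common tuple, on which both functions represent the
  value given by \<open>h\<close>.\<close>

lemma leq_frep:
  assumes F: "frep S \<theta> \<sigma> F h" "frep S \<theta> \<sigma> F' h" "typed S {} F (fun_ty \<theta> \<sigma>)" "typed S {} F' (fun_ty \<theta> \<sigma>)"
    and "distinct (map fst \<theta>)"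
  shows "leq_closed S (fun_ty \<theta> \<sigma>) F F'"
proof -
  have "leq_closed S (tyT \<sigma>) (App F N) (App F' N')" if leq: "leq_closed S (arg_ty \<theta>) N N'" for N N'
  proof -
    have "lolli_free (arg_ty \<theta>)" by (rule lolli_free_with_ty) auto
    then obtain w where "rep S (arg_ty \<theta>) N w" "rep S (arg_ty \<theta>) N' w" using leq_rep leq by blast
    from leq_arg_tuple[OF this] obtain ws where ws: "length ws = length \<theta>"
      "rep S (arg_ty \<theta>) N (vtuple ws)" "rep S (arg_ty \<theta>) N' (vtuple ws)" by auto
    obtain \<mu> where "map (\<lambda>v. \<mu> (fst v)) \<theta> = ws" using tangent_env_exists[OF assms(5) ws(1)] by blast
    then have "rep S (tyT \<sigma>) (App F N) (h \<mu>)" "rep S (tyT \<sigma>) (App F' N') (h \<mu>)"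
      using F(1,2) ws(2,3) unfolding frep_def by blast+
    then show ?thesis using leq_typed[OF leq] F(3,4) by (intro rep_leq) (auto intro: closed_AppI)
  qed
  then show ?thesis using F(3,4) by (simp add: closed_typed_def)
qed

lemma leq_closed_translations:
  assumes M: "wreds S M (Tens (Bang V) (sect F))" "rep S (tyP \<tau>) V v" "frep S \<theta> \<sigma> F h"
    and N: "wreds S N (Tens (Bang W) (sect F'))" "rep S (tyP \<tau>) W v" "frep S \<theta> \<sigma> F' h"
    and typed: "typed S {} M (TensT (OfCourse (tyP \<tau>)) (sect_ty (fun_ty \<theta> \<sigma>)))"
      "typed S {} N (TensT (OfCourse (tyP \<tau>)) (sect_ty (fun_ty \<theta> \<sigma>)))"
    and dist: "distinct (map fst \<theta>)"
  shows "leq_closed S (TensT (OfCourse (tyP \<tau>)) (sect_ty (fun_ty \<theta> \<sigma>))) M N"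
proof -
  let ?B = "fun_ty \<theta> \<sigma>"
  let ?p = "\<lambda>i M. App (Lam (PWith (PVar OneT) (PVar ?B)) (Var i)) M"
  have t: "typed S {} V (tyP \<tau>)" "typed S {} W (tyP \<tau>)" "typed S {} F ?B" "typed S {} F' ?B"
    using closed_typed_components[OF typed(1) M(1)] closed_typed_components[OF typed(2) N(1)] by auto
  have "leq_closed S (tyP \<tau>) V W" using M(2) N(2) t(1,2) by (rule rep_leq)
  then have bang: "leq_closed S (OfCourse (tyP \<tau>)) (Bang V) (Bang W)"
    using t(1,2) by (auto simp: closed_typed_def intro!: closed_BangI)
  have s: "typed S {} (sect F) (sect_ty ?B)" "typed S {} (sect F') (sect_ty ?B)"
    using t(3,4) by (auto intro: t_with t_unit)
  have p: "typed S {} (?p 0 X) OneT" "typed S {} (?p 1 X) ?B" if "typed S {} X (sect_ty ?B)" for X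
    using typed_proj_With that by (blast intro: closed_AppI)+
  have r: "wreds S (?p 0 (sect X)) Unit" "wreds S (?p 1 (sect X)) X" for X
    using wreds_proj_With[of S "sect X" Unit X] by auto
  have "leq_closed S OneT (?p 0 (sect F)) (?p 0 (sect F'))"
    by (rule rep_leq[of _ _ _ VU]) (use r(1) p(1) s in auto)
  \<comment> \<open>Expansion is applied to \<open>frep\<close>, before passing to
    \<open>leq_closed\<close>.\<close>
  moreover have "leq_closed S ?B (?p 1 (sect F)) (?p 1 (sect F'))"
    by (rule leq_frep[OF frep_expand[OF M(3) r(2)] frep_expand[OF N(3) r(2)] p(2)[OF s(1)] p(2)[OF s(2)] dist])
  ultimately have "leq_closed S (sect_ty ?B) (sect F) (sect F')"
    using s by (simp add: closed_typed_def)
  then show ?thesis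
    using bang typed M(1)[THEN wreds_reds] N(1)[THEN wreds_reds]
    unfolding leq_closed.simps(3) closed_typed_def by blast
qed

text \<open>The reducts \<open>M'\<close> and \<open>N'\<close> given by the exponential clause are
  beta-equal to \<open>M\<close> and \<open>N\<close>, the situation for which
  \<open>leq_rep_beta_eq\<close> is stated in its generality.\<close>

lemma leq_Bang_rep:
  assumes "leq_closed S (OfCourse (tyP \<tau>)) (Bang M) (Bang N)"
  shows "typed S {} M (tyP \<tau>)" "typed S {} N (tyP \<tau>)" "\<exists>v. rep S (tyP \<tau>) M v \<and> rep S (tyP \<tau>) N v"
proof -
  show t: "typed S {} M (tyP \<tau>)" "typed S {} N (tyP \<tau>)"
    using assms by (auto simp: closed_typed_def dest!: closed_Bang)
  obtain M' N' where *: "reds S (Bang M) (Bang M')" "reds S (Bang N) (Bang N')" "leq_closed S (tyP \<tau>) M' N'"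
    using assms by auto
  have "beta_eq S M' M" "beta_eq S N' N"
    using *(1,2)[THEN reds_beta_eq, THEN equivclp_sym, THEN beta_eq_Bang_inj] .
  then show "\<exists>v. rep S (tyP \<tau>) M v \<and> rep S (tyP \<tau>) N v"
    using leq_rep_beta_eq[OF _ *(3)] t by (simp add: typed_closed_Red)
qed

theorem theorem6p1:
  fixes S :: "'f signature" and G D :: lctx and e :: "'f exp" and \<tau> \<sigma> :: lty and \<theta> :: "lvar list"
  assumes "wf_signature S"
    and "lin_typed S G D e \<tau> \<sigma>"
    and "distinct \<theta>" and "set \<theta> = Map.graph D"
  shows "log_equiv S {PBang (x, tyP \<tau>') | x \<tau>'. G x = Some \<tau>'}
           (TensT (OfCourse (tyP \<tau>)) (sect_ty (Lolli (arg_ty \<theta>) (tyT \<sigma>))))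
           (unzip (delta e \<theta>)) (delta (unzip_jax e) \<theta>)"
proof -
  let ?E = "{PBang (x, tyP \<tau>') | x \<tau>'. G x = Some \<tau>'}"
  let ?T = "TensT (OfCourse (tyP \<tau>)) (sect_ty (fun_ty \<theta> \<sigma>))"
  let ?M = "unzip (delta e \<theta>)" and ?N = "delta (unzip_jax e) \<theta>"
  have E: "?E = benv (tctx G)" by (auto simp: benv_def tctx_def)
  have wt: "wt S e G" using assms(2) by (rule wt_lin_typed) simp
  have ety: "ety e = (\<tau>, \<sigma>)" using assms(2) by (rule ety_lin_typed)
  have \<theta>: "set \<theta> = FVt e" using assms(2,4) by (simp add: FVt_lin_typed)
  have fin: "finite (dom G)" using assms(2) by (rule finite_lin_typed)
  \<comment> \<open>A graph assigns one type to each index, so distinct entries have distinct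
    indices.\<close>
  have dist: "distinct (map fst \<theta>)"
    using assms(3,4) by (auto simp: distinct_map inj_on_def graph_def)
  note jax = unzip_jax_wt[OF wt]
  have \<theta>': "set \<theta> = FVt (unzip_jax e)" using \<theta> jax(3) by simp
  have typed: "typed S ?E ?M ?T" "typed S ?E ?N ?T"
    using unzip_delta_typed[OF wt fin \<theta> assms(3)] delta_typed[OF jax(1) fin \<theta>' assms(3)]
    unfolding E jax(2) ety by simp_all
  moreover have "leq_closed S ?T (subst s ?M) (subst s' ?N)"
    if leq: "\<forall>p\<in>?E. leq_closed S (pty p) (value_of s p) (value_of s' p)" for s s'
  proof -
    have *: "leq_closed S (OfCourse (tyP \<tau>')) (Bang (s x)) (Bang (s' x))" if "G x = Some \<tau>'" for x \<tau>'
      using leq that by fastforce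
    \<comment> \<open>One value serves both substitutions; choosing it for each \<open>x\<close>
      yields the environment \<open>\<rho>\<close> in which the two sides meet. Outside the domain
      of \<open>G\<close> any value does.\<close>
    have "\<forall>x. \<exists>v. \<forall>\<tau>'. G x = Some \<tau>' \<longrightarrow> rep S (tyP \<tau>') (s x) v \<and> rep S (tyP \<tau>') (s' x) v"
    proof
      fix x
      show "\<exists>v. \<forall>\<tau>'. G x = Some \<tau>' \<longrightarrow> rep S (tyP \<tau>') (s x) v \<and> rep S (tyP \<tau>') (s' x) v"
        using leq_Bang_rep(3)[OF *, of x] by (cases "G x") auto
    qed
    then obtain \<rho> where \<rho>: "renv S G s \<rho>" "renv S G s' \<rho>" unfolding renv_def by metis
    have evT: "evT S (unzip_jax e) \<rho> = evT S e \<rho>" by (rule ext) (rule unzip_jax_sound)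
    note M = unzip_delta_rep[OF wt \<rho>(1) \<theta> assms(3)] and N = delta_rep[OF jax(1) \<rho>(2) \<theta>' assms(3)]
    have "typed S {} (subst s ?M) ?T" "typed S {} (subst s' ?N) ?T"
      using leq_Bang_rep(1,2)[OF *] by (auto intro!: typed_subst_closed[OF typed(1)] typed_subst_closed[OF typed(2)])
    moreover obtain V F where "wreds S (subst s ?M) (Tens (Bang V) (sect F))"
      "rep S (tyP \<tau>) V (evP S e \<rho>)" "frep S \<theta> \<sigma> F (evT S e \<rho>)"
      using M ety by auto
    moreover obtain W F' where "wreds S (subst s' ?N) (Tens (Bang W) (sect F'))"
      "rep S (tyP \<tau>) W (evP S e \<rho>)" "frep S \<theta> \<sigma> F' (evT S e \<rho>)"
      using N ety jax(2) unzip_jax_sound(1)[of S e \<rho>] evT by auto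
    ultimately show ?thesis using dist by (intro leq_closed_translations)
  qed
  ultimately show ?thesis unfolding log_equiv_def by blast
qed

end
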